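(* Let $\Gamma$ be a countable group and let $\alpha\colon \Gamma \curvearrowright X$ be an action by homeomorphisms on a compact, metrizable, $0$-dimensional space $X$. The following are equivalent: (i) the topological full group $[\![\alpha]\!]$ admits a dense locally finite subgroup; (ii) $[\![\alpha]\!]$ admits a dense ample subgroup; (iii) the clopen type semigroup $T(\alpha)$ is unperforated and cancellative.
   Context: Clopen type semigroup: let $Y = X\times\mathbb N$ (with $\mathbb N=\{0,1,2,\dots\}$), and let $\tilde\Gamma=\Gamma\times\mathfrak S$, where $\mathfrak S$ is the permutation group of $\mathbb N$, act on $Y$ by $(\gamma,\sigma)(x,n)=(\alpha(\gamma)x,\sigma(n))$. A clopen $A\subseteq Y$ is bounded if $A\cap(X\times\{n\})=\emptyset$ for all large $n$. Two bounded clopen sets $A,B$ are equidecomposable if there are clopen $A_1,\dots,A_n$ and $\tilde\gamma_1,\dots,\tilde\gamma_n\in\tilde\Gamma$ with $A=\bigsqcup_i A_i$ and $B=\bigsqcup_i\tilde\gamma_iA_i$. $T(\alpha)$ is the set of equivalence classes $[A]$ of bounded clopen sets, with $[A]+[B]=[A'\sqcup B']$ for disjoint representatives $A'\in[A]$, $B'\in[B]$; it is a commutative monoid with $0=[\emptyset]$. Write $a\le b$ iff $b=a+c$ for some $c\in T(\alpha)$. $T(\alpha)$ is unperforated if $na\le nb\Rightarrow a\le b$ for all $a,b$ and all integers $n\ge1$; cancellative if $a+b=a+c\Rightarrow b=c$. $\mathrm{Homeo}(X)$ carries the topology in which a basis of neighbourhoods of the identity is given by the subgroups $\{g: gA=A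 \text{ for all } A\in\mathcal A\}$, $\mathcal A$ ranging over finite clopen partitions of $X$; subgroups carry the induced topology. The topological full group $[\![\alpha]\!]$ is the group of homeomorphisms $g$ of $X$ for which there exist a clopen partition $X=\bigsqcup_{i=1}^nA_i$ and $\gamma_1,\dots,\gamma_n\in\Gamma$ with $g(x)=\alpha(\gamma_i)(x)$ for $x\in A_i$. A subgroup $G\le \mathrm{Homeo}(X)$ is an ample group if it is countable, locally finite, full (every homeomorphism $h$ for which there exist a clopen partition $X=\bigsqcup A_i$ and $g_i\in G$ with $h=g_i$ on $A_i$ belongs to $G$), and $\{x: g(x)=x\}$ is clopen for each $g\in G$. *)

theory Defs
  imports "HOL-Analysis.Analysis" "HOL-Algebra.Generated_Groups"
begin

definition clopen :: "'a::topological_space set \<Rightarrow> bool" where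
  "clopen A \<longleftrightarrow> open A \<and> closed A"

definition zero_dimensional_space :: "'a::topological_space itself \<Rightarrow> bool" where
  "zero_dimensional_space _ \<longleftrightarrow>
     (\<forall>U x. open (U::'a set) \<and> x \<in> U \<longrightarrow> (\<exists>C. clopen C \<and> x \<in> C \<and> C \<subseteq> U))"

(* finite clopen partition of X (empty pieces are harmless) *)
definition clopen_partition :: "'x::topological_space set set \<Rightarrow> bool" where
  "clopen_partition P \<longleftrightarrow> finite P \<and> (\<forall>A\<in>P. clopen A) \<and> \<Union>P = UNIV \<and> disjoint P"

definition Homeo :: "('x::topological_space \<Rightarrow> 'x) set" where
  "Homeo = {f. \<exists>g. homeomorphism UNIV UNIV f g}"

definition homeo_group :: "('x::topological_space \<Rightarrow> 'x) monoid" where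
  "homeo_group = \<lparr>carrier = Homeo, mult = (\<circ>), one = id\<rparr>"

(* the topology on Homeo(X): basic neighbourhoods of f are f U_P = {g. g A = f A for A \<in> P} *)
definition homeo_top :: "('x::topological_space \<Rightarrow> 'x) topology" where
  "homeo_top = topology (\<lambda>U. U \<subseteq> Homeo \<and>
     (\<forall>f\<in>U. \<exists>P. clopen_partition P \<and> {g\<in>Homeo. \<forall>A\<in>P. g ` A = f ` A} \<subseteq> U))"

definition dense_subgroup_of :: "('x::topological_space \<Rightarrow> 'x) set \<Rightarrow> ('x \<Rightarrow> 'x) set \<Rightarrow> bool" where
  "dense_subgroup_of H K \<longleftrightarrow> subgroup H homeo_group \<and> H \<subseteq> K \<and>
     (subtopology homeo_top K) closure_of H = K"

definition topological_full_group ::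
    "('g, 'b) monoid_scheme \<Rightarrow> ('g \<Rightarrow> 'x::topological_space \<Rightarrow> 'x) \<Rightarrow> ('x \<Rightarrow> 'x) set" where
  "topological_full_group G \<alpha> = {f \<in> Homeo. \<exists>P. clopen_partition P \<and>
       (\<forall>A\<in>P. \<exists>\<gamma>\<in>carrier G. \<forall>x\<in>A. f x = \<alpha> \<gamma> x)}"

definition locally_finite_group :: "('x::topological_space \<Rightarrow> 'x) set \<Rightarrow> bool" where
  "locally_finite_group H \<longleftrightarrow> subgroup H homeo_group \<and>
     (\<forall>F. finite F \<and> F \<subseteq> H \<longrightarrow> finite (generate homeo_group F))"

definition ample_group :: "('x::topological_space \<Rightarrow> 'x) set \<Rightarrow> bool" where
  "ample_group H \<longleftrightarrow> countable H \<and> locally_finite_group H \<and>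
     (\<forall>h\<in>Homeo. (\<exists>P. clopen_partition P \<and> (\<forall>A\<in>P. \<exists>g\<in>H. \<forall>x\<in>A. h x = g x)) \<longrightarrow> h \<in> H) \<and>
     (\<forall>g\<in>H. clopen {x. g x = x})"

definition bounded_clopen :: "('x::topological_space \<times> nat) set \<Rightarrow> bool" where
  "bounded_clopen A \<longleftrightarrow> clopen A \<and> (\<exists>N. \<forall>n\<ge>N. A \<inter> (UNIV \<times> {n}) = {})"

definition equidecomposable ::
    "('g, 'b) monoid_scheme \<Rightarrow> ('g \<Rightarrow> 'x::topological_space \<Rightarrow> 'x) \<Rightarrow>
     ('x \<times> nat) set \<Rightarrow> ('x \<times> nat) set \<Rightarrow> bool" where
  "equidecomposable G \<alpha> A B \<longleftrightarrow>
     (\<exists>n::nat. \<exists>Ai \<gamma> \<sigma>. (\<forall>i<n. clopen (Ai i) \<and> \<gamma> i \<in> carrier G \<and> bij (\<sigma> i :: nat \<Rightarrow> nat)) \<and>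
        A = (\<Union>i<n. Ai i) \<and> (\<forall>i<n. \<forall>j<n. i \<noteq> j \<longrightarrow> Ai i \<inter> Ai j = {}) \<and>
        B = (\<Union>i<n. (\<lambda>(x, k). (\<alpha> (\<gamma> i) x, \<sigma> i k)) ` Ai i) \<and>
        (\<forall>i<n. \<forall>j<n. i \<noteq> j \<longrightarrow>
           (\<lambda>(x, k). (\<alpha> (\<gamma> i) x, \<sigma> i k)) ` Ai i \<inter> (\<lambda>(x, k). (\<alpha> (\<gamma> j) x, \<sigma> j k)) ` Ai j = {}))"

definition tclass ::
    "('g, 'b) monoid_scheme \<Rightarrow> ('g \<Rightarrow> 'x::topological_space \<Rightarrow> 'x) \<Rightarrow> ('x \<times> nat) set \<Rightarrow> ('x \<times> nat) set set" where
  "tclass G \<alpha> A = {B. bounded_clopen B \<and> equidecomposable G \<alpha> A B}"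

definition type_semigroup ::
    "('g, 'b) monoid_scheme \<Rightarrow> ('g \<Rightarrow> 'x::topological_space \<Rightarrow> 'x) \<Rightarrow> ('x \<times> nat) set set set" where
  "type_semigroup G \<alpha> = tclass G \<alpha> ` {A. bounded_clopen A}"

definition type_add ::
    "('g, 'b) monoid_scheme \<Rightarrow> ('g \<Rightarrow> 'x::topological_space \<Rightarrow> 'x) \<Rightarrow>
     ('x \<times> nat) set set \<Rightarrow> ('x \<times> nat) set set \<Rightarrow> ('x \<times> nat) set set" where
  "type_add G \<alpha> a b = (THE c. \<exists>A\<in>a. \<exists>B\<in>b. A \<inter> B = {} \<and> c = tclass G \<alpha> (A \<union> B))"

definition type_zero ::
    "('g, 'b) monoid_scheme \<Rightarrow> ('g \<Rightarrow> 'x::topological_space \<Rightarrow> 'x) \<Rightarrow> ('x \<times> nat) set set" where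
  "type_zero G \<alpha> = tclass G \<alpha> {}"

definition type_smult ::
    "('g, 'b) monoid_scheme \<Rightarrow> ('g \<Rightarrow> 'x::topological_space \<Rightarrow> 'x) \<Rightarrow> nat \<Rightarrow>
     ('x \<times> nat) set set \<Rightarrow> ('x \<times> nat) set set" where
  "type_smult G \<alpha> n a = (type_add G \<alpha> a ^^ n) (type_zero G \<alpha>)"

definition type_le ::
    "('g, 'b) monoid_scheme \<Rightarrow> ('g \<Rightarrow> 'x::topological_space \<Rightarrow> 'x) \<Rightarrow>
     ('x \<times> nat) set set \<Rightarrow> ('x \<times> nat) set set \<Rightarrow> bool" where
  "type_le G \<alpha> a b \<longleftrightarrow> (\<exists>c\<in>type_semigroup G \<alpha>. b = type_add G \<alpha> a c)"

definition type_unperforated ::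
    "('g, 'b) monoid_scheme \<Rightarrow> ('g \<Rightarrow> 'x::topological_space \<Rightarrow> 'x) \<Rightarrow> bool" where
  "type_unperforated G \<alpha> \<longleftrightarrow> (\<forall>a\<in>type_semigroup G \<alpha>. \<forall>b\<in>type_semigroup G \<alpha>. \<forall>n::nat. n \<ge> 1 \<longrightarrow>
      type_le G \<alpha> (type_smult G \<alpha> n a) (type_smult G \<alpha> n b) \<longrightarrow> type_le G \<alpha> a b)"

definition type_cancellative ::
    "('g, 'b) monoid_scheme \<Rightarrow> ('g \<Rightarrow> 'x::topological_space \<Rightarrow> 'x) \<Rightarrow> bool" where
  "type_cancellative G \<alpha> \<longleftrightarrow> (\<forall>a\<in>type_semigroup G \<alpha>. \<forall>b\<in>type_semigroup G \<alpha>. \<forall>c\<in>type_semigroup G \<alpha>.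
      type_add G \<alpha> a b = type_add G \<alpha> a c \<longrightarrow> b = c)"

end

theory Submission
  imports Defs
begin

text \<open>
  A bounded clopen set \<open>A\<close> is determined up to equidecomposability by the locally constant
  function counting the points of \<open>A\<close> above each \<open>x\<close>, so the type semigroup is the monoid of
  locally constant functions \<open>X \<rightarrow> \<nat>\<close> modulo the congruence generated by \<open>f \<sim> f \<circ> \<gamma>\<^sup>-\<^sup>1\<close>.

  If a dense subgroup is locally finite, density replaces every \<open>\<gamma>\<close> in a given equidecomposition by an
  element of the subgroup, hence all of them by elements of one finite group \<open>K\<close>. For \<open>K\<close>,
  comparison of classes is comparison of sums over \<open>K\<close>-orbits: a greedy matching along the elements of
  \<open>K\<close> never gets stuck. Sums of natural numbers are cancellative and unperforated.

  Conversely, let \<open>\<pi>\<^sub>n\<close> be maps \<open>X \<rightarrow> X\<close> that are piecewise given by \<open>\<Gamma>\<close>, each factoring through the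
  previous one. Their fibres have bounded size, and the homeomorphisms preserving the fibres of some
  \<open>\<pi>\<^sub>n\<close> form an ample subgroup of the topological full group. It is dense as soon as for all
  equidecomposable clopen \<open>A\<close>, \<open>B\<close> some \<open>\<pi>\<^sub>n\<close> satisfies \<open>|A \<inter> \<pi>\<^sub>n\<^sup>-\<^sup>1(y)| = |B \<inter> \<pi>\<^sub>n\<^sup>-\<^sup>1(y)|\<close> for all \<open>y\<close>. To achieve this for
  one more pair, one has to find, for an integer-valued function \<open>p\<close> whose positive and negative parts
  have the same class, a further map along which \<open>p\<close> is pushed forward to zero. If \<open>m\<close> is the maximum of
  \<open>|p|\<close>, attained on \<open>E = {p = m}\<close>, then \<open>m [E] \<le> m [{p < 0}]\<close>, so \<open>E\<close> can be folded into
  \<open>{p < 0}\<close> because the semigroup is unperforated; this lowers the maximum, and cancellation preserves the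
  hypothesis on \<open>p\<close> (the argument of Effros, Handelman and Shen for dimension groups).
\<close>

subsection \<open>Locally constant maps and homeomorphism groups\<close>

text \<open>This is continuity into the discrete topology, phrased through preimages so that the
  target type carries no topology. Values may thus be numbers, truth values or group
  elements.\<close>

definition locally_constant :: "('a::topological_space \<Rightarrow> 'b) \<Rightarrow> bool" where
  "locally_constant f \<longleftrightarrow> (\<forall>S. open (f -` S))"

lemma locally_constant_clopen: "locally_constant f \<Longrightarrow> clopen (f -` S)"
  unfolding locally_constant_def clopen_def closed_def vimage_Compl[symmetric] by blast

lemma locally_constant_pred_iff: "locally_constant P \<longleftrightarrow> clopen {x. P x}"
proof
  assume "locally_constant P"
  from locally_constant_clopen[OF this, of "{True}"] show "clopen {x. P x}"
    by (simp add: vimage_def)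
next
  assume c: "clopen {x. P x}"
  show "locally_constant P"
    unfolding locally_constant_def
  proof
    fix S :: "bool set"
    have "P -` S = (if True \<in> S then {x. P x} else {}) \<union> (if False \<in> S then - {x. P x} else {})"
    proof (rule Set.set_eqI)
      show "x \<in> P -` S \<longleftrightarrow> x \<in> (if True \<in> S then {x. P x} else {}) \<union> (if False \<in> S then - {x. P x} else {})" for x
        by (cases "P x") auto
    qed
    then show "open (P -` S)"
      using c by (simp add: clopen_def open_Un open_Compl)
  qed
qed

lemma locally_constant_mem: "clopen A \<Longrightarrow> locally_constant (\<lambda>x. x \<in> A)"
  by (simp add: locally_constant_pred_iff)

lemma locally_constant_const: "locally_constant (\<lambda>x. c)"
  unfolding locally_constant_def by (simp add: vimage_const)

lemma locally_constant_comp: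
  assumes "locally_constant f"
  shows "locally_constant (\<lambda>x. h (f x))"
  unfolding locally_constant_def
proof
  fix S
  have "open (f -` (h -` S))" using assms unfolding locally_constant_def by blast
  then show "open ((\<lambda>x. h (f x)) -` S)" by (simp add: vimage_def)
qed

lemma locally_constant_comp2:
  assumes "locally_constant f" "locally_constant g"
  shows "locally_constant (\<lambda>x. h (f x) (g x))"
  unfolding locally_constant_def
proof
  fix S
  have "(\<lambda>x. h (f x) (g x)) -` S = (\<Union>a. f -` {a} \<inter> g -` {b. h a b \<in> S})" by auto
  moreover have "open (f -` {a} \<inter> g -` {b. h a b \<in> S})" for a
    using assms unfolding locally_constant_def by (blast intro: open_Int)
  ultimately show "open ((\<lambda>x. h (f x) (g x)) -` S)" by auto
qed

lemma locally_constant_if: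
  assumes "locally_constant P" "locally_constant f" "locally_constant g"
  shows "locally_constant (\<lambda>x. if P x then f x else g x)"
  unfolding locally_constant_def
proof
  fix S
  have P: "open {x. P x}" "open (- {x. P x})"
    using assms(1) unfolding locally_constant_pred_iff clopen_def by (blast, blast)
  have S: "open (f -` S)" "open (g -` S)"
    using assms(2,3) unfolding locally_constant_def by (blast, blast)
  have "(\<lambda>x. if P x then f x else g x) -` S = ({x. P x} \<inter> f -` S) \<union> (- {x. P x} \<inter> g -` S)"
  proof (rule Set.set_eqI)
    show "x \<in> (\<lambda>x. if P x then f x else g x) -` S \<longleftrightarrow>
        x \<in> ({x. P x} \<inter> f -` S) \<union> (- {x. P x} \<inter> g -` S)" for x
      by (cases "P x") simp_all
  qed
  then show "open ((\<lambda>x. if P x then f x else g x) -` S)"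
    using P S by (simp only: open_Int open_Un)
qed

lemma locally_constant_sum:
  fixes f :: "'i \<Rightarrow> 'a::topological_space \<Rightarrow> 'b::comm_monoid_add"
  assumes "\<And>i. i \<in> I \<Longrightarrow> locally_constant (f i)"
  shows "locally_constant (\<lambda>x. \<Sum>i\<in>I. f i x)"
  using assms
  by (induction I rule: infinite_finite_induct)
    (auto intro: locally_constant_const locally_constant_comp2[where h = "(+)"])

lemma locally_constant_continuous:
  assumes "locally_constant f" "continuous_on UNIV \<phi>"
  shows "locally_constant (\<lambda>x. f (\<phi> x))"
proof -
  have "(\<lambda>x. f (\<phi> x)) -` S = \<phi> -` (f -` S)" for S by auto
  with assms show ?thesis
    unfolding locally_constant_def using continuous_on_open_vimage[OF open_UNIV, of \<phi>] by fastforce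
qed

text \<open>The fibres are an open cover of a compact space, and distinct values have disjoint
  nonempty fibres.\<close>

lemma locally_constant_finite_range:
  assumes "compact (UNIV :: 'a::topological_space set)" "locally_constant (f :: 'a \<Rightarrow> 'b)"
  shows "finite (range f)"
proof -
  have "\<exists>D\<subseteq>range f. finite D \<and> UNIV \<subseteq> (\<Union>c\<in>D. f -` {c})"
    by (rule compactE_image[OF assms(1), of "range f" "\<lambda>c. f -` {c}"])
      (use assms(2) in \<open>auto simp: locally_constant_def\<close>)
  then obtain D where "finite D" "UNIV \<subseteq> (\<Union>c\<in>D. f -` {c})" by blast
  then have "range f \<subseteq> D" by blast
  with \<open>finite D\<close> show ?thesis by (rule rev_finite_subset)
qed

lemma locally_constant_bounded:
  assumes "compact (UNIV :: 'a::topological_space set)" "locally_constant (f :: 'a \<Rightarrow> nat)"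
  obtains N where "\<And>x. f x < N"
proof -
  have "finite (range f)" by (rule locally_constant_finite_range[OF assms])
  then have "f x < Suc (Max (range f))" for x by (simp add: le_imp_less_Suc)
  then show ?thesis by (rule that)
qed

lemma locally_constant_partition:
  assumes "clopen_partition P" "\<And>A. A \<in> P \<Longrightarrow> locally_constant (f A)"
    "\<And>A x. A \<in> P \<Longrightarrow> x \<in> A \<Longrightarrow> g x = f A x"
  shows "locally_constant g"
  unfolding locally_constant_def
proof
  fix S
  have "g -` S = (\<Union>A\<in>P. A \<inter> f A -` S)"
  proof (rule Set.set_eqI)
    fix x
    obtain A where "A \<in> P" "x \<in> A" using assms(1) unfolding clopen_partition_def by blast
    then show "x \<in> g -` S \<longleftrightarrow> x \<in> (\<Union>A\<in>P. A \<inter> f A -` S)"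
      using assms(3) by fastforce
  qed
  moreover have "open (A \<inter> f A -` S)" if "A \<in> P" for A
    using assms(1) assms(2)[OF that] that
    unfolding clopen_partition_def clopen_def locally_constant_def by auto
  ultimately show "open (g -` S)" by auto
qed

lemma clopen_partition_fibres:
  assumes "compact (UNIV :: 'a::topological_space set)" "locally_constant (f :: 'a \<Rightarrow> 'b)"
  shows "clopen_partition ((\<lambda>c. f -` {c}) ` range f)"
  unfolding clopen_partition_def
  using locally_constant_finite_range[OF assms] locally_constant_clopen[OF assms(2)]
  by (auto simp: disjoint_def)

lemma clopen_Compl: "clopen A \<Longrightarrow> clopen (- A)"
  by (auto simp: clopen_def)

lemma clopen_Int: "clopen A \<Longrightarrow> clopen B \<Longrightarrow> clopen (A \<inter> B)"
  by (auto simp: clopen_def)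

lemma clopen_Un: "clopen A \<Longrightarrow> clopen B \<Longrightarrow> clopen (A \<union> B)"
  by (auto simp: clopen_def)

lemma clopen_homeo_image:
  assumes "f \<in> Homeo" "clopen A"
  shows "clopen (f ` A)"
  using assms homeomorphism_imp_open_map[of UNIV UNIV f _ A]
    homeomorphism_imp_closed_map[of UNIV UNIV f _ A]
  unfolding Homeo_def clopen_def by auto

section \<open>The group of homeomorphisms\<close>

abbreviation finv :: "('a \<Rightarrow> 'b) \<Rightarrow> 'b \<Rightarrow> 'a" where
  "finv \<equiv> inv_into UNIV"

lemma Homeo_iff: "f \<in> Homeo \<longleftrightarrow> bij f \<and> continuous_on UNIV f \<and> continuous_on UNIV (finv f)"
proof
  assume "f \<in> Homeo"
  then obtain g where g: "homeomorphism UNIV UNIV f g" unfolding Homeo_def by blast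
  then have "f \<circ> g = id" "g \<circ> f = id" unfolding homeomorphism_def by auto
  then have "bij f" "g = finv f" by (auto intro: o_bij simp: inv_unique_comp)
  with g show "bij f \<and> continuous_on UNIV f \<and> continuous_on UNIV (finv f)"
    unfolding homeomorphism_def by auto
next
  assume "bij f \<and> continuous_on UNIV f \<and> continuous_on UNIV (finv f)"
  then have "homeomorphism UNIV UNIV f (finv f)"
    unfolding homeomorphism_def
    by (auto simp: bij_is_inj bij_is_surj surj_f_inv_f surj_imp_inj_inv bij_imp_bij_inv inj_imp_surj_inv)
  then show "f \<in> Homeo" unfolding Homeo_def by blast
qed

lemma Homeo_id: "id \<in> Homeo"
  by (simp add: Homeo_iff)

lemma Homeo_comp: "f \<in> Homeo \<Longrightarrow> g \<in> Homeo \<Longrightarrow> f \<circ> g \<in> Homeo"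
  unfolding Homeo_def using homeomorphism_compose[of UNIV UNIV g _ UNIV f] by blast

lemma Homeo_inv: "f \<in> Homeo \<Longrightarrow> finv f \<in> Homeo"
  unfolding Homeo_iff by (auto simp: bij_imp_bij_inv inv_inv_eq)

lemma group_homeo_group: "group (homeo_group :: ('x::topological_space \<Rightarrow> 'x) monoid)"
proof (rule groupI)
  fix f :: "'x \<Rightarrow> 'x" assume "f \<in> carrier homeo_group"
  then have "f \<in> Homeo" by (simp add: homeo_group_def)
  then have "finv f \<in> Homeo" "finv f \<circ> f = id"
    using Homeo_inv[of f] Homeo_iff[of f] by (auto simp: bij_is_inj)
  then show "\<exists>g\<in>carrier homeo_group. g \<otimes>\<^bsub>homeo_group\<^esub> f = \<one>\<^bsub>homeo_group\<^esub>"
    by (auto simp: homeo_group_def)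
qed (auto simp: homeo_group_def Homeo_id Homeo_comp comp_assoc)

lemma homeo_group_inv:
  assumes "f \<in> Homeo" shows "inv\<^bsub>homeo_group\<^esub> f = finv f"
proof (rule group.inv_equality[OF group_homeo_group])
  show "finv f \<otimes>\<^bsub>homeo_group\<^esub> f = \<one>\<^bsub>homeo_group\<^esub>"
    using assms by (simp add: homeo_group_def Homeo_iff bij_is_inj)
qed (use assms in \<open>auto simp: homeo_group_def Homeo_inv\<close>)

lemma subgroup_homeo_iff:
  "subgroup H homeo_group \<longleftrightarrow>
     H \<subseteq> Homeo \<and> id \<in> H \<and> (\<forall>f\<in>H. \<forall>g\<in>H. f \<circ> g \<in> H) \<and> (\<forall>f\<in>H. finv f \<in> H)" (is "?l \<longleftrightarrow> ?r")
proof
  assume ?l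
  then interpret subgroup H homeo_group .
  have sub: "H \<subseteq> Homeo" using subset by (simp add: homeo_group_def)
  moreover have "finv f \<in> H" if "f \<in> H" for f
    using m_inv_closed[OF that] homeo_group_inv sub that by (metis subsetD)
  moreover have "id \<in> H" using one_closed by (simp add: homeo_group_def)
  moreover have "f \<circ> g \<in> H" if "f \<in> H" "g \<in> H" for f g
    using m_closed[OF that] by (simp add: homeo_group_def)
  ultimately show ?r by blast
next
  assume r: ?r
  show ?l
  proof (rule subgroup.intro)
    fix f assume "f \<in> H"
    with r have "f \<in> Homeo" "finv f \<in> H" by auto
    then show "inv\<^bsub>homeo_group\<^esub> f \<in> H" by (simp add: homeo_group_inv)
  qed (use r in \<open>auto simp: homeo_group_def\<close>)
qed

section \<open>The topology of Homeo(X) and density\<close>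

lemma image_eq_cover:
  assumes "\<Union>Q = UNIV" "\<And>B. B \<in> Q \<Longrightarrow> g ` (A \<inter> B) = f ` (A \<inter> B)"
  shows "g ` A = f ` A"
proof -
  have A: "(\<Union>B\<in>Q. A \<inter> B) = A" using assms(1) by blast
  have "g ` (\<Union>B\<in>Q. A \<inter> B) = f ` (\<Union>B\<in>Q. A \<inter> B)"
    unfolding image_UN using assms(2) by simp
  then show ?thesis unfolding A .
qed

text \<open>The predicate inside \<open>homeo_top\<close> describes open sets only once it is known
  to satisfy \<open>istopology\<close>. The point is closure under intersection, where two
  partitions are replaced by their common refinement.\<close>

lemma openin_homeo_top:
  "openin homeo_top U \<longleftrightarrow> U \<subseteq> Homeo \<and>
     (\<forall>f\<in>U. \<exists>P. clopen_partition P \<and> {g\<in>Homeo. \<forall>A\<in>P. g ` A = f ` A} \<subseteq> U)"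
proof -
  define N where "N P f = {g\<in>Homeo. \<forall>A\<in>P. g ` A = f ` A}" for P and f :: "'a \<Rightarrow> 'a"
  define L where "L U \<longleftrightarrow> U \<subseteq> Homeo \<and> (\<forall>f\<in>U. \<exists>P. clopen_partition P \<and> N P f \<subseteq> U)" for U :: "('a \<Rightarrow> 'a) set"
  have "L (S \<inter> T)" if S: "L S" and T: "L T" for S T
    unfolding L_def
  proof (intro conjI ballI)
    show "S \<inter> T \<subseteq> Homeo" using S unfolding L_def by blast
    fix f assume f: "f \<in> S \<inter> T"
    from f S obtain P where P: "clopen_partition P" "N P f \<subseteq> S" unfolding L_def by blast
    from f T obtain Q where Q: "clopen_partition Q" "N Q f \<subseteq> T" unfolding L_def by blast
    let ?R = "(\<lambda>(A, B). A \<inter> B) ` (P \<times> Q)"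
    have R: "clopen_partition ?R"
      unfolding clopen_partition_def
    proof (intro conjI ballI)
      show "finite ?R"
        using P(1) Q(1) unfolding clopen_partition_def by blast
      show "clopen C" if "C \<in> ?R" for C
        using that P(1) Q(1) clopen_Int unfolding clopen_partition_def by fast
      show "\<Union>?R = UNIV"
      proof (rule UNIV_eq_I[THEN sym])
        fix x
        obtain A B where "A \<in> P" "x \<in> A" "B \<in> Q" "x \<in> B"
          using P(1) Q(1) unfolding clopen_partition_def by (metis UNIV_I UnionE)
        then show "x \<in> \<Union>?R" by blast
      qed
      show "disjoint ?R"
      proof (rule disjointI)
        fix C D assume "C \<in> ?R" "D \<in> ?R" and ne: "C \<noteq> D"
        then obtain A B A' B' where "A \<in> P" "B \<in> Q" "C = A \<inter> B" "A' \<in> P" "B' \<in> Q" "D = A' \<inter> B'"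
          by blast
        moreover have "A \<noteq> A' \<or> B \<noteq> B'" using ne calculation by blast
        moreover have "disjoint P" "disjoint Q" using P(1) Q(1) unfolding clopen_partition_def by simp_all
        ultimately show "C \<inter> D = {}" using disjointD[of P A A'] disjointD[of Q B B'] by blast
      qed
    qed
    \<comment> \<open>Agreement on the pieces \<open>A \<inter> B\<close> of the refinement gives
      agreement on \<open>A\<close>, because the \<open>B\<close> cover the space.\<close>
    have "g ` A = f ` A" if g: "g \<in> N ?R f" and A: "A \<in> P" for g A
    proof (rule image_eq_cover[of Q])
      show "\<Union>Q = UNIV" using Q(1) unfolding clopen_partition_def by blast
      show "g ` (A \<inter> B) = f ` (A \<inter> B)" if "B \<in> Q" for B
      proof -
        have "A \<inter> B \<in> ?R" using A that by blast
        then show ?thesis using g unfolding N_def by blast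
      qed
    qed
    moreover have "g ` B = f ` B" if g: "g \<in> N ?R f" and B: "B \<in> Q" for g B
    proof (rule image_eq_cover[of P])
      show "\<Union>P = UNIV" using P(1) unfolding clopen_partition_def by blast
      show "g ` (B \<inter> A) = f ` (B \<inter> A)" if "A \<in> P" for A
      proof -
        have "B \<inter> A \<in> ?R" using B that by blast
        then show ?thesis using g unfolding N_def by blast
      qed
    qed
    moreover have "g \<in> Homeo" if "g \<in> N ?R f" for g using that unfolding N_def by simp
    ultimately have "g \<in> N P f \<inter> N Q f" if "g \<in> N ?R f" for g
      using that unfolding N_def[of P] N_def[of Q] by simp
    then have "N ?R f \<subseteq> N P f \<inter> N Q f" by (rule subsetI)
    with R P(2) Q(2) show "\<exists>P. clopen_partition P \<and> N P f \<subseteq> S \<inter> T" by blast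
  qed
  moreover have "L (\<Union>\<K>)" if "\<forall>K\<in>\<K>. L K" for \<K>
    unfolding L_def
  proof (intro conjI ballI)
    show "\<Union>\<K> \<subseteq> Homeo" using that unfolding L_def by blast
    fix f assume "f \<in> \<Union>\<K>"
    then obtain K where "K \<in> \<K>" "f \<in> K" by blast
    with that show "\<exists>P. clopen_partition P \<and> N P f \<subseteq> \<Union>\<K>"
      unfolding L_def by (meson Union_upper order_trans)
  qed
  ultimately have "istopology L" unfolding istopology_def by blast
  then have "openin (topology L) = L" by (rule topology_inverse')
  then show ?thesis 
    unfolding homeo_top_def L_def[abs_def] N_def by (rule fun_cong)
qed

lemma topspace_homeo_top: "topspace homeo_top = Homeo"
proof -
  have "clopen_partition ({UNIV} :: 'a set set)"
    by (simp add: clopen_partition_def clopen_def disjoint_def)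
  then have "openin homeo_top (Homeo :: ('a \<Rightarrow> 'a) set)" unfolding openin_homeo_top by blast
  then show ?thesis
    by (metis openin_homeo_top openin_subset openin_topspace subset_antisym)
qed

text \<open>Density only has to be tested on basic neighbourhoods, and such a neighbourhood of
  \<open>f\<close> consists of the maps with the same images of the pieces of \<open>P\<close> as
  \<open>f\<close>.\<close>

lemma dense_subgroup_of_iff:
  fixes K :: "('x::topological_space \<Rightarrow> 'x) set"
  assumes "K \<subseteq> Homeo"
  shows "dense_subgroup_of H K \<longleftrightarrow> subgroup H homeo_group \<and> H \<subseteq> K \<and>
    (\<forall>f\<in>K. \<forall>P. clopen_partition P \<longrightarrow> (\<exists>h\<in>H. \<forall>A\<in>P. h ` A = f ` A))"
proof -
  have ts: "topspace (subtopology homeo_top K) = K"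
    using assms by (auto simp: topspace_homeo_top)
  have "subtopology homeo_top K closure_of H = K \<longleftrightarrow>
    (\<forall>f\<in>K. \<forall>P. clopen_partition P \<longrightarrow> (\<exists>h\<in>H. \<forall>A\<in>P. h ` A = f ` A))" (is "?l \<longleftrightarrow> ?r")
    if HK: "H \<subseteq> K"
  proof
    assume l: ?l
    show ?r
    proof (intro ballI allI impI)
      fix f and P :: "'x set set" assume f: "f \<in> K" and P: "clopen_partition P"
      let ?U = "{g\<in>Homeo. \<forall>A\<in>P. g ` A = f ` A}"
      \<comment> \<open>The neighbourhood is itself open: for any of its members the same
        \<open>P\<close> defines the same set.\<close>
      have "openin homeo_top ?U" 
        unfolding openin_homeo_top using P by (intro conjI ballI exI[of _ P]) auto
      then have "openin (subtopology homeo_top K) (?U \<inter> K)" by (rule openin_subtopology_Int)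
      moreover have "\<forall>T. f \<in> T \<and> openin (subtopology homeo_top K) T \<longrightarrow> (\<exists>h. h \<in> H \<and> h \<in> T)"
        using l f in_closure_of[THEN iffD1, THEN conjunct2, of f "subtopology homeo_top K" H] by simp
      moreover have "f \<in> ?U \<inter> K" using f assms by auto
      ultimately have "\<exists>h. h \<in> H \<and> h \<in> ?U \<inter> K" by (simp only: simp_thms)
      then show "\<exists>h\<in>H. \<forall>A\<in>P. h ` A = f ` A" by blast
    qed
  next
    assume r: ?r
    have "f \<in> subtopology homeo_top K closure_of H" if f: "f \<in> K" for f
      unfolding in_closure_of ts
    proof (intro conjI allI impI)
      show "f \<in> K" by (rule f)
      fix T assume T: "f \<in> T \<and> openin (subtopology homeo_top K) T"
      then obtain U where U: "openin homeo_top U" "T = U \<inter> K" unfolding openin_subtopology by blast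
      with T obtain P where P: "clopen_partition P" "{g\<in>Homeo. \<forall>A\<in>P. g ` A = f ` A} \<subseteq> U"
        unfolding openin_homeo_top by blast
      from r f P(1) obtain h where "h \<in> H" "\<forall>A\<in>P. h ` A = f ` A" by blast
      with P(2) U(2) HK assms have "h \<in> H" "h \<in> T" by auto
      then show "\<exists>y. y \<in> H \<and> y \<in> T" by blast
    qed
    then have "K \<subseteq> subtopology homeo_top K closure_of H" by (rule subsetI)
    moreover have "subtopology homeo_top K closure_of H \<subseteq> K"
      using closure_of_subset_topspace[of "subtopology homeo_top K" H] ts by simp
    ultimately show ?l by (rule subset_antisym[rotated])
  qed
  then show ?thesis unfolding dense_subgroup_of_def by (simp cong: conj_cong)
qed

text \<open>Total boundedness yields a countable family of balls of radius \<open>1 / Suc n\<close>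
  that is a base. A clopen set is compact, hence a finite union of members of this family, and there
  are only countably many finite subfamilies.\<close>

lemma countable_clopen:
  assumes comp: "compact (UNIV :: 'a::topological_space set)"
    and metr: "metrizable_space (euclidean :: 'a topology)"
  shows "countable {A :: 'a set. clopen A}"
proof -
  from metr obtain M d where "Metric_space M d" and eu: "(euclidean :: 'a topology) = Metric_space.mtopology M d"
    unfolding metrizable_space_def by blast
  then interpret Metric_space M d by simp
  have M: "M = UNIV" using eu by (metis topspace_euclidean topspace_mtopology)
  have "compactin mtopology UNIV" using comp eu by (metis compactin_euclidean_iff)
  then have "mtotally_bounded UNIV" by (rule compactin_imp_mtotally_bounded)
  then have tb: "\<exists>K. finite K \<and> UNIV \<subseteq> (\<Union>y\<in>K. mball y e)" if "e > 0" for e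
    using that unfolding mtotally_bounded_def by blast
  have "\<forall>n. \<exists>K. finite K \<and> (\<forall>x. \<exists>y\<in>K. x \<in> mball y (1 / Suc n))"
  proof
    fix n
    obtain K where "finite K" "UNIV \<subseteq> (\<Union>y\<in>K. mball y (1 / Suc n))" using tb[of "1 / Suc n"] by auto
    then show "\<exists>K. finite K \<and> (\<forall>x. \<exists>y\<in>K. x \<in> mball y (1 / Suc n))" by blast
  qed
  then obtain K where K: "\<And>n. finite (K n)" "\<And>n x. \<exists>y\<in>K n. x \<in> mball y (1 / Suc n)" by metis
  define B where "B = (\<Union>n. (\<lambda>y. mball y (1 / Suc n)) ` K n)"
  have cB: "countable B" unfolding B_def using K(1) by (auto intro: countable_finite)
  have openB: "open b" if "b \<in> B" for b
    using that eu openin_mball unfolding B_def by (metis (no_types, lifting) UN_E imageE open_openin)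
  have "{A :: 'a set. clopen A} \<subseteq> Union ` {\<A>. finite \<A> \<and> \<A> \<subseteq> B}"
  proof
    fix A :: "'a set" assume "A \<in> {A. clopen A}"
    then have A: "open A" "closed A" by (auto simp: clopen_def)
    have ex: "\<exists>b\<in>B. x \<in> b \<and> b \<subseteq> A" if x: "x \<in> A" for x
    proof -
      have "openin mtopology A" using A eu by (metis open_openin)
      then obtain r where r: "r > 0" "mball x r \<subseteq> A" using x unfolding openin_mtopology by blast
      \<comment> \<open>With radius below \<open>r / 2\<close>, any such ball that contains
        \<open>x\<close> lies in the ball of radius \<open>r\<close> about \<open>x\<close>.\<close>
      obtain n where "1 / Suc n < r / 2" using r(1) nat_approx_posE[of "r / 2"] by (metis half_gt_zero_iff)
      moreover obtain y where y: "y \<in> K n" "x \<in> mball y (1 / Suc n)" using K(2) by blast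
      ultimately have "mball y (1 / Suc n) \<subseteq> mball x r"
      proof (intro subsetI)
        fix z assume "z \<in> mball y (1 / Suc n)"
        then have "d y z < 1 / Suc n" "d y x < 1 / Suc n" "x \<in> M" "y \<in> M" "z \<in> M"
          using y(2) by (simp_all only: in_mball)
        then have "d x z < r"
          using \<open>1 / Suc n < r / 2\<close> triangle[of x y z] commute[of x y] by linarith
        then show "z \<in> mball x r" using \<open>x \<in> M\<close> \<open>z \<in> M\<close> by (simp only: in_mball)
      qed
      with r y show ?thesis unfolding B_def by blast
    qed
    have "compact A" using compact_Int_closed[OF comp A(2)] by simp
    moreover have "A \<subseteq> \<Union>{b\<in>B. b \<subseteq> A}" using ex by blast
    moreover have "open b" if "b \<in> {b\<in>B. b \<subseteq> A}" for b using that openB by simp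
    ultimately obtain \<A> where "\<A> \<subseteq> {b\<in>B. b \<subseteq> A}" "finite \<A>" "A \<subseteq> \<Union>\<A>"
      by (rule compactE)
    then have "A = \<Union>\<A>" "finite \<A>" "\<A> \<subseteq> B" by auto
    then show "A \<in> Union ` {\<A>. finite \<A> \<and> \<A> \<subseteq> B}" by blast
  qed
  then show ?thesis
    by (rule countable_subset) (intro countable_image countable_Collect_finite_subset cB)
qed

subsection \<open>Piecewise translations\<close>

locale homeo_action = group G for G :: "('g, 'b) monoid_scheme" (structure) +
  fixes \<alpha> :: "'g \<Rightarrow> 'x::topological_space \<Rightarrow> 'x"
  assumes hom: "\<alpha> \<in> hom G homeo_group"
    and compact_space: "compact (UNIV :: 'x set)"
begin

lemma act_Homeo: "\<gamma> \<in> carrier G \<Longrightarrow> \<alpha> \<gamma> \<in> Homeo"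
  using hom unfolding hom_def by (auto simp: homeo_group_def)

lemma act_continuous: "\<gamma> \<in> carrier G \<Longrightarrow> continuous_on UNIV (\<alpha> \<gamma>)"
  using act_Homeo Homeo_iff by blast

lemma act_mult: "\<gamma> \<in> carrier G \<Longrightarrow> \<delta> \<in> carrier G \<Longrightarrow> \<alpha> (\<gamma> \<otimes> \<delta>) x = \<alpha> \<gamma> (\<alpha> \<delta> x)"
  using hom_mult[OF hom] by (simp add: homeo_group_def)

lemma act_one: "\<alpha> \<one> x = x"
proof -
  have "\<alpha> \<one> = id"
    using hom_one[OF hom is_group group_homeo_group] by (simp add: homeo_group_def)
  then show ?thesis by simp
qed

lemma act_inv_act: "\<gamma> \<in> carrier G \<Longrightarrow> \<alpha> (inv \<gamma>) (\<alpha> \<gamma> x) = x"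
  by (simp add: act_mult[symmetric] act_one)

lemma act_act_inv: "\<gamma> \<in> carrier G \<Longrightarrow> \<alpha> \<gamma> (\<alpha> (inv \<gamma>) x) = x"
  by (simp add: act_mult[symmetric] act_one)

lemma act_eq_iff: "\<gamma> \<in> carrier G \<Longrightarrow> \<alpha> \<gamma> x = y \<longleftrightarrow> x = \<alpha> (inv \<gamma>) y"
  using act_inv_act act_act_inv by metis

lemma act_inj: "\<gamma> \<in> carrier G \<Longrightarrow> \<alpha> \<gamma> x = \<alpha> \<gamma> y \<longleftrightarrow> x = y"
  using act_inv_act by metis

lemma locally_constant_act:
  "locally_constant f \<Longrightarrow> \<gamma> \<in> carrier G \<Longrightarrow> locally_constant (\<lambda>x. f (\<alpha> \<gamma> x))"
  by (rule locally_constant_continuous[OF _ act_continuous])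

definition cocycle_of :: "('x \<Rightarrow> 'g) \<Rightarrow> ('x \<Rightarrow> 'x) \<Rightarrow> bool" where
  "cocycle_of c \<rho> \<longleftrightarrow> locally_constant c \<and> range c \<subseteq> carrier G \<and> (\<forall>x. \<rho> x = \<alpha> (c x) x)"

text \<open>Injectivity is deliberately absent: the bijective maps of this kind form the topological
  full group, while the others fold parts of the space onto each other.\<close>

definition piecewise :: "('x \<Rightarrow> 'x) \<Rightarrow> bool" where
  "piecewise \<rho> \<longleftrightarrow> (\<exists>c. cocycle_of c \<rho>)"

lemma piecewiseI:
  assumes "locally_constant c" "\<And>x. c x \<in> carrier G" "\<And>x. \<rho> x = \<alpha> (c x) x"
  shows "piecewise \<rho>"
  using assms unfolding piecewise_def cocycle_of_def by blast

lemma piecewiseE: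
  assumes "piecewise \<rho>"
  obtains c where "locally_constant c" "\<forall>x. c x \<in> carrier G" "\<forall>x. \<rho> x = \<alpha> (c x) x" "finite (range c)"
  using assms locally_constant_finite_range[OF compact_space] unfolding piecewise_def cocycle_of_def by blast

lemma piecewise_act: "\<gamma> \<in> carrier G \<Longrightarrow> piecewise (\<alpha> \<gamma>)"
  by (rule piecewiseI[of "\<lambda>x. \<gamma>"]) (auto intro: locally_constant_const)

lemma piecewise_id: "piecewise id"
  by (rule piecewiseI[of "\<lambda>x. \<one>"]) (auto intro: locally_constant_const simp: act_one)

lemma piecewise_continuous:
  assumes "piecewise \<rho>"
  shows "continuous_on UNIV \<rho>"
proof -
  obtain c where c[rule_format]: "locally_constant c" "\<forall>x. c x \<in> carrier G" "\<forall>x. \<rho> x = \<alpha> (c x) x" "finite (range c)"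
    using assms by (rule piecewiseE)
  have "open (\<rho> -` U)" if U: "open U" for U
  proof -
    have "\<rho> -` U = (\<Union>\<gamma>\<in>range c. c -` {\<gamma>} \<inter> \<alpha> \<gamma> -` U)" using c(3) by auto
    moreover have "open (c -` {\<gamma>} \<inter> \<alpha> \<gamma> -` U)" if "\<gamma> \<in> range c" for \<gamma>
    proof (rule open_Int)
      show "open (c -` {\<gamma>})" using c(1) unfolding locally_constant_def by blast
      have "\<gamma> \<in> carrier G" using that c(2) by auto
      then show "open (\<alpha> \<gamma> -` U)"
        using U open_vimage[OF U act_continuous] by blast
    qed
    ultimately show ?thesis by auto
  qed
  then show ?thesis by (simp add: continuous_on_open_vimage)
qed

lemma locally_constant_piecewise:
  "locally_constant f \<Longrightarrow> piecewise \<rho> \<Longrightarrow> locally_constant (\<lambda>x. f (\<rho> x))"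
  by (rule locally_constant_continuous[OF _ piecewise_continuous])

lemma piecewise_comp:
  assumes "piecewise \<rho>" "piecewise \<pi>"
  shows "piecewise (\<lambda>x. \<rho> (\<pi> x))"
proof -
  obtain c where c[rule_format]: "locally_constant c" "\<forall>x. c x \<in> carrier G" "\<forall>x. \<rho> x = \<alpha> (c x) x" "finite (range c)"
    using assms(1) by (rule piecewiseE)
  obtain d where d[rule_format]: "locally_constant d" "\<forall>x. d x \<in> carrier G" "\<forall>x. \<pi> x = \<alpha> (d x) x" "finite (range d)"
    using assms(2) by (rule piecewiseE)
  show ?thesis
  proof (rule piecewiseI)
    show "locally_constant (\<lambda>x. c (\<pi> x) \<otimes> d x)"
      by (intro locally_constant_comp2[where h = "(\<otimes>)"] locally_constant_piecewise[OF c(1) assms(2)] d(1))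
    show "c (\<pi> x) \<otimes> d x \<in> carrier G" for x using c(2) d(2) by simp
    show "\<rho> (\<pi> x) = \<alpha> (c (\<pi> x) \<otimes> d x) x" for x
      using c(2) d(2) by (simp add: act_mult c(3)[of "\<pi> x"] d(3)[symmetric])
  qed
qed

lemma piecewise_if:
  assumes "clopen A" "piecewise \<rho>" "piecewise \<pi>"
  shows "piecewise (\<lambda>x. if x \<in> A then \<rho> x else \<pi> x)"
proof -
  obtain c where c[rule_format]: "locally_constant c" "\<forall>x. c x \<in> carrier G" "\<forall>x. \<rho> x = \<alpha> (c x) x" "finite (range c)"
    using assms(2) by (rule piecewiseE)
  obtain d where d[rule_format]: "locally_constant d" "\<forall>x. d x \<in> carrier G" "\<forall>x. \<pi> x = \<alpha> (d x) x" "finite (range d)"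
    using assms(3) by (rule piecewiseE)
  show ?thesis
    by (rule piecewiseI[of "\<lambda>x. if x \<in> A then c x else d x"])
      (use c d in \<open>simp_all add: locally_constant_if locally_constant_mem assms(1)\<close>)
qed

lemma piecewise_partition:
  assumes P: "clopen_partition P" and f: "\<And>A. A \<in> P \<Longrightarrow> piecewise (f A)"
    and g: "\<And>A x. A \<in> P \<Longrightarrow> x \<in> A \<Longrightarrow> g x = f A x"
  shows "piecewise g"
proof -
  have "\<forall>A\<in>P. \<exists>c. locally_constant c \<and> range c \<subseteq> carrier G \<and> (\<forall>x. f A x = \<alpha> (c x) x)"
    using f unfolding piecewise_def cocycle_of_def by blast
  then obtain c where c: "\<And>A. A \<in> P \<Longrightarrow> locally_constant (c A)" "\<And>A x. A \<in> P \<Longrightarrow> c A x \<in> carrier G"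
    "\<And>A x. A \<in> P \<Longrightarrow> f A x = \<alpha> (c A x) x"
    by (metis range_subsetD)
  \<comment> \<open>\<open>B x\<close> is the piece containing \<open>x\<close>; it selects which of
    the chosen cocycles applies at \<open>x\<close>.\<close>
  define B where "B x = (THE A. A \<in> P \<and> x \<in> A)" for x
  have B: "B x = A" if "A \<in> P" "x \<in> A" for A x
    unfolding B_def
  proof (rule the_equality)
    show "A' = A" if "A' \<in> P \<and> x \<in> A'" for A'
      using P that \<open>A \<in> P\<close> \<open>x \<in> A\<close> unfolding clopen_partition_def disjoint_def by blast
  qed (use that in blast)
  have Bin: "B x \<in> P" "x \<in> B x" for x
  proof -
    obtain A where "A \<in> P" "x \<in> A" using P unfolding clopen_partition_def by blast
    then show "B x \<in> P" "x \<in> B x" using B by auto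
  qed
  show ?thesis
  proof (rule piecewiseI)
    show "locally_constant (\<lambda>x. c (B x) x)"
      by (rule locally_constant_partition[OF P, of c]) (simp_all add: c(1) B)
    show "c (B x) x \<in> carrier G" for x using c(2) Bin by blast
    show "g x = \<alpha> (c (B x) x) x" for x
      using g[OF Bin] c(3)[OF Bin(1)] by simp
  qed
qed

text \<open>By compactness a cocycle has finitely many values, so its fibres form a clopen
  partition. Conversely, one group element per piece is glued to a cocycle.\<close>

lemma topological_full_group_eq: "topological_full_group G \<alpha> = {f \<in> Homeo. piecewise f}"
proof -
  have "piecewise f \<longleftrightarrow> (\<exists>P. clopen_partition P \<and> (\<forall>A\<in>P. \<exists>\<gamma>\<in>carrier G. \<forall>x\<in>A. f x = \<alpha> \<gamma> x))" for f
  proof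
    assume "piecewise f"
    then obtain c where c[rule_format]: "locally_constant c" "\<forall>x. c x \<in> carrier G" "\<forall>x. f x = \<alpha> (c x) x" "finite (range c)"
      by (rule piecewiseE)
    show "\<exists>P. clopen_partition P \<and> (\<forall>A\<in>P. \<exists>\<gamma>\<in>carrier G. \<forall>x\<in>A. f x = \<alpha> \<gamma> x)"
      by (intro exI[of _ "(\<lambda>\<gamma>. c -` {\<gamma>}) ` range c"] conjI clopen_partition_fibres compact_space c(1))
        (use c(2,3) in force)
  next
    assume "\<exists>P. clopen_partition P \<and> (\<forall>A\<in>P. \<exists>\<gamma>\<in>carrier G. \<forall>x\<in>A. f x = \<alpha> \<gamma> x)"
    then obtain P where P: "clopen_partition P" "\<forall>A\<in>P. \<exists>\<gamma>\<in>carrier G. \<forall>x\<in>A. f x = \<alpha> \<gamma> x" by blast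
    from bchoice[OF this(2)[unfolded Bex_def]]
    obtain \<gamma> where "\<forall>A\<in>P. \<gamma> A \<in> carrier G \<and> (\<forall>x\<in>A. f x = \<alpha> (\<gamma> A) x)" ..
    then have g: "\<gamma> A \<in> carrier G" "\<And>x. x \<in> A \<Longrightarrow> f x = \<alpha> (\<gamma> A) x" if "A \<in> P" for A
      using that by auto
    show "piecewise f"
      by (rule piecewise_partition[OF P(1), of "\<lambda>A. \<alpha> (\<gamma> A)"]) (erule piecewise_act[OF g(1)], rule g(2))
  qed
  then show ?thesis unfolding topological_full_group_def by simp
qed

lemma piecewise_inv:
  assumes "piecewise f" "bij f"
  shows "piecewise (finv f)"
proof -
  obtain c where c[rule_format]: "locally_constant c" "\<forall>x. c x \<in> carrier G" "\<forall>x. f x = \<alpha> (c x) x" "finite (range c)"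
    using assms(1) by (rule piecewiseE)
  have inv: "finv f y = \<alpha> (inv (c (finv f y))) y" for y
    using c(2) c(3)[of "finv f y"] act_inv_act[of "c (finv f y)" "finv f y"] assms(2)
    by (simp add: bij_is_surj surj_f_inv_f)
  have "locally_constant (\<lambda>y. inv (c (finv f y)))"
  proof (rule locally_constant_comp[of "\<lambda>y. c (finv f y)"])
    show "locally_constant (\<lambda>y. c (finv f y))"
      unfolding locally_constant_def
    proof
      fix S
      \<comment> \<open>Continuity of \<open>finv f\<close> is not yet available, so it is
        eliminated: the preimage of \<open>y\<close> has label \<open>\<gamma>\<close> exactly when
        \<open>\<alpha> (inv \<gamma>) y\<close> has label \<open>\<gamma>\<close>, and then this
        point is the preimage.\<close>
      have "(\<lambda>y. c (finv f y)) -` S = (\<Union>\<gamma>\<in>S \<inter> range c. \<alpha> (inv \<gamma>) -` (c -` {\<gamma>}))" (is "?l = ?r")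
      proof (rule Set.set_eqI)
        fix y
        show "y \<in> ?l \<longleftrightarrow> y \<in> ?r"
        proof
          assume "y \<in> ?l"
          moreover have "\<alpha> (inv (c (finv f y))) y = finv f y" using inv by simp
          ultimately show "y \<in> ?r" by (intro UN_I[of "c (finv f y)"]) auto
        next
          assume "y \<in> ?r"
          then obtain \<gamma> where g: "\<gamma> \<in> S" "\<gamma> \<in> range c" "c (\<alpha> (inv \<gamma>) y) = \<gamma>" by auto
          then have "\<gamma> \<in> carrier G" using c(2) by auto
          then have "f (\<alpha> (inv \<gamma>) y) = y" using c(3) g(3) by (simp add: act_act_inv)
          then have "finv f y = \<alpha> (inv \<gamma>) y" using assms(2) by (metis bij_is_inj inv_f_f)
          then show "y \<in> ?l" using g by simp
        qed
      qed
      moreover have "open (\<alpha> (inv \<gamma>) -` (c -` {\<gamma>}))" if "\<gamma> \<in> S \<inter> range c" for \<gamma>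
      proof -
        have "inv \<gamma> \<in> carrier G" using that c(2) by auto
        moreover have "open (c -` {\<gamma>})" using c(1) unfolding locally_constant_def by blast
        ultimately show ?thesis using open_vimage act_continuous by blast
      qed
      ultimately show "open ((\<lambda>y. c (finv f y)) -` S)" by auto
    qed
  qed
  then show ?thesis by (rule piecewiseI) (use inv c(2) in auto)
qed

lemma topological_full_groupI: "piecewise f \<Longrightarrow> bij f \<Longrightarrow> f \<in> topological_full_group G \<alpha>"
  unfolding topological_full_group_eq
  by (simp add: Homeo_iff piecewise_continuous piecewise_inv)

text \<open>A piecewise map is coded by the finite set of pairs formed by a fibre of its cocycle and
  the value there, and \<open>ev\<close> decodes it. The codes range over a countable set.\<close>

lemma countable_piecewise:
  assumes "countable (carrier G)" "countable {A :: 'x set. clopen A}"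
  shows "countable {\<rho>. piecewise \<rho>}"
proof -
  let ?D = "{S. finite S \<and> S \<subseteq> {A :: 'x set. clopen A} \<times> carrier G}"
  \<comment> \<open>For a code that comes from a cocycle exactly one \<open>\<gamma>\<close>
    qualifies at each \<open>x\<close>; on other sets the value is irrelevant.\<close>
  define ev where "ev S x = \<alpha> (SOME \<gamma>. \<exists>A. (A, \<gamma>) \<in> S \<and> x \<in> A) x" for S :: "('x set \<times> 'g) set" and x
  have "{\<rho>. piecewise \<rho>} \<subseteq> ev ` ?D"
  proof
    fix \<rho> assume "\<rho> \<in> {\<rho>. piecewise \<rho>}"
    then have "piecewise \<rho>" by simp
    then obtain c where c[rule_format]: "locally_constant c" "\<forall>x. c x \<in> carrier G" "\<forall>x. \<rho> x = \<alpha> (c x) x" "finite (range c)"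
      by (rule piecewiseE)
    let ?S = "(\<lambda>\<gamma>. (c -` {\<gamma>}, \<gamma>)) ` range c"
    have "\<rho> = ev ?S"
    proof
      fix x
      have "(\<exists>A. (A, \<gamma>) \<in> ?S \<and> x \<in> A) \<longleftrightarrow> \<gamma> = c x" for \<gamma> by auto
      then show "\<rho> x = ev ?S x" unfolding ev_def using c(3) by simp
    qed
    moreover have "?S \<in> ?D"
      using c(2,4) locally_constant_clopen[OF c(1)] by auto
    ultimately show "\<rho> \<in> ev ` ?D" by blast
  qed
  moreover have "countable ?D"
    using assms by (intro countable_Collect_finite_subset countable_SIGMA)
  ultimately show ?thesis using countable_image countable_subset by blast
qed

end

subsection \<open>Equidecomposability of integer-valued functions\<close>

context homeo_action
begin

text \<open>
  The relation \<open>Q\<close> restricts the allowed moves: no restriction gives equidecomposability, while orbits of a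
  finite group or fibres of a map give matchings inside the classes of \<open>Q\<close>.
\<close>
inductive eqv :: "('x \<Rightarrow> 'x \<Rightarrow> bool) \<Rightarrow> ('x \<Rightarrow> nat) \<Rightarrow> ('x \<Rightarrow> nat) \<Rightarrow> bool"
  for Q where
  move: "locally_constant f \<Longrightarrow> \<gamma> \<in> carrier G \<Longrightarrow> \<forall>x. g (\<alpha> \<gamma> x) = f x \<Longrightarrow>
    \<forall>x. f x \<noteq> 0 \<longrightarrow> Q x (\<alpha> \<gamma> x) \<Longrightarrow> eqv Q f g"
| add: "eqv Q f g \<Longrightarrow> eqv Q f' g' \<Longrightarrow> eqv Q (\<lambda>x. f x + f' x) (\<lambda>x. g x + g' x)"

abbreviation equidec :: "('x \<Rightarrow> nat) \<Rightarrow> ('x \<Rightarrow> nat) \<Rightarrow> bool" (infix "\<simeq>" 50) where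
  "f \<simeq> g \<equiv> eqv (\<lambda>_ _. True) f g"

lemma eqv_addI:
  assumes "eqv Q f g" "eqv Q f' g'" "\<And>x. F x = f x + f' x" "\<And>x. H x = g x + g' x"
  shows "eqv Q F H"
proof -
  have "F = (\<lambda>x. f x + f' x)" "H = (\<lambda>x. g x + g' x)" using assms(3,4) by auto
  then show ?thesis using eqv.add[OF assms(1,2)] by simp
qed

lemma eqv_locally_constant:
  assumes "eqv Q f g"
  shows "locally_constant f" "locally_constant g"
proof -
  from assms have "locally_constant f \<and> locally_constant g"
  proof induction
    case (move f \<gamma> g)
    have "g = (\<lambda>x. f (\<alpha> (inv \<gamma>) x))"
    proof
      show "g x = f (\<alpha> (inv \<gamma>) x)" for x
        using move.hyps(3)[rule_format, of "\<alpha> (inv \<gamma>) x"] act_act_inv[OF move.hyps(2)] by simp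
    qed
    with move.hyps(1,2) show ?case using locally_constant_act[of f "inv \<gamma>"] by simp
  next
    case (add f g f' g')
    then show ?case by (auto intro: locally_constant_comp2[where h = "(+)"])
  qed
  then show "locally_constant f" "locally_constant g" by auto
qed

lemma eqv_zero: "eqv Q (\<lambda>x. 0) (\<lambda>x. 0)"
  by (rule eqv.move[of _ "\<one>"]) (auto intro: locally_constant_const)

lemma eqv_sum:
  assumes "finite I" "\<And>i. i \<in> I \<Longrightarrow> eqv Q (f i) (g i)"
  shows "eqv Q (\<lambda>x. \<Sum>i\<in>I. f i x) (\<lambda>x. \<Sum>i\<in>I. g i x)"
  using assms by (induction I) (auto intro: eqv_zero eqv.add)

lemma equidec_refl: "locally_constant f \<Longrightarrow> f \<simeq> f"
  by (rule eqv.move[of _ "\<one>"]) (auto simp: act_one)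

lemma equidec_mono: "eqv Q f g \<Longrightarrow> f \<simeq> g"
  by (induction rule: eqv.induct) (auto intro: eqv.intros)

lemma equidec_sym: "f \<simeq> g \<Longrightarrow> g \<simeq> f"
proof (induction rule: eqv.induct)
  case (move f \<gamma> g)
  then have "f \<simeq> g" by (intro eqv.move)
  then have "locally_constant g" by (rule eqv_locally_constant)
  moreover have "f (\<alpha> (inv \<gamma>) x) = g x" for x
    using move.hyps(3)[rule_format, of "\<alpha> (inv \<gamma>) x"] act_act_inv[OF move.hyps(2)] by simp
  ultimately show ?case by (intro eqv.move[of _ "inv \<gamma>"]) (use move.hyps(2) in auto)
qed (rule eqv.add)

text \<open>A final translation is absorbed into each move. This is the generating case of
  transitivity.\<close>

lemma equidec_act:
  assumes "\<gamma> \<in> carrier G"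
  shows "f \<simeq> g \<Longrightarrow> f \<simeq> (\<lambda>x. g (\<alpha> (inv \<gamma>) x))"
proof (induction rule: eqv.induct)
  case (move f \<delta> g)
  show ?case
  proof (rule eqv.move[of _ "\<gamma> \<otimes> \<delta>"])
    show "\<forall>x. g (\<alpha> (inv \<gamma>) (\<alpha> (\<gamma> \<otimes> \<delta>) x)) = f x"
      using move assms by (simp add: act_mult act_inv_act)
  qed (use move assms in auto)
qed (rule eqv.add)

text \<open>The refinement property: a decomposition of the target is pulled back to the source.
  Under a single move it is translated back; for a sum of moves the two decompositions of the target
  are first refined to a common one.\<close>

lemma equidec_split:
  assumes "f \<simeq> g" "locally_constant g1" "locally_constant g2" "\<forall>x. g x = g1 x + g2 x"
  shows "\<exists>f1 f2. f1 \<simeq> g1 \<and> f2 \<simeq> g2 \<and> (\<forall>x. f x = f1 x + f2 x)"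
  using assms
proof (induction arbitrary: g1 g2 rule: eqv.induct)
  case (move f \<gamma> g)
  have "(\<lambda>x. g1 (\<alpha> \<gamma> x)) \<simeq> g1" "(\<lambda>x. g2 (\<alpha> \<gamma> x)) \<simeq> g2"
    using move.prems(1,2) move.hyps(2) by (auto intro!: eqv.move locally_constant_act)
  moreover have "\<forall>x. f x = g1 (\<alpha> \<gamma> x) + g2 (\<alpha> \<gamma> x)"
    using move.hyps(3) move.prems(3) by metis
  ultimately show ?case by blast
next
  case (add f g f' g')
  have lc: "locally_constant g" "locally_constant g'"
    using add.hyps eqv_locally_constant by blast+
  \<comment> \<open>The 2 by 2 refinement matrix of \<open>g + g' = g1 + g2\<close>: rows
    \<open>a\<close>, \<open>b\<close> sum to \<open>g\<close> and \<open>c\<close>,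
    \<open>d\<close> to \<open>g'\<close>, while columns \<open>a\<close>, \<open>c\<close> sum to
    \<open>g1\<close> and \<open>b\<close>, \<open>d\<close> to \<open>g2\<close>. As
    \<open>a\<close> is a minimum and subtraction is truncated, \<open>b\<close> and
    \<open>c\<close> are never both nonzero.\<close>
  define a where "a x = min (g x) (g1 x)" for x
  define b where "b x = g x - g1 x" for x
  define c where "c x = g1 x - g x" for x
  define d where "d x = g' x - (g1 x - g x)" for x
  have lcs: "locally_constant a" "locally_constant b" "locally_constant c" "locally_constant d"
    unfolding a_def b_def c_def d_def
    by (intro locally_constant_comp2[where h = min] locally_constant_comp2[where h = "(-)"] lc add.prems)+
  have eq: "g x = a x + b x" "g' x = c x + d x" "g1 x = a x + c x" "g2 x = b x + d x" for x
    using add.prems(3)[rule_format, of x] unfolding a_def b_def c_def d_def by auto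
  obtain f1 f2 where f: "f1 \<simeq> a" "f2 \<simeq> b" "\<forall>x. f x = f1 x + f2 x"
    using add.IH(1)[OF lcs(1,2)] eq by blast
  obtain f1' f2' where f': "f1' \<simeq> c" "f2' \<simeq> d" "\<forall>x. f' x = f1' x + f2' x"
    using add.IH(2)[OF lcs(3,4)] eq by blast
  have "(\<lambda>x. f1 x + f1' x) \<simeq> g1" "(\<lambda>x. f2 x + f2' x) \<simeq> g2"
    using f f' eq by (auto intro: eqv_addI)
  moreover have "\<forall>x. f x + f' x = (f1 x + f1' x) + (f2 x + f2' x)" using f(3) f'(3) by simp
  ultimately show ?case by blast
qed

text \<open>The relation is generated by moves and sums only, so transitivity is a result. Induction
  runs over the second equivalence, and at a sum the first one is split accordingly.\<close>

lemma equidec_trans: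
  assumes "f \<simeq> g" "g \<simeq> h"
  shows "f \<simeq> h"
  using assms(2,1)
proof (induction arbitrary: f rule: eqv.induct)
  case (move g \<gamma> h)
  have "h = (\<lambda>x. g (\<alpha> (inv \<gamma>) x))"
  proof
    show "h x = g (\<alpha> (inv \<gamma>) x)" for x
      using move.hyps(3)[rule_format, of "\<alpha> (inv \<gamma>) x"] act_act_inv[OF move.hyps(2)] by simp
  qed
  then show ?case using equidec_act[OF move.hyps(2) move.prems] by simp
next
  case (add g h g' h')
  then obtain f1 f2 where f: "f1 \<simeq> g" "f2 \<simeq> g'" "\<forall>x. f x = f1 x + f2 x"
    using equidec_split[OF add.prems] eqv_locally_constant by blast
  then show ?case using add.IH by (auto intro: eqv_addI)
qed

section \<open>Push-forward of functions along piecewise maps\<close>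

definition push :: "('x \<Rightarrow> 'x) \<Rightarrow> ('x \<Rightarrow> 'c::comm_monoid_add) \<Rightarrow> 'x \<Rightarrow> 'c" where
  "push \<rho> f z = (\<Sum>x | \<rho> x = z. f x)"

text \<open>A point of the fibre over \<open>z\<close> is determined by its label, being
  \<open>\<alpha> (inv (c x)) z\<close>, and there are finitely many labels. Hence
  \<open>push\<close> never meets the default value 0 of a sum over an infinite set.\<close>

lemma finite_fibre:
  assumes "piecewise \<rho>"
  shows "finite {x. \<rho> x = z}"
proof -
  obtain c where c[rule_format]: "locally_constant c" "\<forall>x. c x \<in> carrier G" "\<forall>x. \<rho> x = \<alpha> (c x) x" "finite (range c)"
    using assms by (rule piecewiseE)
  have "{x. \<rho> x = z} \<subseteq> (\<lambda>\<gamma>. \<alpha> (inv \<gamma>) z) ` range c"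
  proof
    fix x assume "x \<in> {x. \<rho> x = z}"
    then have "x = \<alpha> (inv (c x)) z" using c(2,3) act_inv_act by auto
    then show "x \<in> (\<lambda>\<gamma>. \<alpha> (inv \<gamma>) z) ` range c" by blast
  qed
  then show ?thesis using c(4) finite_subset by blast
qed

text \<open>Replacing the varying fibre by the fixed finite index set \<open>range c\<close> allows
  local constancy and equidecomposability of a push-forward to be checked term by term.\<close>

lemma push_cocycle:
  assumes c: "finite (range c)" "\<And>x. c x \<in> carrier G" "\<And>x. \<rho> x = \<alpha> (c x) x"
  shows "push \<rho> f z = (\<Sum>\<gamma>\<in>range c. if c (\<alpha> (inv \<gamma>) z) = \<gamma> then f (\<alpha> (inv \<gamma>) z) else 0)"
proof -
  have "(\<Sum>\<gamma>\<in>range c. if c (\<alpha> (inv \<gamma>) z) = \<gamma> then f (\<alpha> (inv \<gamma>) z) else 0)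
     = (\<Sum>\<gamma> | \<gamma> \<in> range c \<and> c (\<alpha> (inv \<gamma>) z) = \<gamma>. f (\<alpha> (inv \<gamma>) z))"
    using c(1) by (simp add: sum.inter_filter)
  also have "\<dots> = (\<Sum>x | \<rho> x = z. f x)"
  proof (rule sum.reindex_bij_witness[of _ c "\<lambda>\<gamma>. \<alpha> (inv \<gamma>) z"])
    fix x assume "x \<in> {x. \<rho> x = z}"
    then have "z = \<alpha> (c x) x" using c(3) by simp
    then show x: "\<alpha> (inv (c x)) z = x" using c(2) act_inv_act by simp
    then show "c x \<in> {\<gamma> \<in> range c. c (\<alpha> (inv \<gamma>) z) = \<gamma>}" by simp
  next
    fix \<gamma> assume "\<gamma> \<in> {\<gamma> \<in> range c. c (\<alpha> (inv \<gamma>) z) = \<gamma>}"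
    then show "c (\<alpha> (inv \<gamma>) z) = \<gamma>" "\<alpha> (inv \<gamma>) z \<in> {x. \<rho> x = z}"
      using c(2,3) act_act_inv by (auto intro: range_subsetD)
  qed auto
  finally show ?thesis by (simp add: push_def)
qed

text \<open>The part of \<open>f\<close> carried by the points with label \<open>\<gamma>\<close> is
  moved by \<open>\<gamma>\<close>; the sum of these moves is the push-forward.\<close>

lemma equidec_push:
  assumes "piecewise \<rho>" "locally_constant f"
  shows "f \<simeq> push \<rho> f"
proof -
  obtain c where c[rule_format]: "locally_constant c" "\<forall>x. c x \<in> carrier G" "\<forall>x. \<rho> x = \<alpha> (c x) x" "finite (range c)"
    using assms(1) by (rule piecewiseE)
  have "(\<lambda>x. \<Sum>\<gamma>\<in>range c. if c x = \<gamma> then f x else 0) \<simeq>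
     (\<lambda>z. \<Sum>\<gamma>\<in>range c. if c (\<alpha> (inv \<gamma>) z) = \<gamma> then f (\<alpha> (inv \<gamma>) z) else 0)"
  proof (rule eqv_sum[OF c(4)])
    fix \<gamma> assume "\<gamma> \<in> range c"
    then have g: "\<gamma> \<in> carrier G" using c(2) by auto
    show "(\<lambda>x. if c x = \<gamma> then f x else 0) \<simeq>
      (\<lambda>z. if c (\<alpha> (inv \<gamma>) z) = \<gamma> then f (\<alpha> (inv \<gamma>) z) else 0)"
    proof (rule eqv.move[OF _ g])
      show "locally_constant (\<lambda>x. if c x = \<gamma> then f x else 0)"
        by (intro locally_constant_if locally_constant_comp[OF c(1)] assms(2) locally_constant_const)
    qed (simp_all add: act_inv_act g)
  qed
  moreover have "(\<lambda>x. \<Sum>\<gamma>\<in>range c. if c x = \<gamma> then f x else 0) = f"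
    using c(4) by (auto simp: sum.delta')
  moreover have "(\<lambda>z. \<Sum>\<gamma>\<in>range c. if c (\<alpha> (inv \<gamma>) z) = \<gamma> then f (\<alpha> (inv \<gamma>) z) else 0) = push \<rho> f"
    by (rule ext) (rule push_cocycle[OF c(4,2,3), symmetric])
  ultimately show ?thesis by simp
qed

lemma locally_constant_push:
  assumes "piecewise \<rho>" "locally_constant f"
  shows "locally_constant (push \<rho> f)"
proof -
  obtain c where c[rule_format]: "locally_constant c" "\<forall>x. c x \<in> carrier G" "\<forall>x. \<rho> x = \<alpha> (c x) x" "finite (range c)"
    using assms(1) by (rule piecewiseE)
  have "locally_constant (\<lambda>z. \<Sum>\<gamma>\<in>range c. if c (\<alpha> (inv \<gamma>) z) = \<gamma> then f (\<alpha> (inv \<gamma>) z) else 0)"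
  proof (rule locally_constant_sum)
    fix \<gamma> assume "\<gamma> \<in> range c"
    then have g: "inv \<gamma> \<in> carrier G" using c(2) by auto
    show "locally_constant (\<lambda>z. if c (\<alpha> (inv \<gamma>) z) = \<gamma> then f (\<alpha> (inv \<gamma>) z) else 0)"
      by (rule locally_constant_act[OF _ g, of "\<lambda>z. if c z = \<gamma> then f z else 0"])
        (intro locally_constant_if locally_constant_comp[OF c(1)] assms(2) locally_constant_const)
  qed
  moreover have "(\<lambda>z. \<Sum>\<gamma>\<in>range c. if c (\<alpha> (inv \<gamma>) z) = \<gamma> then f (\<alpha> (inv \<gamma>) z) else 0) = push \<rho> f"
    by (rule ext) (rule push_cocycle[OF c(4,2,3), symmetric])
  ultimately show ?thesis by simp
qed

text \<open>A fibre of the composition is grouped by the value of \<open>\<pi>\<close>.\<close>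

lemma push_comp:
  assumes "piecewise \<rho>" "piecewise \<pi>"
  shows "push (\<lambda>x. \<rho> (\<pi> x)) f = push \<rho> (push \<pi> f)"
proof
  fix z
  let ?S = "{x. \<rho> (\<pi> x) = z}" and ?T = "{y. \<rho> y = z}"
  have "(\<Sum>y\<in>?T. \<Sum>x\<in>{x \<in> ?S. \<pi> x = y}. f x) = sum f ?S"
    using finite_fibre[OF piecewise_comp[OF assms]] finite_fibre[OF assms(1)]
    by (intro sum.group) auto
  moreover have "(\<Sum>y\<in>?T. \<Sum>x\<in>{x \<in> ?S. \<pi> x = y}. f x) = (\<Sum>y\<in>?T. \<Sum>x | \<pi> x = y. f x)"
    by (intro sum.cong arg_cong2[where f = sum]) auto
  ultimately show "push (\<lambda>x. \<rho> (\<pi> x)) f z = push \<rho> (push \<pi> f) z"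
    unfolding push_def by simp
qed

lemma push_id: "push id f = f"
  by (auto simp: push_def)

lemma push_zero: "push \<rho> (\<lambda>x. 0) = (\<lambda>x. 0)"
  by (auto simp: push_def)

lemma push_add: "push \<rho> (\<lambda>x. f x + g x) = (\<lambda>x. push \<rho> f x + push \<rho> g x)"
  by (auto simp: push_def sum.distrib)

lemma push_diff: "push \<rho> (\<lambda>x. f x - g x :: 'c::ab_group_add) = (\<lambda>x. push \<rho> f x - push \<rho> g x)"
  by (auto simp: push_def sum_subtractf)

lemma push_uminus: "push \<rho> (\<lambda>x. - f x :: 'c::ab_group_add) = (\<lambda>x. - push \<rho> f x)"
  by (auto simp: push_def sum_negf)

lemma push_of_nat: "push \<rho> (\<lambda>x. int (f x)) = (\<lambda>x. int (push \<rho> f x))"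
  by (auto simp: push_def)

text \<open>Only the behaviour on the support matters, so a map may be altered freely where the
  function vanishes.\<close>

lemma push_cong:
  assumes "piecewise \<rho>" "piecewise \<pi>"
    and eq: "\<And>x. f x = 0 \<and> g x = 0 \<or> f x = g x \<and> \<rho> x = \<pi> x"
  shows "push \<rho> f = push \<pi> g"
  unfolding push_def
proof (rule ext, rule sum.mono_neutral_cong)
  fix z
  show "finite {x. \<rho> x = z}" "finite {x. \<pi> x = z}" by (simp_all add: finite_fibre assms)
  show "g x = 0" if "x \<in> {x. \<pi> x = z} - {x. \<rho> x = z}" for x using eq[of x] that by auto
  show "f x = 0" if "x \<in> {x. \<rho> x = z} - {x. \<pi> x = z}" for x using eq[of x] that by auto
  show "f x = g x" if "x \<in> {x. \<rho> x = z} \<inter> {x. \<pi> x = z}" for x using eq[of x] that by auto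
qed

text \<open>The bound 1 forces the summands of \<open>f\<close> to have disjoint supports, so the
  separate moves do not compete and combine into one map.\<close>

lemma eqv_imp_piecewise:
  assumes "eqv Q f g" "\<forall>x. f x \<le> 1"
  shows "\<exists>\<rho>. piecewise \<rho> \<and> push \<rho> f = g \<and> (\<forall>x. f x \<noteq> 0 \<longrightarrow> Q x (\<rho> x))"
  using assms
proof (induction rule: eqv.induct)
  case (move f \<gamma> g)
  have "push (\<alpha> \<gamma>) f z = g z" for z
  proof -
    have "{x. \<alpha> \<gamma> x = z} = {\<alpha> (inv \<gamma>) z}" using act_eq_iff[OF move.hyps(2)] by auto
    then show ?thesis
      using move.hyps(3)[rule_format, of "\<alpha> (inv \<gamma>) z"] act_act_inv[OF move.hyps(2)]
      by (simp add: push_def)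
  qed
  then have "push (\<alpha> \<gamma>) f = g" by (rule ext)
  with move.hyps(4) piecewise_act[OF move.hyps(2)] show ?case by blast
next
  case (add f g f' g')
  have "\<forall>x. f x \<le> 1" "\<forall>x. f' x \<le> 1" using add.prems add_leE by blast+
  then obtain \<rho> \<rho>' where
    r: "piecewise \<rho>" "push \<rho> f = g" "\<forall>x. f x \<noteq> 0 \<longrightarrow> Q x (\<rho> x)" and
    r': "piecewise \<rho>'" "push \<rho>' f' = g'" "\<forall>x. f' x \<noteq> 0 \<longrightarrow> Q x (\<rho>' x)"
    using add.IH by blast
  \<comment> \<open>Outside both supports the value \<open>\<rho>' x\<close> is a harmless
    default.\<close>
  let ?A = "{x. f x \<noteq> 0}" and ?\<rho> = "\<lambda>x. if f x \<noteq> 0 then \<rho> x else \<rho>' x"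
  have disj: "f x = 0 \<or> f' x = 0" for x using add.prems[rule_format, of x] by linarith
  have "clopen ?A"
    using locally_constant_clopen[OF eqv_locally_constant(1)[OF add.hyps(1)], of "- {0}"]
    by (simp add: vimage_def)
  then have p: "piecewise ?\<rho>" using piecewise_if[OF _ r(1) r'(1), of ?A] unfolding mem_Collect_eq by blast
  have "push ?\<rho> f = push \<rho> f" by (rule push_cong[OF p r(1)]) simp
  moreover have "push ?\<rho> f' = push \<rho>' f'" 
  proof (rule push_cong[OF p r'(1)])
    show "f' x = 0 \<and> f' x = 0 \<or> f' x = f' x \<and> ?\<rho> x = \<rho>' x" for x using disj[of x] by auto
  qed
  ultimately have "push ?\<rho> (\<lambda>x. f x + f' x) = (\<lambda>x. g x + g' x)"
    unfolding push_add using r(2) r'(2) by simp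
  moreover have "\<forall>x. f x + f' x \<noteq> 0 \<longrightarrow> Q x (?\<rho> x)" using r(3) r'(3) disj by auto
  ultimately show ?case using p by blast
qed

section \<open>Matchings inside the classes of a relation\<close>

lemma greedy_matching:
  assumes "\<forall>(D, \<gamma>)\<in>set L. clopen D \<and> \<gamma> \<in> carrier G \<and> (\<forall>x\<in>D. Q x (\<alpha> \<gamma> x))"
    and "locally_constant f" "locally_constant g"
  shows "\<exists>f1 f2 g1 g2. eqv Q f1 g1 \<and> locally_constant f2 \<and> locally_constant g2 \<and>
    (\<forall>x. f x = f1 x + f2 x) \<and> (\<forall>x. g x = g1 x + g2 x) \<and>
    (\<forall>(D, \<gamma>)\<in>set L. \<forall>x\<in>D. f2 x = 0 \<or> g2 (\<alpha> \<gamma> x) = 0)"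
  using assms(1)
proof (induction L)
  case Nil
  show ?case
    by (intro exI[of _ "\<lambda>x. 0"] exI[of _ f] exI[of _ g] conjI)
      (use assms(2,3) in \<open>simp_all add: eqv_zero\<close>)
next
  case (Cons m L)
  obtain D \<gamma> where m: "m = (D, \<gamma>)" by (cases m)
  then have D: "clopen D" "\<gamma> \<in> carrier G" "\<forall>x\<in>D. Q x (\<alpha> \<gamma> x)" using Cons.prems by auto
  have "\<forall>(D, \<gamma>)\<in>set L. clopen D \<and> \<gamma> \<in> carrier G \<and> (\<forall>x\<in>D. Q x (\<alpha> \<gamma> x))" using Cons.prems by simp
  then obtain f1 f2 g1 g2 where IH: "eqv Q f1 g1" "locally_constant f2" "locally_constant g2"
    "\<forall>x. f x = f1 x + f2 x" "\<forall>x. g x = g1 x + g2 x"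
    "\<forall>(D, \<gamma>)\<in>set L. \<forall>x\<in>D. f2 x = 0 \<or> g2 (\<alpha> \<gamma> x) = 0"
    using Cons.IH by blast
  \<comment> \<open>As much as possible of the leftovers is matched along the new move, after which
    one of them vanishes at \<open>x\<close> or at \<open>\<alpha> \<gamma> x\<close> for every
    \<open>x\<close> in \<open>D\<close>. Leftovers only shrink, so the same property persists for
    the moves treated before.\<close>
  define a where "a x = (if x \<in> D then min (f2 x) (g2 (\<alpha> \<gamma> x)) else 0)" for x
  define b where "b x = a (\<alpha> (inv \<gamma>) x)" for x
  have lca: "locally_constant a"
    unfolding a_def
    by (intro locally_constant_if locally_constant_mem locally_constant_const
        locally_constant_comp2[where h = min] locally_constant_act IH D)
  have ab: "eqv Q a b"
    by (rule eqv.move[OF lca D(2)]) (use D(2,3) in \<open>auto simp: b_def act_inv_act a_def\<close>)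
  have af: "a x \<le> f2 x" for x by (simp add: a_def)
  have bg: "b x \<le> g2 x" for x using act_act_inv[OF D(2)] by (simp add: b_def a_def)
  show ?case
  proof (intro exI conjI)
    show "eqv Q (\<lambda>x. f1 x + a x) (\<lambda>x. g1 x + b x)" by (rule eqv.add[OF IH(1) ab])
    show "locally_constant (\<lambda>x. f2 x - a x)" "locally_constant (\<lambda>x. g2 x - b x)"
      by (intro locally_constant_comp2[where h = "(-)"] IH lca eqv_locally_constant[OF ab])+
    show "\<forall>x. f x = f1 x + a x + (f2 x - a x)" "\<forall>x. g x = g1 x + b x + (g2 x - b x)"
      using IH(4,5) af bg by simp_all
    have "f2 x - a x = 0 \<or> g2 (\<alpha> \<gamma> x) - b (\<alpha> \<gamma> x) = 0" if "x \<in> D" for x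
      using that by (simp add: b_def act_inv_act D(2) a_def min_def)
    moreover have "f2 x - a x = 0 \<or> g2 (\<alpha> \<delta> x) - b (\<alpha> \<delta> x) = 0" if "(E, \<delta>) \<in> set L" "x \<in> E" for E \<delta> x
      using IH(6) that by fastforce
    ultimately show "\<forall>(D, \<gamma>)\<in>set (m # L). \<forall>x\<in>D. f2 x - a x = 0 \<or> g2 (\<alpha> \<gamma> x) - b (\<alpha> \<gamma> x) = 0"
      using m by auto
  qed
qed

text \<open>A move carries the mass of \<open>f\<close> bijectively onto that of \<open>g\<close>
  without leaving any class, so sums over classes are invariant.\<close>

lemma eqv_orbit_sum:
  assumes Q: "symp Q" "transp Q" "\<And>x. finite {y. Q x y}" and e: "eqv Q f g"
  shows "(\<Sum>y | Q x y. f y) = (\<Sum>y | Q x y. g y)"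
  using e
proof (induction rule: eqv.induct)
  case (move f \<gamma> g)
  have inv: "\<alpha> (inv \<gamma>) (\<alpha> \<gamma> y) = y" "\<alpha> \<gamma> (\<alpha> (inv \<gamma>) y) = y" for y
    using move.hyps(2) by (simp_all add: act_inv_act act_act_inv)
  have gf: "g y = f (\<alpha> (inv \<gamma>) y)" for y using move.hyps(3) inv(2) by metis
  \<comment> \<open>A move is known to respect \<open>Q\<close> only on the support of
    \<open>f\<close>, so the reindexing disregards points with value 0.\<close>
  show ?case
  proof (rule sum.reindex_bij_witness_not_neutral
      [of "{y. Q x y \<and> f y = 0}" "{y. Q x y \<and> g y = 0}" _ "\<alpha> (inv \<gamma>)" "\<alpha> \<gamma>"])
    show "finite {y. Q x y \<and> f y = 0}" "finite {y. Q x y \<and> g y = 0}" using Q(3)[of x] by auto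
    show "\<alpha> \<gamma> a \<in> {y. Q x y} - {y. Q x y \<and> g y = 0}" if "a \<in> {y. Q x y} - {y. Q x y \<and> f y = 0}" for a
    proof -
      have "Q x a" "f a \<noteq> 0" using that by auto
      then have "Q a (\<alpha> \<gamma> a)" using move.hyps(4) by blast
      then have "Q x (\<alpha> \<gamma> a)" using \<open>Q x a\<close> Q(2) by (meson transpD)
      then show ?thesis using \<open>f a \<noteq> 0\<close> move.hyps(3) by simp
    qed
    show "\<alpha> (inv \<gamma>) b \<in> {y. Q x y} - {y. Q x y \<and> f y = 0}" if "b \<in> {y. Q x y} - {y. Q x y \<and> g y = 0}" for b
    proof -
      have "Q x b" "f (\<alpha> (inv \<gamma>) b) \<noteq> 0" using that gf by auto
      then have "Q (\<alpha> (inv \<gamma>) b) b" using move.hyps(4)[rule_format, of "\<alpha> (inv \<gamma>) b"] inv(2) by simp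
      then have "Q x (\<alpha> (inv \<gamma>) b)" using \<open>Q x b\<close> Q(1,2) by (meson transpD sympD)
      then show ?thesis using \<open>f (\<alpha> (inv \<gamma>) b) \<noteq> 0\<close> by simp
    qed
  qed (use move.hyps(3) inv in auto)
qed (simp add: sum.distrib)

text \<open>If the greedy matching left something of \<open>f\<close> at \<open>x\<close>, the
  inequality of sums would leave something of \<open>g\<close> at some \<open>y\<close> in the class
  of \<open>x\<close>. But some move in \<open>L\<close> takes \<open>x\<close> to \<open>y\<close>,
  and after it one of the two leftovers is 0.\<close>

lemma orbit_sum_le_imp_eqv:
  assumes Q: "reflp Q" "symp Q" "transp Q" "\<And>x. finite {y. Q x y}"
    and L: "\<forall>(D, \<gamma>)\<in>set L. clopen D \<and> \<gamma> \<in> carrier G \<and> (\<forall>x\<in>D. Q x (\<alpha> \<gamma> x))"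
    and cover: "\<And>x y. Q x y \<Longrightarrow> \<exists>(D, \<gamma>)\<in>set L. x \<in> D \<and> y = \<alpha> \<gamma> x"
    and lc: "locally_constant f" "locally_constant g"
    and le: "\<And>x. (\<Sum>y | Q x y. f y) \<le> (\<Sum>y | Q x y. g y)"
  shows "\<exists>g1 g2. eqv Q f g1 \<and> locally_constant g2 \<and> (\<forall>x. g x = g1 x + g2 x)"
proof -
  obtain f1 f2 g1 g2 where m: "eqv Q f1 g1" "locally_constant f2" "locally_constant g2"
    "\<forall>x. f x = f1 x + f2 x" "\<forall>x. g x = g1 x + g2 x"
    "\<forall>(D, \<gamma>)\<in>set L. \<forall>x\<in>D. f2 x = 0 \<or> g2 (\<alpha> \<gamma> x) = 0"
    using greedy_matching[OF L lc] by blast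
  have "f2 x = 0" for x
  proof (rule ccontr)
    assume nz: "f2 x \<noteq> 0"
    have "(\<Sum>y | Q x y. f1 y) = (\<Sum>y | Q x y. g1 y)"
      by (rule eqv_orbit_sum[OF Q(2-4) m(1)])
    with le[of x] have "(\<Sum>y | Q x y. f2 y) \<le> (\<Sum>y | Q x y. g2 y)"
      using m(4,5) by (simp add: sum.distrib)
    moreover have "f2 x \<le> (\<Sum>y | Q x y. f2 y)"
      using Q(1,4) by (intro member_le_sum) (auto dest: reflpD)
    ultimately have "(\<Sum>y | Q x y. g2 y) \<noteq> 0" using nz by linarith
    then obtain y where y: "Q x y" "g2 y \<noteq> 0" by (metis (mono_tags, lifting) mem_Collect_eq sum.neutral)
    obtain D \<gamma> where D: "(D, \<gamma>) \<in> set L" "x \<in> D" "y = \<alpha> \<gamma> x" using cover[OF y(1)] by auto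
    have "\<forall>x\<in>D. f2 x = 0 \<or> g2 (\<alpha> \<gamma> x) = 0" using bspec[OF m(6) D(1)] by simp
    from bspec[OF this D(2)] D(3) y(2) nz show False by simp
  qed
  then have "f = f1" using m(4) by auto
  then show ?thesis using m by blast
qed

end

subsection \<open>The type semigroup as a quotient of locally constant functions\<close>

text \<open>Counting the smaller elements numbers a finite set in increasing order. This choice-free
  numbering lets columns be matched in a locally constant way.\<close>

lemma rank_bij:
  assumes "finite (S :: nat set)"
  shows "bij_betw (\<lambda>k. card {k'\<in>S. k' < k}) S {..<card S}"
proof -
  let ?r = "\<lambda>k. card {k'\<in>S. k' < k}"
  have less: "?r k < ?r l" if "k \<in> S" "k < l" for k l
    by (rule psubset_card_mono) (use that assms in auto)
  have inj: "inj_on ?r S"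
  proof (rule inj_onI, rule ccontr)
    fix k l assume "k \<in> S" "l \<in> S" "?r k = ?r l" "k \<noteq> l"
    then show False using less[of k l] less[of l k] by (cases "k < l") auto
  qed
  have "?r k < card S" if "k \<in> S" for k
    by (rule psubset_card_mono) (use that assms in auto)
  then have "?r ` S \<subseteq> {..<card S}" by auto
  moreover have "card (?r ` S) = card {..<card S}" using card_image[OF inj] by simp
  ultimately have "?r ` S = {..<card S}" by (intro card_subset_eq) auto
  with inj show ?thesis unfolding bij_betw_def by simp
qed

text \<open>For a point \<open>(x, n)\<close> of \<open>A\<close> this is its rank in the column of
  \<open>A\<close> above \<open>x\<close>, counted from 0.\<close>

definition count_below :: "('x \<times> nat) set \<Rightarrow> nat \<Rightarrow> 'x \<Rightarrow> nat" where
  "count_below A n x = card {k. k < n \<and> (x, k) \<in> A}"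

definition level_count :: "('x \<times> nat) set \<Rightarrow> 'x \<Rightarrow> nat" where
  "level_count A x = card {k. (x, k) \<in> A}"

text \<open>The standard set with prescribed level count, all columns being pushed down to the
  bottom.\<close>

definition subgraph :: "('x \<Rightarrow> nat) \<Rightarrow> ('x \<times> nat) set" where
  "subgraph f = {(x, n). n < f x}"

lemma level_count_subgraph: "level_count (subgraph f) = f"
  by (auto simp: level_count_def subgraph_def)

lemma bounded_clopenE:
  assumes "bounded_clopen A"
  obtains N where "\<And>x n. (x, n) \<in> A \<Longrightarrow> n < N"
proof -
  from assms obtain N where "\<forall>n\<ge>N. A \<inter> (UNIV \<times> {n}) = {}" unfolding bounded_clopen_def by blast
  then have "n < N" if "(x, n) \<in> A" for x n
    using that disjoint_iff[of A "UNIV \<times> {n}"] by (cases "n < N") auto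
  then show ?thesis by (rule that)
qed

lemma bounded_clopenI:
  assumes "locally_constant (\<lambda>p. p \<in> A)" "\<And>x n. (x, n) \<in> A \<Longrightarrow> n < N"
  shows "bounded_clopen A"
  unfolding bounded_clopen_def
proof (intro conjI exI[of _ N] allI impI)
  show "clopen A" using assms(1) by (simp add: locally_constant_pred_iff)
  show "A \<inter> (UNIV \<times> {n}) = {}" if "N \<le> n" for n using assms(2) that by force
qed

lemma locally_constant_slice:
  assumes "clopen A"
  shows "locally_constant (\<lambda>x. (x, n) \<in> A)"
  by (rule locally_constant_continuous[OF locally_constant_mem[OF assms], of "\<lambda>x. (x, n)"])
    (intro continuous_intros)

lemma locally_constant_fst:
  assumes "locally_constant f"
  shows "locally_constant (\<lambda>p. f (fst p))"
  by (rule locally_constant_continuous[OF assms]) (intro continuous_intros)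

lemma locally_constant_snd: "locally_constant (snd :: 'x::topological_space \<times> nat \<Rightarrow> nat)"
  unfolding locally_constant_def by (simp add: open_vimage_snd open_discrete)

lemma locally_constant_count_below:
  assumes "clopen A"
  shows "locally_constant (count_below A n)"
proof -
  have "count_below A n = (\<lambda>x. \<Sum>k<n. if (x, k) \<in> A then 1 else 0)"
    by (auto simp: count_below_def sum.If_cases Int_def lessThan_def)
  moreover have "locally_constant (\<lambda>x. \<Sum>k<n. if (x, k) \<in> A then 1 else 0 :: nat)"
    by (intro locally_constant_sum locally_constant_if locally_constant_slice assms locally_constant_const)
  ultimately show ?thesis by simp
qed

lemma level_count_eq_count_below:
  assumes "\<And>x n. (x, n) \<in> A \<Longrightarrow> n < N"
  shows "level_count A = count_below A N"
proof
  show "level_count A x = count_below A N x" for x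
    unfolding level_count_def count_below_def by (rule arg_cong[where f = card]) (use assms in auto)
qed

lemma locally_constant_level_count:
  assumes "bounded_clopen A"
  shows "locally_constant (level_count A)"
proof -
  obtain N where "\<And>x n. (x, n) \<in> A \<Longrightarrow> n < N" using assms by (rule bounded_clopenE) blast
  then have "level_count A = count_below A N" by (rule level_count_eq_count_below)
  then show ?thesis
    using locally_constant_count_below assms unfolding bounded_clopen_def by metis
qed

lemma finite_level:
  assumes "bounded_clopen A"
  shows "finite {k. (x, k) \<in> A}"
proof -
  obtain N where "\<And>x n. (x, n) \<in> A \<Longrightarrow> n < N" using assms by (rule bounded_clopenE) blast
  then have "{k. (x, k) \<in> A} \<subseteq> {..<N}" by blast
  then show ?thesis by (rule finite_subset) simp
qed

lemma level_count_Un: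
  assumes "bounded_clopen A" "bounded_clopen B" "A \<inter> B = {}"
  shows "level_count (A \<union> B) = (\<lambda>x. level_count A x + level_count B x)"
proof
  fix x
  have "{k. (x, k) \<in> A \<union> B} = {k. (x, k) \<in> A} \<union> {k. (x, k) \<in> B}" by blast
  moreover have "{k. (x, k) \<in> A} \<inter> {k. (x, k) \<in> B} = {}" using assms(3) by blast
  ultimately show "level_count (A \<union> B) x = level_count A x + level_count B x"
    unfolding level_count_def using assms by (simp add: card_Un_disjoint finite_level)
qed

lemma bounded_clopen_Un:
  assumes "bounded_clopen A" "bounded_clopen B"
  shows "bounded_clopen (A \<union> B)"
proof -
  obtain N M where NM: "\<And>x n. (x, n) \<in> A \<Longrightarrow> n < N" "\<And>x n. (x, n) \<in> B \<Longrightarrow> n < M"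
    using bounded_clopenE[OF assms(1)] bounded_clopenE[OF assms(2)] by metis
  show ?thesis
  proof (rule bounded_clopenI[of _ "max N M"])
    show "locally_constant (\<lambda>p. p \<in> A \<union> B)"
      using assms by (intro locally_constant_mem clopen_Un) (auto simp: bounded_clopen_def)
  qed (use NM in \<open>auto simp: less_max_iff_disj\<close>)
qed

context homeo_action
begin

lemma bounded_clopen_between:
  assumes "locally_constant (f :: 'x \<Rightarrow> nat)" "locally_constant g"
  shows "bounded_clopen {(x, n). f x \<le> n \<and> n < g x}"
proof -
  obtain N where N: "\<And>x. g x < N" using compact_space assms(2) by (rule locally_constant_bounded) blast
  show ?thesis
  proof (rule bounded_clopenI[of _ N])
    have "locally_constant (\<lambda>p. (f (fst p) \<le> snd p) \<and> (snd p < g (fst p)))"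
      by (intro locally_constant_comp2[where h = "(\<and>)"] locally_constant_comp2[where h = "(\<le>)"]
          locally_constant_comp2[where h = "(<)"] locally_constant_fst locally_constant_snd assms)
    then show "locally_constant (\<lambda>p. p \<in> {(x, n). f x \<le> n \<and> n < g x})"
      by (simp add: case_prod_beta)
  qed (use N in \<open>auto intro: less_trans\<close>)
qed

lemma bounded_clopen_subgraph: "locally_constant f \<Longrightarrow> bounded_clopen (subgraph (f :: 'x \<Rightarrow> nat))"
  using bounded_clopen_between[OF locally_constant_const[of 0]] by (simp add: subgraph_def)

section \<open>Equidecomposable sets and their level counts\<close>

definition shift :: "'g \<Rightarrow> (nat \<Rightarrow> nat) \<Rightarrow> 'x \<times> nat \<Rightarrow> 'x \<times> nat" where
  "shift \<gamma> \<sigma> = (\<lambda>(x, k). (\<alpha> \<gamma> x, \<sigma> k))"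

lemma equidecomposable_shift_iff:
  "equidecomposable G \<alpha> A B \<longleftrightarrow>
     (\<exists>n::nat. \<exists>E \<gamma> \<sigma>. (\<forall>i<n. clopen (E i) \<and> \<gamma> i \<in> carrier G \<and> bij (\<sigma> i :: nat \<Rightarrow> nat)) \<and>
        A = (\<Union>i<n. E i) \<and> (\<forall>i<n. \<forall>j<n. i \<noteq> j \<longrightarrow> E i \<inter> E j = {}) \<and>
        B = (\<Union>i<n. shift (\<gamma> i) (\<sigma> i) ` E i) \<and>
        (\<forall>i<n. \<forall>j<n. i \<noteq> j \<longrightarrow> shift (\<gamma> i) (\<sigma> i) ` E i \<inter> shift (\<gamma> j) (\<sigma> j) ` E j = {}))"
  unfolding equidecomposable_def shift_def ..

text \<open>Frees the pieces from numbering: sums and products of index sets serve as indices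
  below.\<close>

lemma equidecomposableI:
  fixes I :: "'i set"
  assumes I: "finite I" "\<And>i. i \<in> I \<Longrightarrow> clopen (E i) \<and> \<gamma> i \<in> carrier G \<and> bij (\<sigma> i)"
    and A: "A = (\<Union>i\<in>I. E i)" "\<And>i j. i \<in> I \<Longrightarrow> j \<in> I \<Longrightarrow> i \<noteq> j \<Longrightarrow> E i \<inter> E j = {}"
    and B: "B = (\<Union>i\<in>I. shift (\<gamma> i) (\<sigma> i) ` E i)"
      "\<And>i j. i \<in> I \<Longrightarrow> j \<in> I \<Longrightarrow> i \<noteq> j \<Longrightarrow> shift (\<gamma> i) (\<sigma> i) ` E i \<inter> shift (\<gamma> j) (\<sigma> j) ` E j = {}"
  shows "equidecomposable G \<alpha> A B"
proof -
  obtain h where h: "bij_betw h {0..<card I} I" using ex_bij_betw_nat_finite[OF I(1)] by blast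
  then have h: "bij_betw h {..<card I} I" by (simp add: atLeast0LessThan)
  have hI: "h i \<in> I" if "i < card I" for i using h that by (auto simp: bij_betw_def)
  have hne: "h i \<noteq> h j" if "i < card I" "j < card I" "i \<noteq> j" for i j
    using h that by (auto simp: bij_betw_def inj_on_def)
  have img: "(\<Union>i<card I. F (h i)) = (\<Union>i\<in>I. F i)" for F :: "'i \<Rightarrow> ('x \<times> nat) set"
    using h unfolding bij_betw_def by (metis image_image)
  show ?thesis
    unfolding equidecomposable_shift_iff
    by (rule exI[of _ "card I"], rule exI[of _ "\<lambda>i. E (h i)"], rule exI[of _ "\<lambda>i. \<gamma> (h i)"],
        rule exI[of _ "\<lambda>i. \<sigma> (h i)"])
      (simp add: I(2) A(2) B(2) hI hne img[of E] img[of "\<lambda>i. shift (\<gamma> i) (\<sigma> i) ` E i"] A(1)[symmetric] B(1)[symmetric])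
qed

lemma equidecomposable_Un:
  assumes "equidecomposable G \<alpha> A B" "equidecomposable G \<alpha> A' B'" "A \<inter> A' = {}" "B \<inter> B' = {}"
  shows "equidecomposable G \<alpha> (A \<union> A') (B \<union> B')"
proof -
  obtain n :: nat and E \<gamma> \<sigma> where e: "\<forall>i<n. clopen (E i) \<and> \<gamma> i \<in> carrier G \<and> bij (\<sigma> i :: nat \<Rightarrow> nat)"
    "A = (\<Union>i<n. E i)" "\<forall>i<n. \<forall>j<n. i \<noteq> j \<longrightarrow> E i \<inter> E j = {}"
    "B = (\<Union>i<n. shift (\<gamma> i) (\<sigma> i) ` E i)"
    "\<forall>i<n. \<forall>j<n. i \<noteq> j \<longrightarrow> shift (\<gamma> i) (\<sigma> i) ` E i \<inter> shift (\<gamma> j) (\<sigma> j) ` E j = {}"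
    using assms(1) unfolding equidecomposable_shift_iff by (elim exE conjE)
  obtain n' :: nat and E' \<gamma>' \<sigma>' where e': "\<forall>i<n'. clopen (E' i) \<and> \<gamma>' i \<in> carrier G \<and> bij (\<sigma>' i :: nat \<Rightarrow> nat)"
    "A' = (\<Union>i<n'. E' i)" "\<forall>i<n'. \<forall>j<n'. i \<noteq> j \<longrightarrow> E' i \<inter> E' j = {}"
    "B' = (\<Union>i<n'. shift (\<gamma>' i) (\<sigma>' i) ` E' i)"
    "\<forall>i<n'. \<forall>j<n'. i \<noteq> j \<longrightarrow> shift (\<gamma>' i) (\<sigma>' i) ` E' i \<inter> shift (\<gamma>' j) (\<sigma>' j) ` E' j = {}"
    using assms(2) unfolding equidecomposable_shift_iff by (elim exE conjE)
  have AA': "E i \<inter> E' j = {}" "E' j \<inter> E i = {}" if "i < n" "j < n'" for i j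
    using assms(3) e(2) e'(2) that by auto
  have BB': "shift (\<gamma> i) (\<sigma> i) ` E i \<inter> shift (\<gamma>' j) (\<sigma>' j) ` E' j = {}"
    "shift (\<gamma>' j) (\<sigma>' j) ` E' j \<inter> shift (\<gamma> i) (\<sigma> i) ` E i = {}" if "i < n" "j < n'" for i j
    using assms(4) e(4) e'(4) that by auto
  show ?thesis
  proof (rule equidecomposableI[of "{..<n} <+> {..<n'}" "case_sum E E'" "case_sum \<gamma> \<gamma>'" "case_sum \<sigma> \<sigma>'"])
    show "A \<union> A' = (\<Union>i\<in>{..<n} <+> {..<n'}. case_sum E E' i)"
      unfolding e(2) e'(2) by (auto simp: Plus_def)
    show "B \<union> B' = (\<Union>i\<in>{..<n} <+> {..<n'}. shift (case_sum \<gamma> \<gamma>' i) (case_sum \<sigma> \<sigma>' i) ` case_sum E E' i)"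
      unfolding e(4) e'(4) by (simp add: Plus_def UN_Un)
  next
    fix i j assume "i \<in> {..<n} <+> {..<n'}" "j \<in> {..<n} <+> {..<n'}" "i \<noteq> j"
    then show "case_sum E E' i \<inter> case_sum E E' j = {}"
      using e(3) e'(3) AA' by (elim PlusE) (simp_all)
  next
    fix i j assume "i \<in> {..<n} <+> {..<n'}" "j \<in> {..<n} <+> {..<n'}" "i \<noteq> j"
    then show "shift (case_sum \<gamma> \<gamma>' i) (case_sum \<sigma> \<sigma>' i) ` case_sum E E' i \<inter>
        shift (case_sum \<gamma> \<gamma>' j) (case_sum \<sigma> \<sigma>' j) ` case_sum E E' j = {}"
      using e(5) e'(5) BB' by (elim PlusE) (simp_all)
  next
    fix i assume "i \<in> {..<n} <+> {..<n'}"
    then show "clopen (case_sum E E' i) \<and> case_sum \<gamma> \<gamma>' i \<in> carrier G \<and> bij (case_sum \<sigma> \<sigma>' i)"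
      using e(1) e'(1) by (elim PlusE) simp_all
  qed simp
qed

text \<open>The permutation of levels does not change the size of a column, so each piece
  contributes the move by its \<open>\<gamma> i\<close>, and the pieces add up by
  disjointness.\<close>

lemma equidecomposable_imp_equidec:
  assumes A: "bounded_clopen A" and eq: "equidecomposable G \<alpha> A B"
  shows "level_count A \<simeq> level_count B"
proof -
  obtain n :: nat and E \<gamma> \<sigma> where e: "\<forall>i<n. clopen (E i) \<and> \<gamma> i \<in> carrier G \<and> bij (\<sigma> i :: nat \<Rightarrow> nat)"
    "A = (\<Union>i<n. E i)" "\<forall>i<n. \<forall>j<n. i \<noteq> j \<longrightarrow> E i \<inter> E j = {}"
    "B = (\<Union>i<n. shift (\<gamma> i) (\<sigma> i) ` E i)"
    "\<forall>i<n. \<forall>j<n. i \<noteq> j \<longrightarrow> shift (\<gamma> i) (\<sigma> i) ` E i \<inter> shift (\<gamma> j) (\<sigma> j) ` E j = {}"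
    using eq unfolding equidecomposable_shift_iff by (elim exE conjE)
  obtain N where N: "\<And>x n. (x, n) \<in> A \<Longrightarrow> n < N" using A by (rule bounded_clopenE) blast
  have E: "bounded_clopen (E i)" if "i < n" for i
    by (rule bounded_clopenI[of _ N]) (use that e(1,2) N in \<open>auto intro: locally_constant_mem\<close>)
  let ?F = "\<lambda>i. shift (\<gamma> i) (\<sigma> i) ` E i"
  have Flevel: "{k. (\<alpha> (\<gamma> i) x, k) \<in> ?F i} = \<sigma> i ` {k. (x, k) \<in> E i}" if "i < n" for i x
  proof -
    have "\<alpha> (\<gamma> i) x = \<alpha> (\<gamma> i) y \<longleftrightarrow> x = y" for y using act_inj e(1) that by blast
    then show ?thesis by (force simp: shift_def image_iff)
  qed
  have Ffin: "finite {k. (y, k) \<in> ?F i}" if "i < n" for i y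
    using Flevel[OF that, of "\<alpha> (inv (\<gamma> i)) y"] finite_level[OF E[OF that]] e(1) that
    by (simp add: act_act_inv)
  have "level_count A = (\<lambda>x. \<Sum>i<n. level_count (E i) x)"
  proof
    fix x
    have "{k. (x, k) \<in> A} = (\<Union>i<n. {k. (x, k) \<in> E i})" using e(2) by auto
    moreover have "card (\<Union>i<n. {k. (x, k) \<in> E i}) = (\<Sum>i<n. card {k. (x, k) \<in> E i})"
      using e(3) by (intro card_UN_disjoint) (auto intro: finite_level E)
    ultimately show "level_count A x = (\<Sum>i<n. level_count (E i) x)"
      unfolding level_count_def by simp
  qed
  moreover have "level_count B = (\<lambda>x. \<Sum>i<n. level_count (?F i) x)"
  proof
    fix x
    have "{k. (x, k) \<in> B} = (\<Union>i<n. {k. (x, k) \<in> ?F i})" using e(4) by auto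
    moreover have "card (\<Union>i<n. {k. (x, k) \<in> ?F i}) = (\<Sum>i<n. card {k. (x, k) \<in> ?F i})"
    proof (intro card_UN_disjoint ballI impI)
      fix i j assume "i \<in> {..<n}" "j \<in> {..<n}" "i \<noteq> j"
      then have "?F i \<inter> ?F j = {}" using e(5) by blast
      then show "{k. (x, k) \<in> ?F i} \<inter> {k. (x, k) \<in> ?F j} = {}" by blast
    qed (auto intro: Ffin)
    ultimately show "level_count B x = (\<Sum>i<n. level_count (?F i) x)"
      unfolding level_count_def by simp
  qed
  moreover have "level_count (E i) \<simeq> level_count (?F i)" if "i < n" for i
  proof (rule eqv.move[of _ "\<gamma> i"])
    show "\<forall>x. level_count (?F i) (\<alpha> (\<gamma> i) x) = level_count (E i) x"
      unfolding level_count_def Flevel[OF that]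
      using e(1) that by (auto intro!: card_image dest: bij_is_inj inj_on_subset)
  qed (use e(1) that in \<open>auto intro: locally_constant_level_count E\<close>)
  ultimately show ?thesis by (auto intro!: eqv_sum)
qed

text \<open>The column of \<open>A\<close> above \<open>x\<close> and that of \<open>B\<close> above
  \<open>\<alpha> \<gamma> x\<close> have equal size, so their points are paired in increasing
  order. Pieces are indexed by the pairs of levels that occur.\<close>

lemma equidecomposable_move:
  assumes A: "bounded_clopen A" and B: "bounded_clopen B" and \<gamma>: "\<gamma> \<in> carrier G"
    and eq: "\<And>x. level_count B (\<alpha> \<gamma> x) = level_count A x"
  shows "equidecomposable G \<alpha> A B"
proof -
  obtain N1 where N1: "\<And>x n. (x, n) \<in> A \<Longrightarrow> n < N1" using A by (rule bounded_clopenE) blast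
  obtain N2 where N2: "\<And>x n. (x, n) \<in> B \<Longrightarrow> n < N2" using B by (rule bounded_clopenE) blast
  have bijA: "bij_betw (\<lambda>k. count_below A k x) {k. (x, k) \<in> A} {..<level_count A x}" for x
    using rank_bij[OF finite_level[OF A, of x]]
    by (simp add: count_below_def level_count_def conj_commute)
  have bijB: "bij_betw (\<lambda>k. count_below B k y) {k. (y, k) \<in> B} {..<level_count B y}" for y
    using rank_bij[OF finite_level[OF B, of y]]
    by (simp add: count_below_def level_count_def conj_commute)
  \<comment> \<open>Level \<open>i\<close> above \<open>x\<close> is paired with level
    \<open>j\<close> above \<open>\<alpha> \<gamma> x\<close> when both points have the same
    rank.\<close>
  define R where "R x i j \<longleftrightarrow> (x, i) \<in> A \<and> (\<alpha> \<gamma> x, j) \<in> B \<and> count_below A i x = count_below B j (\<alpha> \<gamma> x)"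
    for x i j
  have R1: "\<exists>j. R x i j" if "(x, i) \<in> A" for x i
  proof -
    have "count_below A i x \<in> {..<level_count B (\<alpha> \<gamma> x)}"
      using bij_betwE[OF bijA[of x]] that eq by auto
    then have "count_below A i x \<in> (\<lambda>k. count_below B k (\<alpha> \<gamma> x)) ` {k. (\<alpha> \<gamma> x, k) \<in> B}"
      using bijB[of "\<alpha> \<gamma> x"] by (simp add: bij_betw_def)
    then show ?thesis unfolding R_def using that by auto
  qed
  have R2: "\<exists>i. R x i j" if "(\<alpha> \<gamma> x, j) \<in> B" for x j
  proof -
    have "count_below B j (\<alpha> \<gamma> x) \<in> {..<level_count A x}"
      using bij_betwE[OF bijB[of "\<alpha> \<gamma> x"]] that eq by auto
    then have "count_below B j (\<alpha> \<gamma> x) \<in> (\<lambda>k. count_below A k x) ` {k. (x, k) \<in> A}"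
      using bijA[of x] by (simp add: bij_betw_def)
    then show ?thesis unfolding R_def using that by auto
  qed
  have R3: "j = j'" if "R x i j" "R x i j'" for x i j j'
    using that inj_onD[OF bij_betw_imp_inj_on[OF bijB[of "\<alpha> \<gamma> x"]], of j j'] unfolding R_def by simp
  have R4: "i = i'" if "R x i j" "R x i' j" for x i i' j
    using that inj_onD[OF bij_betw_imp_inj_on[OF bijA[of x]], of i i'] unfolding R_def by simp
  have RN: "i < N1" "j < N2" if "R x i j" for x i j using that N1 N2 unfolding R_def by auto
  \<comment> \<open>The piece lies in level \<open>i\<close> alone, so any permutation sending
    \<open>i\<close> to \<open>j\<close> would serve; the transposition is the simplest.\<close>
  have img: "shift \<gamma> (Transposition.transpose i j) ` {(x, k). k = i \<and> R x i j} = {(\<alpha> \<gamma> x, j) | x. R x i j}" for i j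
    by (force simp: shift_def image_iff)
  have clA: "clopen A" "clopen B" using A B unfolding bounded_clopen_def by auto
  have lcR: "locally_constant (\<lambda>x. R x i j)" for i j
    unfolding R_def
    by (intro locally_constant_comp2[where h = "(\<and>)"] locally_constant_comp2[where h = "(=)"]
        locally_constant_slice locally_constant_count_below clA
        locally_constant_act[OF _ \<gamma>, of "\<lambda>y. (y, j) \<in> B"] locally_constant_act[OF _ \<gamma>, of "count_below B j"])
  show ?thesis
  proof (rule equidecomposableI[of "{..<N1} \<times> {..<N2}" "\<lambda>(i, j). {(x, k). k = i \<and> R x i j}" "\<lambda>_. \<gamma>"
        "\<lambda>(i, j). Transposition.transpose i j"])
    fix p assume "p \<in> {..<N1} \<times> {..<N2}"
    obtain i j where p: "p = (i, j)" by (cases p)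
    have "locally_constant (\<lambda>q. (snd q = i) \<and> R (fst q) i j)"
      by (intro locally_constant_comp2[where h = "(\<and>)"] locally_constant_comp[OF locally_constant_snd]
          locally_constant_fst[OF lcR])
    moreover have "{(x, k). k = i \<and> R x i j} = {q. (snd q = i) \<and> R (fst q) i j}" by auto
    ultimately show "clopen (case p of (i, j) \<Rightarrow> {(x, k). k = i \<and> R x i j}) \<and> \<gamma> \<in> carrier G \<and>
        bij (case p of (i, j) \<Rightarrow> Transposition.transpose i j)"
      using \<gamma> p by (simp add: locally_constant_pred_iff)
  next
    show "A = (\<Union>p\<in>{..<N1} \<times> {..<N2}. case p of (i, j) \<Rightarrow> {(x, k). k = i \<and> R x i j})"
    proof (intro subset_antisym subsetI)
      fix p assume "p \<in> A"
      then obtain x i where p: "p = (x, i)" "(x, i) \<in> A" by (cases p) auto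
      then obtain j where "R x i j" using R1 by blast
      then show "p \<in> (\<Union>p\<in>{..<N1} \<times> {..<N2}. case p of (i, j) \<Rightarrow> {(x, k). k = i \<and> R x i j})"
        using RN p by (intro UN_I[of "(i, j)"]) auto
    qed (auto simp: R_def)
    show "B = (\<Union>p\<in>{..<N1} \<times> {..<N2}. shift \<gamma> (case p of (i, j) \<Rightarrow> Transposition.transpose i j) `
        (case p of (i, j) \<Rightarrow> {(x, k). k = i \<and> R x i j}))" (is "_ = ?B")
    proof (intro subset_antisym subsetI)
      fix p assume "p \<in> B"
      then obtain y j where p: "p = (y, j)" "(y, j) \<in> B" by (cases p) auto
      define x where "x = \<alpha> (inv \<gamma>) y"
      have x: "\<alpha> \<gamma> x = y" using act_act_inv[OF \<gamma>] by (simp add: x_def)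
      then obtain i where R: "R x i j" using R2 p by blast
      then have "p \<in> shift \<gamma> (Transposition.transpose i j) ` {(x, k). k = i \<and> R x i j}" unfolding img using x p by auto
      then show "p \<in> ?B" using RN[OF R] by (intro UN_I[of "(i, j)"]) auto
    next
      fix p assume "p \<in> ?B"
      then obtain i j where "p \<in> shift \<gamma> (Transposition.transpose i j) ` {(x, k). k = i \<and> R x i j}" by auto
      then show "p \<in> B" unfolding img by (auto simp: R_def)
    qed
  next
    fix p q :: "nat \<times> nat" assume ne: "p \<noteq> q"
    obtain i j i' j' where p: "p = (i, j)" "q = (i', j')" by (cases p; cases q)
    show "(case p of (i, j) \<Rightarrow> {(x, k). k = i \<and> R x i j}) \<inter> (case q of (i, j) \<Rightarrow> {(x, k). k = i \<and> R x i j}) = {}"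
      using ne p R3 by auto
    have "{(\<alpha> \<gamma> x, j) | x. R x i j} \<inter> {(\<alpha> \<gamma> x, j') | x. R x i' j'} = {}"
      using ne p R4 act_inj[OF \<gamma>] by auto
    then show "shift \<gamma> (case p of (i, j) \<Rightarrow> Transposition.transpose i j) ` (case p of (i, j) \<Rightarrow> {(x, k). k = i \<and> R x i j}) \<inter>
        shift \<gamma> (case q of (i, j) \<Rightarrow> Transposition.transpose i j) ` (case q of (i, j) \<Rightarrow> {(x, k). k = i \<and> R x i j}) = {}"
      using p by (simp add: img)
  qed simp
qed

lemma equidec_imp_equidecomposable:
  assumes "f \<simeq> g" "bounded_clopen A" "bounded_clopen B" "level_count A = f" "level_count B = g"
  shows "equidecomposable G \<alpha> A B"
  using assms
proof (induction arbitrary: A B rule: eqv.induct)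
  case (move f \<gamma> g)
  then show ?case using equidecomposable_move[of A B \<gamma>] by simp
next
  case (add f g f' g')
  have split: "\<exists>A1 A2. bounded_clopen A1 \<and> bounded_clopen A2 \<and> A1 \<union> A2 = A \<and> A1 \<inter> A2 = {} \<and>
      level_count A1 = a \<and> level_count A2 = b"
    if A: "bounded_clopen A" and lc: "level_count A = (\<lambda>x. a x + b x)" "locally_constant a"
    for A and a b :: "'x \<Rightarrow> nat"
  proof -
    \<comment> \<open>The set is split by taking the lowest \<open>a x\<close> points of each
      column; the remaining points have level count \<open>b\<close>.\<close>
    define A1 where "A1 = {(x, n) \<in> A. count_below A n x < a x}"
    obtain N where N: "\<And>x n. (x, n) \<in> A \<Longrightarrow> n < N" using A by (rule bounded_clopenE) blast
    have clA: "clopen A" using A unfolding bounded_clopen_def by auto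
    have "locally_constant (\<lambda>p. p \<in> A1)"
    proof -
      have "locally_constant (\<lambda>x. count_below A n x < a x)" for n
        by (intro locally_constant_comp2[where h = "(<)"] locally_constant_count_below clA lc(2))
      then have "locally_constant (\<lambda>p. (n = snd p) \<and> (count_below A n (fst p) < a (fst p)))" for n
        by (intro locally_constant_comp2[where h = "(\<and>)"] locally_constant_comp[OF locally_constant_snd]
            locally_constant_fst[of "\<lambda>x. count_below A n x < a x"])
      then have "clopen {p. n = snd p \<and> count_below A n (fst p) < a (fst p)}" for n
        by (simp add: locally_constant_pred_iff)
      then have "clopen (A \<inter> (\<Union>n<N. {p. n = snd p \<and> count_below A n (fst p) < a (fst p)}))"
        using clA unfolding clopen_def by (intro conjI open_Int closed_Int open_UN closed_UN) auto
      moreover have "A1 = A \<inter> (\<Union>n<N. {p. n = snd p \<and> count_below A n (fst p) < a (fst p)})"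
        unfolding A1_def using N by auto
      ultimately have "clopen A1" by simp
      then show ?thesis by (rule locally_constant_mem)
    qed
    then have b1: "bounded_clopen A1" by (rule bounded_clopenI) (use N in \<open>auto simp: A1_def\<close>)
    then have "clopen (A \<inter> - A1)" using clA unfolding bounded_clopen_def by (intro clopen_Int clopen_Compl) auto
    then have b2: "bounded_clopen (A - A1)"
      by (intro bounded_clopenI[of _ N] locally_constant_mem) (use N in \<open>auto simp: Diff_eq\<close>)
    have c1: "level_count A1 = a"
    proof
      fix x
      have "bij_betw (\<lambda>k. count_below A k x) {k. (x, k) \<in> A} {..<level_count A x}"
        using rank_bij[OF finite_level[OF A, of x]]
        by (simp add: count_below_def level_count_def conj_commute)
      then have "bij_betw (\<lambda>k. count_below A k x) {k. (x, k) \<in> A1} {..<a x}"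
        unfolding A1_def bij_betw_def lc(1)
        by (auto intro: inj_on_subset)
      then show "level_count A1 x = a x"
        unfolding level_count_def using bij_betw_same_card by fastforce
    qed
    have "A1 \<union> (A - A1) = A" by (auto simp: A1_def)
    then have "level_count A = (\<lambda>x. level_count A1 x + level_count (A - A1) x)"
      using level_count_Un[OF b1 b2] by simp
    then have "level_count (A - A1) = b" using c1 lc(1) by (simp add: fun_eq_iff)
    then show ?thesis using b1 b2 c1 unfolding A1_def by blast
  qed
  obtain A1 A2 where A: "bounded_clopen A1" "bounded_clopen A2" "A1 \<union> A2 = A" "A1 \<inter> A2 = {}"
    "level_count A1 = f" "level_count A2 = f'"
    using split[OF add.prems(1) add.prems(3) eqv_locally_constant(1)[OF add.hyps(1)]] by blast
  obtain B1 B2 where B: "bounded_clopen B1" "bounded_clopen B2" "B1 \<union> B2 = B" "B1 \<inter> B2 = {}"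
    "level_count B1 = g" "level_count B2 = g'"
    using split[OF add.prems(2) add.prems(4) eqv_locally_constant(2)[OF add.hyps(1)]] by blast
  show ?case
    using equidecomposable_Un[OF add.IH(1)[OF A(1) B(1) A(5) B(5)] add.IH(2)[OF A(2) B(2) A(6) B(6)] A(4) B(4)]
    by (simp add: A(3) B(3))
qed

lemma equidecomposable_iff:
  "bounded_clopen A \<Longrightarrow> bounded_clopen B \<Longrightarrow>
    equidecomposable G \<alpha> A B \<longleftrightarrow> level_count A \<simeq> level_count B"
  using equidecomposable_imp_equidec equidec_imp_equidecomposable by blast

section \<open>Semigroup operations expressed by locally constant functions\<close>

definition type_of :: "('x \<Rightarrow> nat) \<Rightarrow> ('x \<times> nat) set set" where
  "type_of f = {B. bounded_clopen B \<and> f \<simeq> level_count B}"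

lemma tclass_eq: "bounded_clopen A \<Longrightarrow> tclass G \<alpha> A = type_of (level_count A)"
  unfolding tclass_def type_of_def by (auto simp: equidecomposable_iff)

lemma tclass_subgraph: "locally_constant f \<Longrightarrow> tclass G \<alpha> (subgraph f) = type_of f"
  by (simp add: tclass_eq bounded_clopen_subgraph level_count_subgraph)

lemma type_of_eq_iff:
  assumes "locally_constant f" "locally_constant g"
  shows "type_of f = type_of g \<longleftrightarrow> f \<simeq> g"
proof
  assume "type_of f = type_of g"
  moreover have "subgraph g \<in> type_of g"
    unfolding type_of_def using assms(2) by (simp add: bounded_clopen_subgraph level_count_subgraph equidec_refl)
  ultimately have "subgraph g \<in> type_of f" by simp
  then show "f \<simeq> g" by (simp add: type_of_def level_count_subgraph)
next
  assume "f \<simeq> g"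
  then show "type_of f = type_of g" unfolding type_of_def using equidec_trans equidec_sym by blast
qed

lemma type_semigroup_eq: "type_semigroup G \<alpha> = type_of ` {f. locally_constant f}"
proof -
  have "tclass G \<alpha> A \<in> type_of ` {f. locally_constant f}" if "bounded_clopen A" for A
    using that by (auto simp: tclass_eq intro: locally_constant_level_count)
  moreover have "type_of f \<in> tclass G \<alpha> ` {A. bounded_clopen A}" if "locally_constant f" for f
    using that tclass_subgraph[OF that] bounded_clopen_subgraph[OF that] by (metis image_eqI mem_Collect_eq)
  ultimately show ?thesis unfolding type_semigroup_def by auto
qed

lemma type_add_type_of:
  assumes f: "locally_constant f" and g: "locally_constant g"
  shows "type_add G \<alpha> (type_of f) (type_of g) = type_of (\<lambda>x. f x + g x)"
  unfolding type_add_def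
proof (rule the_equality)
  \<comment> \<open>A copy of \<open>g\<close> stacked on top of \<open>subgraph f\<close> supplies
    disjoint representatives. Uniqueness of the sum follows by counting levels of arbitrary disjoint
    representatives.\<close>
  let ?B = "{(x, n). f x \<le> n \<and> n < f x + g x}"
  have fg: "locally_constant (\<lambda>x. f x + g x)" using f g by (rule locally_constant_comp2)
  have B: "bounded_clopen ?B" by (rule bounded_clopen_between[OF f fg])
  have "{k. f x \<le> k \<and> k < f x + g x} = {f x..<f x + g x}" for x by auto
  then have "level_count ?B = g" by (auto simp: level_count_def)
  then have "?B \<in> type_of g" using B g by (simp add: type_of_def equidec_refl)
  moreover have "subgraph f \<in> type_of f"
    unfolding type_of_def using f by (simp add: bounded_clopen_subgraph level_count_subgraph equidec_refl)
  moreover have "subgraph f \<inter> ?B = {}" "subgraph f \<union> ?B = subgraph (\<lambda>x. f x + g x)"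
    by (auto simp: subgraph_def)
  moreover have "type_of (\<lambda>x. f x + g x) = tclass G \<alpha> (subgraph (\<lambda>x. f x + g x))"
    using tclass_subgraph[OF fg] by simp
  ultimately show "\<exists>A\<in>type_of f. \<exists>B\<in>type_of g. A \<inter> B = {} \<and> type_of (\<lambda>x. f x + g x) = tclass G \<alpha> (A \<union> B)"
    by (intro bexI[of _ "subgraph f"] bexI[of _ ?B] conjI) simp_all
next
  fix c assume "\<exists>A\<in>type_of f. \<exists>B\<in>type_of g. A \<inter> B = {} \<and> c = tclass G \<alpha> (A \<union> B)"
  then obtain A B where AB: "bounded_clopen A" "f \<simeq> level_count A" "bounded_clopen B" "g \<simeq> level_count B"
    "A \<inter> B = {}" "c = tclass G \<alpha> (A \<union> B)" unfolding type_of_def by blast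
  then have "c = type_of (\<lambda>x. level_count A x + level_count B x)"
    by (simp add: tclass_eq bounded_clopen_Un level_count_Un)
  moreover have "(\<lambda>x. f x + g x) \<simeq> (\<lambda>x. level_count A x + level_count B x)"
    by (rule eqv.add[OF AB(2,4)])
  ultimately show "c = type_of (\<lambda>x. f x + g x)"
    using type_of_eq_iff eqv_locally_constant by metis
qed

lemma type_smult_type_of:
  assumes f: "locally_constant f"
  shows "type_smult G \<alpha> n (type_of f) = type_of (\<lambda>x. n * f x)"
proof (induction n)
  case 0
  have "subgraph (\<lambda>x. 0) = ({} :: ('x \<times> nat) set)" by (simp add: subgraph_def)
  then show ?case
    using tclass_subgraph[OF locally_constant_const[of 0]] by (simp add: type_smult_def type_zero_def)
next
  case (Suc n)
  have "locally_constant (\<lambda>x. n * f x)" using f by (rule locally_constant_comp)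
  with Suc show ?case by (simp add: type_smult_def type_add_type_of f)
qed

lemma type_le_type_of:
  assumes f: "locally_constant f" and g: "locally_constant g"
  shows "type_le G \<alpha> (type_of f) (type_of g) \<longleftrightarrow> (\<exists>c. locally_constant c \<and> (\<lambda>x. f x + c x) \<simeq> g)"
proof -
  have "type_of g = type_add G \<alpha> (type_of f) (type_of c) \<longleftrightarrow> (\<lambda>x. f x + c x) \<simeq> g"
    if "locally_constant c" for c
    using type_of_eq_iff[OF g locally_constant_comp2[OF f that, of "(+)"]] that equidec_sym
    by (auto simp: type_add_type_of f)
  then show ?thesis unfolding type_le_def type_semigroup_eq by auto
qed

text \<open>With this and the next lemma the sets in \<open>X \<times> \<nat>\<close> leave the
  argument; only functions and equidecompositions remain.\<close>

lemma type_unperforated_iff: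
  "type_unperforated G \<alpha> \<longleftrightarrow> (\<forall>f g n. locally_constant f \<longrightarrow> locally_constant g \<longrightarrow> n \<ge> 1 \<longrightarrow>
     (\<exists>c. locally_constant c \<and> (\<lambda>x. n * f x + c x) \<simeq> (\<lambda>x. n * g x)) \<longrightarrow>
     (\<exists>c. locally_constant c \<and> (\<lambda>x. f x + c x) \<simeq> g))"
  unfolding type_unperforated_def type_semigroup_eq
  by (auto simp: type_smult_type_of type_le_type_of locally_constant_comp)

lemma type_cancellative_iff:
  "type_cancellative G \<alpha> \<longleftrightarrow> (\<forall>f g h. locally_constant f \<longrightarrow> locally_constant g \<longrightarrow> locally_constant h \<longrightarrow>
     (\<lambda>x. f x + g x) \<simeq> (\<lambda>x. f x + h x) \<longrightarrow> g \<simeq> h)"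
  unfolding type_cancellative_def type_semigroup_eq
  by (auto simp: type_add_type_of type_of_eq_iff locally_constant_comp2)

end

subsection \<open>Dense locally finite subgroups\<close>

definition orbit_rel :: "('x \<Rightarrow> 'x) set \<Rightarrow> 'x \<Rightarrow> 'x \<Rightarrow> bool" where
  "orbit_rel K x y \<longleftrightarrow> (\<exists>k\<in>K. y = k x)"

lemma orbit_rel_equiv:
  assumes "subgroup K homeo_group"
  shows "reflp (orbit_rel K)" "symp (orbit_rel K)" "transp (orbit_rel K)"
proof -
  have K: "K \<subseteq> Homeo" "id \<in> K" "\<And>f g. f \<in> K \<Longrightarrow> g \<in> K \<Longrightarrow> f \<circ> g \<in> K" "\<And>f. f \<in> K \<Longrightarrow> finv f \<in> K"
    using assms unfolding subgroup_homeo_iff by auto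
  show "reflp (orbit_rel K)" unfolding orbit_rel_def reflp_def using K(2) by (metis id_apply)
  show "transp (orbit_rel K)" unfolding orbit_rel_def transp_def using K(3) by (metis comp_apply)
  show "symp (orbit_rel K)"
    unfolding orbit_rel_def
  proof (intro sympI, elim bexE)
    fix x y k assume k: "k \<in> K" "y = k x"
    then have "inj k" using K(1) Homeo_iff bij_is_inj by blast
    then have "x = finv k y" using k(2) by simp
    then show "\<exists>k\<in>K. x = k y" using K(4)[OF k(1)] by blast
  qed
qed

context homeo_action
begin

text \<open>Density applied to the partition into level sets of \<open>f\<close> replaces
  \<open>\<gamma>\<close> by some \<open>h\<close> in \<open>H\<close> with the same images of these
  sets, so \<open>h\<close> also transports \<open>f\<close> to \<open>g\<close>. Quantifying over
  all \<open>K\<close> above a finite set makes the statement additive: the finite sets are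
  united.\<close>

lemma equidec_orbit_sum:
  assumes H: "dense_subgroup_of H (topological_full_group G \<alpha>)" and fg: "f \<simeq> g"
  shows "\<exists>F. finite F \<and> F \<subseteq> H \<and> (\<forall>K. subgroup K homeo_group \<and> F \<subseteq> K \<longrightarrow>
    (\<forall>x. (\<Sum>y | orbit_rel K x y. f y) = (\<Sum>y | orbit_rel K x y. g y)))"
  using fg
proof (induction rule: eqv.induct)
  case (move f \<gamma> g)
  have "topological_full_group G \<alpha> \<subseteq> Homeo" by (auto simp: topological_full_group_eq)
  from H[unfolded dense_subgroup_of_iff[OF this]]
  have dense: "\<forall>f\<in>topological_full_group G \<alpha>. \<forall>P. clopen_partition P \<longrightarrow> (\<exists>h\<in>H. \<forall>A\<in>P. h ` A = f ` A)"
    by (elim conjE)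
  have 1: "\<alpha> \<gamma> \<in> topological_full_group G \<alpha>"
    using move.hyps(2) by (simp add: topological_full_group_eq act_Homeo piecewise_act)
  have 2: "clopen_partition ((\<lambda>n. f -` {n}) ` range f)"
    by (rule clopen_partition_fibres[OF compact_space move.hyps(1)])
  from mp[OF spec[OF bspec[OF dense 1]] 2]
  obtain h where h: "h \<in> H" "\<forall>A\<in>(\<lambda>n. f -` {n}) ` range f. h ` A = \<alpha> \<gamma> ` A" ..
  have gh: "g (h x) = f x" for x
  proof -
    have "h x \<in> h ` (f -` {f x})" by simp
    then have "h x \<in> \<alpha> \<gamma> ` (f -` {f x})" using h(2) by auto
    then obtain y where "f y = f x" "h x = \<alpha> \<gamma> y" by auto
    then show ?thesis using move.hyps(3) by simp
  qed
  have "(\<Sum>y | orbit_rel K x y. f y) = (\<Sum>y | orbit_rel K x y. g y)"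
    if K: "subgroup K homeo_group" "h \<in> K" for K x
  proof (rule sum.reindex_bij_witness[of _ "finv h" h])
    have "h \<in> Homeo" using K unfolding subgroup_homeo_iff by auto
    then have "bij h" by (simp add: Homeo_iff)
    then show "finv h (h y) = y" "h (finv h y) = y" for y
      by (simp_all add: bij_is_inj bij_is_surj surj_f_inv_f)
    have hy: "orbit_rel K y (h y)" for y using K(2) unfolding orbit_rel_def by blast
    have fy: "orbit_rel K y (finv h y)" for y
      using K unfolding subgroup_homeo_iff orbit_rel_def by blast
    show "h y \<in> {y. orbit_rel K x y}" if "y \<in> {y. orbit_rel K x y}" for y
      using that hy transpD[OF orbit_rel_equiv(3)[OF K(1)]] by blast
    show "finv h y \<in> {y. orbit_rel K x y}" if "y \<in> {y. orbit_rel K x y}" for y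
      using that fy transpD[OF orbit_rel_equiv(3)[OF K(1)]] by blast
  qed (rule gh)
  then show ?case using h(1) by (intro exI[of _ "{h}"]) simp
next
  case (add f g f' g')
  then obtain F F' where "finite F" "F \<subseteq> H" "finite F'" "F' \<subseteq> H"
    and F: "\<And>K x. subgroup K homeo_group \<Longrightarrow> F \<subseteq> K \<Longrightarrow>
      (\<Sum>y | orbit_rel K x y. f y) = (\<Sum>y | orbit_rel K x y. g y)"
    and F': "\<And>K x. subgroup K homeo_group \<Longrightarrow> F' \<subseteq> K \<Longrightarrow>
      (\<Sum>y | orbit_rel K x y. f' y) = (\<Sum>y | orbit_rel K x y. g' y)"
    by (elim exE conjE) metis
  \<comment> \<open>An infinite orbit has sum 0 by convention, so additivity of sums covers every
    \<open>K\<close>.\<close>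
  then show ?case
    by (intro exI[of _ "F \<union> F'"]) (simp add: sum.distrib)
qed

text \<open>Each \<open>k\<close> in \<open>K\<close> is cut by its cocycle into finitely many
  partial translations. Together these moves connect any two points of an orbit, so the greedy
  matching applies.\<close>

lemma finite_group_orbit_sum_le:
  assumes K: "finite K" "subgroup K homeo_group" "K \<subseteq> topological_full_group G \<alpha>"
    and lc: "locally_constant f" "locally_constant g"
    and le: "\<And>x. (\<Sum>y | orbit_rel K x y. f y) \<le> (\<Sum>y | orbit_rel K x y. g y)"
  shows "\<exists>g1 g2. eqv (orbit_rel K) f g1 \<and> locally_constant g2 \<and> (\<forall>x. g x = g1 x + g2 x)"
proof -
  have "\<forall>k\<in>K. \<exists>c. cocycle_of c k"
    using K(3) unfolding topological_full_group_eq piecewise_def by blast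
  from bchoice[OF this] obtain c where "\<forall>k\<in>K. cocycle_of (c k) k" ..
  then have c: "cocycle_of (c k) k" if "k \<in> K" for k using that by simp
  let ?M = "\<Union>k\<in>K. (\<lambda>\<gamma>. (c k -` {\<gamma>}, \<gamma>)) ` range (c k)"
  have "finite (range (c k))" if "k \<in> K" for k
    using c[OF that] locally_constant_finite_range[OF compact_space] unfolding cocycle_of_def by blast
  then have "finite ?M" using K(1) by blast
  from finite_list[OF this] obtain L where L: "set L = ?M" ..
  show ?thesis
  proof (rule orbit_sum_le_imp_eqv[where L = L])
    show "reflp (orbit_rel K)" "symp (orbit_rel K)" "transp (orbit_rel K)"
      by (rule orbit_rel_equiv[OF K(2)])+
    have "{y. orbit_rel K x y} = (\<lambda>k. k x) ` K" for x unfolding orbit_rel_def by auto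
    then show "finite {y. orbit_rel K x y}" for x using K(1) by simp
    have "clopen (c k -` {\<gamma>}) \<and> \<gamma> \<in> carrier G \<and> (\<forall>x\<in>c k -` {\<gamma>}. orbit_rel K x (\<alpha> \<gamma> x))"
      if "k \<in> K" "\<gamma> \<in> range (c k)" for k \<gamma>
    proof (intro conjI ballI)
      show "clopen (c k -` {\<gamma>})" "\<gamma> \<in> carrier G"
        using c[OF that(1)] that(2) locally_constant_clopen unfolding cocycle_of_def by auto
      fix x assume "x \<in> c k -` {\<gamma>}"
      then have "\<alpha> \<gamma> x = k x" using c[OF that(1)] unfolding cocycle_of_def by simp
      then show "orbit_rel K x (\<alpha> \<gamma> x)" unfolding orbit_rel_def using that(1) by auto
    qed
    then show "\<forall>(D, \<gamma>)\<in>set L. clopen D \<and> \<gamma> \<in> carrier G \<and> (\<forall>x\<in>D. orbit_rel K x (\<alpha> \<gamma> x))"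
      unfolding L by auto
    show "\<exists>(D, \<gamma>)\<in>set L. x \<in> D \<and> y = \<alpha> \<gamma> x" if xy: "orbit_rel K x y" for x y
    proof -
      obtain k where k: "k \<in> K" "y = k x" using xy unfolding orbit_rel_def by blast
      then have "y = \<alpha> (c k x) x" using c[OF k(1)] unfolding cocycle_of_def by simp
      then show ?thesis unfolding L using k(1) by (intro bexI[of _ "(c k -` {c k x}, c k x)"]) auto
    qed
  qed (use lc le in auto)
qed

lemma dense_locally_finite_finite_group:
  assumes H: "dense_subgroup_of H (topological_full_group G \<alpha>)" and lf: "locally_finite_group H"
    and fg: "f \<simeq> g"
  obtains K where "finite K" "subgroup K homeo_group" "K \<subseteq> topological_full_group G \<alpha>"
    "\<And>x. (\<Sum>y | orbit_rel K x y. f y) = (\<Sum>y | orbit_rel K x y. g y)"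
proof -
  obtain F where F: "finite F" "F \<subseteq> H" "\<forall>K. subgroup K homeo_group \<and> F \<subseteq> K \<longrightarrow>
    (\<forall>x. (\<Sum>y | orbit_rel K x y. f y) = (\<Sum>y | orbit_rel K x y. g y))"
    using equidec_orbit_sum[OF H fg] by blast
  interpret HG: group "homeo_group :: ('x \<Rightarrow> 'x) monoid" by (rule group_homeo_group)
  let ?K = "generate homeo_group F"
  have sub: "subgroup H homeo_group" "H \<subseteq> topological_full_group G \<alpha>"
    using H unfolding dense_subgroup_of_def by auto
  have 1: "finite ?K" using lf F(1,2) unfolding locally_finite_group_def by simp
  have 2: "subgroup ?K homeo_group"
    by (rule HG.generate_is_subgroup) (rule subset_trans[OF F(2) subgroup.subset[OF sub(1)]])
  have "?K \<subseteq> H" by (rule HG.generate_subgroup_incl[OF F(2) sub(1)])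
  then have 3: "?K \<subseteq> topological_full_group G \<alpha>" using sub(2) by blast
  have "F \<subseteq> ?K" by (intro subsetI generate.incl)
  with F(3) 2 show ?thesis using that[OF 1 2 3] by simp
qed

text \<open>Over each orbit of a suitable finite group the hypothesis becomes an inequality between
  \<open>n\<close>-fold sums of natural numbers, where \<open>n\<close> can be divided out. The
  matching then realises the inequality by an equidecomposition.\<close>

lemma dense_locally_finite_imp_unperforated:
  assumes H: "dense_subgroup_of H (topological_full_group G \<alpha>)" and lf: "locally_finite_group H"
  shows "type_unperforated G \<alpha>"
  unfolding type_unperforated_iff
proof (intro allI impI, elim exE conjE)
  fix f g :: "'x \<Rightarrow> nat" and n :: nat and c
  assume f: "locally_constant f" and g: "locally_constant g" and n: "1 \<le> n"
    and c: "locally_constant c" "(\<lambda>x. n * f x + c x) \<simeq> (\<lambda>x. n * g x)"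
  obtain K where K: "finite K" "subgroup K homeo_group" "K \<subseteq> topological_full_group G \<alpha>"
    "\<And>x. (\<Sum>y | orbit_rel K x y. n * f y + c y) = (\<Sum>y | orbit_rel K x y. n * g y)"
    using H lf c(2) by (rule dense_locally_finite_finite_group) blast
  have "(\<Sum>y | orbit_rel K x y. f y) \<le> (\<Sum>y | orbit_rel K x y. g y)" for x
  proof -
    have "n * (\<Sum>y | orbit_rel K x y. f y) \<le> n * (\<Sum>y | orbit_rel K x y. g y)"
      using K(4)[of x] by (simp add: sum.distrib sum_distrib_left)
    then show ?thesis using n by simp
  qed
  from finite_group_orbit_sum_le[OF K(1-3) f g this]
  obtain g1 g2 where g12: "eqv (orbit_rel K) f g1" "locally_constant g2" "\<forall>x. g x = g1 x + g2 x"
    by blast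
  have "(\<lambda>x. f x + g2 x) \<simeq> g"
    by (rule eqv_addI[OF equidec_mono[OF g12(1)] equidec_refl[OF g12(2)]]) (use g12(3) in auto)
  then show "\<exists>c. locally_constant c \<and> (\<lambda>x. f x + c x) \<simeq> g" using g12(2) by blast
qed

text \<open>Cancelling the orbit sums of \<open>f\<close> leaves equal orbit sums of
  \<open>g\<close> and \<open>h\<close>. The matching of \<open>g\<close> into \<open>h\<close> then
  has a remainder with orbit sums 0, hence no remainder.\<close>

lemma dense_locally_finite_imp_cancellative:
  assumes H: "dense_subgroup_of H (topological_full_group G \<alpha>)" and lf: "locally_finite_group H"
  shows "type_cancellative G \<alpha>"
  unfolding type_cancellative_iff
proof (intro allI impI)
  fix f g h :: "'x \<Rightarrow> nat"
  assume f: "locally_constant f" and g: "locally_constant g" and h: "locally_constant h"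
    and eq: "(\<lambda>x. f x + g x) \<simeq> (\<lambda>x. f x + h x)"
  obtain K where K: "finite K" "subgroup K homeo_group" "K \<subseteq> topological_full_group G \<alpha>"
    "\<And>x. (\<Sum>y | orbit_rel K x y. f y + g y) = (\<Sum>y | orbit_rel K x y. f y + h y)"
    using H lf eq by (rule dense_locally_finite_finite_group) blast
  have gh: "(\<Sum>y | orbit_rel K x y. g y) = (\<Sum>y | orbit_rel K x y. h y)" for x
    using K(4)[of x] by (simp add: sum.distrib)
  from finite_group_orbit_sum_le[OF K(1-3) g h] gh
  obtain h1 h2 where h12: "eqv (orbit_rel K) g h1" "locally_constant h2" "\<forall>x. h x = h1 x + h2 x"
    by auto
  have fin: "finite {y. orbit_rel K x y}" for x
  proof -
    have "{y. orbit_rel K x y} = (\<lambda>k. k x) ` K" unfolding orbit_rel_def by auto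
    then show ?thesis using K(1) by simp
  qed
  have "h2 x = 0" for x
  proof -
    have "(\<Sum>y | orbit_rel K x y. g y) = (\<Sum>y | orbit_rel K x y. h1 y)"
      by (rule eqv_orbit_sum[OF orbit_rel_equiv(2,3)[OF K(2)] fin h12(1)])
    then have "(\<Sum>y | orbit_rel K x y. h2 y) = 0"
      using gh[of x] h12(3) by (simp add: sum.distrib)
    moreover have "orbit_rel K x x" using orbit_rel_equiv(1)[OF K(2)] by (simp add: reflpD)
    ultimately show ?thesis using fin[of x] by simp
  qed
  then have "h = h1" using h12(3) by auto
  then show "g \<simeq> h" using equidec_mono[OF h12(1)] by simp
qed

end

subsection \<open>Balanced functions and fibre groups\<close>

context homeo_action
begin

text \<open>As \<open>nat\<close> truncates at 0, the two sides are the positive and the negative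
  part of \<open>p\<close>.\<close>

abbreviation balanced :: "('x \<Rightarrow> int) \<Rightarrow> bool" where
  "balanced p \<equiv> (\<lambda>x. nat (p x)) \<simeq> (\<lambda>x. nat (- p x))"

text \<open>The push-forwards of \<open>f\<close> and \<open>g\<close> are equivalent, and they
  exceed the positive and the negative part of their difference by the same function. Cancellation
  removes the common excess.\<close>

lemma balanced_push:
  assumes canc: "type_cancellative G \<alpha>" and \<rho>: "piecewise \<rho>" and fg: "f \<simeq> g"
  shows "balanced (push \<rho> (\<lambda>x. int (f x) - int (g x)))"
proof -
  let ?p = "push \<rho> (\<lambda>x. int (f x) - int (g x))"
  have lc: "locally_constant f" "locally_constant g" using eqv_locally_constant[OF fg] by auto
  have p: "?p x = int (push \<rho> f x) - int (push \<rho> g x)" for x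
    by (simp add: push_diff push_of_nat)
  have lp: "locally_constant ?p"
    by (intro locally_constant_push \<rho> locally_constant_comp2[where h = "\<lambda>a b. int a - int b"] lc)
  have n: "(\<lambda>x. nat (?p x)) \<simeq> (\<lambda>x. nat (?p x))"
    by (rule equidec_refl, rule locally_constant_comp[OF lp])
  have "push \<rho> f \<simeq> push \<rho> g"
    by (rule equidec_trans[OF equidec_sym[OF equidec_push[OF \<rho> lc(1)]]
          equidec_trans[OF fg equidec_push[OF \<rho> lc(2)]]])
  from eqv.add[OF this n]
  have "(\<lambda>x. push \<rho> f x + nat (?p x)) \<simeq> (\<lambda>x. push \<rho> g x + nat (?p x))" .
  \<comment> \<open>With the positive part added on both sides, the right side is rewritten so that
    \<open>push \<rho> f\<close> becomes the common summand to cancel.\<close>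
  moreover have "(\<lambda>x. push \<rho> g x + nat (?p x)) = (\<lambda>x. push \<rho> f x + nat (- ?p x))"
    by (rule ext) (simp add: p)
  ultimately have "(\<lambda>x. push \<rho> f x + nat (?p x)) \<simeq> (\<lambda>x. push \<rho> f x + nat (- ?p x))" by simp
  moreover have "locally_constant (push \<rho> f)" by (rule locally_constant_push[OF \<rho> lc(1)])
  moreover have "locally_constant (\<lambda>x. nat (?p x))" "locally_constant (\<lambda>x. nat (- ?p x))"
    by (rule locally_constant_comp[OF lp])+
  ultimately show ?thesis using canc unfolding type_cancellative_iff by simp
qed

lemma balanced_push_balanced:
  assumes "type_cancellative G \<alpha>" "piecewise \<rho>" "balanced p"
  shows "balanced (push \<rho> p)"
proof -
  have "(\<lambda>x. int (nat (p x)) - int (nat (- p x))) = p" by (rule ext) simp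
  then show ?thesis using balanced_push[OF assms] by simp
qed

text \<open>The level set \<open>{p = m}\<close> is folded into \<open>{p < 0}\<close>; applied to \<open>p\<close> and \<open>- p\<close> in turn, this lowers \<open>|p|\<close>.\<close>
lemma lower_maximum:
  assumes unp: "type_unperforated G \<alpha>" and canc: "type_cancellative G \<alpha>"
    and p: "locally_constant p" "balanced p" and m: "1 \<le> m" "l \<le> m"
    and bnd: "\<And>x. - int l \<le> p x" "\<And>x. p x \<le> int m"
  shows "\<exists>\<rho>. piecewise \<rho> \<and> (\<forall>x. - int l \<le> push \<rho> p x \<and> push \<rho> p x \<le> int m - 1) \<and> balanced (push \<rho> p)"
proof -
  define E N :: "'x \<Rightarrow> nat" where "E x = (if p x = int m then 1 else 0)" and "N x = (if p x < 0 then 1 else 0)" for x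
  have lE: "locally_constant E" and lN: "locally_constant N"
    unfolding E_def N_def by (rule locally_constant_comp[OF p(1)])+
  \<comment> \<open>The sum of the gaps in \<open>m * E \<le> nat p\<close> and
    \<open>nat (- p) \<le> m * N\<close>; the latter uses \<open>l \<le> m\<close>. Balancedness
    turns it into the complement of \<open>m * E\<close> in \<open>m * N\<close>.\<close>
  define c where "c x = (nat (p x) - m * E x) + (m * N x - nat (- p x))" for x
  have lc: "locally_constant c"
    unfolding c_def E_def N_def by (rule locally_constant_comp[OF p(1)])
  have le: "nat (- p x) \<le> m * N x" "m * E x \<le> nat (p x)" for x
    using bnd(1)[of x] m(2) by (auto simp: N_def E_def)
  have "(\<lambda>x. m * N x - nat (- p x)) \<simeq> (\<lambda>x. m * N x - nat (- p x))"
    by (rule equidec_refl) (simp add: N_def, rule locally_constant_comp[OF p(1)])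
  from eqv.add[OF p(2) this]
  have "(\<lambda>x. nat (p x) + (m * N x - nat (- p x))) \<simeq> (\<lambda>x. nat (- p x) + (m * N x - nat (- p x)))" .
  moreover have "(\<lambda>x. nat (p x) + (m * N x - nat (- p x))) = (\<lambda>x. m * E x + c x)"
  proof
    show "nat (p x) + (m * N x - nat (- p x)) = m * E x + c x" for x
      using le(2)[of x] by (simp add: c_def)
  qed
  moreover have "(\<lambda>x. nat (- p x) + (m * N x - nat (- p x))) = (\<lambda>x. m * N x)"
    using le(1) by (intro ext) simp
  ultimately have "(\<lambda>x. m * E x + c x) \<simeq> (\<lambda>x. m * N x)" by simp
  then have "\<exists>c. locally_constant c \<and> (\<lambda>x. m * E x + c x) \<simeq> (\<lambda>x. m * N x)" using lc by blast
  then have "\<exists>c. locally_constant c \<and> (\<lambda>x. E x + c x) \<simeq> N"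
    using unp lE lN m(1) unfolding type_unperforated_iff by blast
  then obtain c' where c': "locally_constant c'" "(\<lambda>x. E x + c' x) \<simeq> N" by blast
  \<comment> \<open>Unperforation gave that \<open>E\<close> is dominated by \<open>N\<close>;
    splitting locates a copy \<open>n1\<close> of \<open>E\<close> inside the set where
    \<open>p\<close> is negative.\<close>
  obtain n1 n2 where n: "n1 \<simeq> E" "n2 \<simeq> c'" "\<forall>x. N x = n1 x + n2 x"
    using equidec_split[OF equidec_sym[OF c'(2)] lE c'(1)] by auto
  have "\<forall>x. E x \<le> 1" by (simp add: E_def)
  then obtain \<rho>0 where \<rho>0: "piecewise \<rho>0" "push \<rho>0 E = n1"
    using eqv_imp_piecewise[OF equidec_sym[OF n(1)]] by blast
  \<comment> \<open>Only the level set is moved, so everything else of \<open>p\<close> stays in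
    place.\<close>
  define \<rho> where "\<rho> x = (if x \<in> {x. p x = int m} then \<rho>0 x else id x)" for x
  have "clopen {x. p x = int m}"
    using locally_constant_clopen[OF p(1), of "{int m}"] by (simp add: vimage_def)
  then have \<rho>: "piecewise \<rho>" unfolding \<rho>_def by (rule piecewise_if[OF _ \<rho>0(1) piecewise_id])
  have "push \<rho> (\<lambda>x. int (m * E x)) = push \<rho>0 (\<lambda>x. int (m * E x))"
    by (rule push_cong[OF \<rho> \<rho>0(1)]) (simp add: E_def \<rho>_def)
  also have "\<dots> = (\<lambda>x. int (m * n1 x))"
    unfolding \<rho>0(2)[symmetric] by (rule ext) (simp add: push_def sum_distrib_left)
  finally have 1: "push \<rho> (\<lambda>x. int (m * E x)) = (\<lambda>x. int (m * n1 x))" .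
  have "push \<rho> (\<lambda>x. p x - int (m * E x)) = push id (\<lambda>x. p x - int (m * E x))"
    by (rule push_cong[OF \<rho> piecewise_id]) (simp add: E_def \<rho>_def)
  then have 2: "push \<rho> (\<lambda>x. p x - int (m * E x)) = (\<lambda>x. p x - int (m * E x))"
    by (simp add: push_id)
  have "push \<rho> (\<lambda>x. int (m * E x) + (p x - int (m * E x))) = (\<lambda>x. int (m * n1 x) + (p x - int (m * E x)))"
    unfolding push_add 1 2 ..
  then have q: "push \<rho> p = (\<lambda>x. int (m * n1 x) + (p x - int (m * E x)))" by simp
  have "- int l \<le> push \<rho> p x \<and> push \<rho> p x \<le> int m - 1" for x
  proof (cases "n1 x = 0")
    case True
    then show ?thesis using bnd[of x] m unfolding q by (auto simp: E_def)
  next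
    case False
    \<comment> \<open>Such a point receives exactly one point of the level set, so its new value
      \<open>p x + m\<close> lies between \<open>m - l\<close> and \<open>m - 1\<close>.\<close>
    then have "n1 x = 1" "p x < 0"
      using n(3)[rule_format, of x] by (auto simp: N_def split: if_splits)
    then show ?thesis using bnd[of x] m unfolding q by (auto simp: E_def)
  qed
  with \<rho> balanced_push_balanced[OF canc \<rho> p(2)] show ?thesis by blast
qed

text \<open>Induction on the bound for the absolute value. One step lowers the maximum, then, after
  a change of sign, raises the minimum; composing the maps gives a single push-forward.\<close>

lemma balanced_push_zero:
  assumes unp: "type_unperforated G \<alpha>" and canc: "type_cancellative G \<alpha>"
  shows "locally_constant p \<Longrightarrow> balanced p \<Longrightarrow> (\<And>x. \<bar>p x\<bar> \<le> int m) \<Longrightarrow>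
    \<exists>\<rho>. piecewise \<rho> \<and> push \<rho> p = (\<lambda>x. 0)"
proof (induction m arbitrary: p)
  case 0
  then have "push id p = (\<lambda>x. 0)" by (auto simp: push_id)
  then show ?case using piecewise_id by blast
next
  case (Suc m)
  have "- int (Suc m) \<le> p x" "p x \<le> int (Suc m)" for x using Suc.prems(3)[of x] by auto
  from lower_maximum[OF unp canc Suc.prems(1,2) _ order_refl this]
  obtain \<rho>1 where r1: "piecewise \<rho>1" "balanced (push \<rho>1 p)"
    "\<forall>x. - int (Suc m) \<le> push \<rho>1 p x \<and> push \<rho>1 p x \<le> int (Suc m) - 1" by auto
  define q where "q x = - push \<rho>1 p x" for x
  have q: "locally_constant q" "balanced q"
    unfolding q_def
    using locally_constant_comp[OF locally_constant_push[OF r1(1) Suc.prems(1)], of uminus]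
      equidec_sym[OF r1(2)] by simp_all
  \<comment> \<open>After the first step the bounds are unequal, which is why
    \<open>lower_maximum\<close> treats the lower bound \<open>l\<close> separately from
    \<open>m\<close>.\<close>
  have bq: "- int m \<le> q x" "q x \<le> int (Suc m)" for x
    using r1(3)[rule_format, of x] by (auto simp: q_def)
  from lower_maximum[OF unp canc q _ _ bq]
  obtain \<rho>2 where r2: "piecewise \<rho>2" "balanced (push \<rho>2 q)"
    "\<forall>x. - int m \<le> push \<rho>2 q x \<and> push \<rho>2 q x \<le> int (Suc m) - 1" by auto
  have "\<bar>push \<rho>2 q x\<bar> \<le> int m" for x using r2(3)[rule_format, of x] by auto
  from Suc.IH[OF locally_constant_push[OF r2(1) q(1)] r2(2) this]
  obtain \<rho>3 where r3: "piecewise \<rho>3" "push \<rho>3 (push \<rho>2 q) = (\<lambda>x. 0)" by blast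
  have "q = (\<lambda>x. - push \<rho>1 p x)" by (rule ext) (simp add: q_def)
  then have "push \<rho>3 (push \<rho>2 q) = (\<lambda>x. - push \<rho>3 (push \<rho>2 (push \<rho>1 p)) x)"
    by (simp add: push_uminus)
  then have "push \<rho>3 (push \<rho>2 (push \<rho>1 p)) = (\<lambda>x. 0)"
    using r3(2) by (metis neg_equal_0_iff_equal)
  then have "push (\<lambda>x. \<rho>3 (\<rho>2 (\<rho>1 x))) p = (\<lambda>x. 0)"
    by (simp only: push_comp[OF piecewise_comp[OF r3(1) r2(1)] r1(1)] push_comp[OF r3(1) r2(1)])
  moreover have "piecewise (\<lambda>x. \<rho>3 (\<rho>2 (\<rho>1 x)))"
    by (rule piecewise_comp[OF r3(1) piecewise_comp[OF r2(1) r1(1)]])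
  ultimately show ?case by blast
qed

text \<open>The new map is built on top of a given \<open>\<pi>\<close> so that successive maps
  factor through each other.\<close>

lemma equidec_push_zero:
  assumes unp: "type_unperforated G \<alpha>" and canc: "type_cancellative G \<alpha>"
    and \<pi>: "piecewise \<pi>" and fg: "f \<simeq> g"
  shows "\<exists>\<rho>. piecewise \<rho> \<and> push (\<lambda>x. \<rho> (\<pi> x)) (\<lambda>x. int (f x) - int (g x)) = (\<lambda>x. 0)"
proof -
  let ?p = "push \<pi> (\<lambda>x. int (f x) - int (g x))"
  have lp: "locally_constant ?p"
    by (intro locally_constant_push \<pi> locally_constant_comp2[where h = "\<lambda>a b. int a - int b"]
        eqv_locally_constant[OF fg])
  have "locally_constant (\<lambda>x. nat \<bar>?p x\<bar>)" by (rule locally_constant_comp[OF lp])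
  from locally_constant_bounded[OF compact_space this]
  obtain m where m: "\<And>x. nat \<bar>?p x\<bar> < m" by blast
  have "\<bar>?p x\<bar> \<le> int m" for x using m[of x] by linarith
  from balanced_push_zero[OF unp canc lp balanced_push[OF canc \<pi> fg] this]
  obtain \<rho> where "piecewise \<rho>" "push \<rho> ?p = (\<lambda>x. 0)" by blast
  then show ?thesis by (intro exI[of _ \<rho>]) (simp add: push_comp[OF _ \<pi>])
qed

section \<open>Homeomorphisms preserving the fibres of a map\<close>

definition fibre_group :: "('x \<Rightarrow> 'x) \<Rightarrow> ('x \<Rightarrow> 'x) set" where
  "fibre_group \<pi> = {g \<in> Homeo. \<forall>x. \<pi> (g x) = \<pi> x}"

lemma subgroup_fibre_group: "subgroup (fibre_group \<pi>) homeo_group"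
proof -
  have "\<pi> (finv g x) = \<pi> x" if "g \<in> Homeo" "\<forall>x. \<pi> (g x) = \<pi> x" for g x
    using that(2)[rule_format, of "finv g x"] that(1) by (simp add: Homeo_iff bij_is_surj surj_f_inv_f)
  then show ?thesis
    unfolding subgroup_homeo_iff fibre_group_def by (simp add: Homeo_id Homeo_comp Homeo_inv subset_iff)
qed

text \<open>The cocycle labels the points of each fibre injectively, so labels act as coordinates
  along fibres.\<close>

lemma cocycle_separates:
  assumes "\<And>x. c x \<in> carrier G" "\<And>x. \<pi> x = \<alpha> (c x) x" "\<pi> x = \<pi> y" "c x = c y"
  shows "x = y"
  using assms act_inj by metis

text \<open>Since \<open>x\<close> and \<open>g x\<close> have the same image under
  \<open>\<pi>\<close>, one gets from \<open>x\<close> to \<open>g x\<close> by applying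
  \<open>c x\<close> and undoing \<open>c (g x)\<close>; both labels depend locally constantly on
  \<open>x\<close>.\<close>

lemma fibre_group_piecewise:
  assumes \<pi>: "piecewise \<pi>" and g: "g \<in> fibre_group \<pi>"
  shows "piecewise g"
proof -
  obtain c where c[rule_format]: "locally_constant c" "\<forall>x. c x \<in> carrier G" "\<forall>x. \<pi> x = \<alpha> (c x) x" "finite (range c)"
    using \<pi> by (rule piecewiseE)
  have gh: "g \<in> Homeo" "\<And>x. \<pi> (g x) = \<pi> x" using g unfolding fibre_group_def by auto
  then have cont: "continuous_on UNIV g" by (simp add: Homeo_iff)
  show ?thesis
  proof (rule piecewiseI)
    show "locally_constant (\<lambda>x. inv (c (g x)) \<otimes> c x)"
      by (rule locally_constant_comp2[OF locally_constant_continuous[OF c(1) cont] c(1)])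
    show "inv (c (g x)) \<otimes> c x \<in> carrier G" for x using c(2) by simp
    show "g x = \<alpha> (inv (c (g x)) \<otimes> c x) x" for x
    proof -
      have "\<alpha> (c (g x)) (g x) = \<alpha> (c x) x" using gh(2)[of x] c(3) by metis
      then show ?thesis using c(2) act_inv_act[of "c (g x)" "g x"] by (simp add: act_mult)
    qed
  qed
qed

text \<open>Within a fibre, a point is fixed exactly when its label is unchanged, and this is a
  locally constant condition.\<close>

lemma fibre_group_clopen_fixed:
  assumes \<pi>: "piecewise \<pi>" and g: "g \<in> fibre_group \<pi>"
  shows "clopen {x. g x = x}"
proof -
  obtain c where c[rule_format]: "locally_constant c" "\<forall>x. c x \<in> carrier G" "\<forall>x. \<pi> x = \<alpha> (c x) x" "finite (range c)"
    using \<pi> by (rule piecewiseE)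
  have gh: "g \<in> Homeo" "\<And>x. \<pi> (g x) = \<pi> x" using g unfolding fibre_group_def by auto
  then have cont: "continuous_on UNIV g" by (simp add: Homeo_iff)
  have "locally_constant (\<lambda>x. c (g x) = c x)"
    by (rule locally_constant_comp2[OF locally_constant_continuous[OF c(1) cont] c(1)])
  moreover have "c (g x) = c x \<longleftrightarrow> g x = x" for x
    using cocycle_separates[of c \<pi> "g x" x, OF c(2,3) gh(2)] by auto
  ultimately show ?thesis by (simp add: locally_constant_pred_iff)
qed

lemma fibre_group_locally_finite:
  assumes \<pi>: "piecewise \<pi>" and F: "finite F" "F \<subseteq> fibre_group \<pi>"
  shows "finite (generate homeo_group F)"
proof -
  obtain c where c[rule_format]: "locally_constant c" "\<forall>x. c x \<in> carrier G" "\<forall>x. \<pi> x = \<alpha> (c x) x" "finite (range c)"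
    using \<pi> by (rule piecewiseE)
  note sep = cocycle_separates[of c \<pi>, OF c(2,3)]
  txt \<open>On the fibre over \<open>y\<close>, labelled by \<open>c\<close>, the action of \<open>F\<close> is described by one of the finitely many
    states \<open>st y\<close>; a word in \<open>F\<close> moves labels in a way that depends only on the state.\<close>
  define st where "st y = {(g, i, j). g \<in> F \<and> (\<exists>x. \<pi> x = y \<and> c x = i \<and> c (g x) = j)}" for y
  define S where "S = {w \<in> fibre_group \<pi>. \<forall>x x'. st (\<pi> x) = st (\<pi> x') \<and> c x = c x' \<longrightarrow> c (w x) = c (w x')}"
  have fib: "\<pi> (w x) = \<pi> x" if "w \<in> fibre_group \<pi>" for w x using that unfolding fibre_group_def by simp
  have sub: "fibre_group \<pi> \<subseteq> Homeo" unfolding fibre_group_def by auto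
  have S1: "w \<in> fibre_group \<pi>" if "w \<in> S" for w using that unfolding S_def by blast
  have S2: "c (w x) = c (w x')" if "w \<in> S" "st (\<pi> x) = st (\<pi> x')" "c x = c x'" for w x x'
    using that unfolding S_def by blast
  have SI: "w \<in> S" if "w \<in> fibre_group \<pi>" "\<And>x x'. st (\<pi> x) = st (\<pi> x') \<Longrightarrow> c x = c x' \<Longrightarrow> c (w x) = c (w x')" for w
    using that unfolding S_def by blast
  have "w \<in> S" if "w \<in> generate homeo_group F" for w
    using that
  proof (induction rule: generate.induct)
    case one
    have "id \<in> S"
      unfolding S_def using subgroup_fibre_group unfolding subgroup_homeo_iff by simp
    moreover have "\<one>\<^bsub>homeo_group\<^esub> = (id :: 'x \<Rightarrow> 'x)" by (simp add: homeo_group_def)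
    ultimately show ?case by (simp only:)
  next
    case (incl g)
    then have g: "g \<in> fibre_group \<pi>" using F(2) by blast
    have "c (g x) = c (g x')" if s: "st (\<pi> x) = st (\<pi> x')" "c x = c x'" for x x'
    proof -
      have "(g, c x, c (g x)) \<in> st (\<pi> x)" unfolding st_def using incl by blast
      then have "(g, c x, c (g x)) \<in> st (\<pi> x')" using s(1) by simp
      then obtain u where u: "\<pi> u = \<pi> x'" "c u = c x" "c (g u) = c (g x)" unfolding st_def by auto
      then have "u = x'" using s(2) sep by simp
      then show ?thesis using u by simp
    qed
    with g show ?case unfolding S_def by blast
  next
    case (inv g)
    then have g: "g \<in> fibre_group \<pi>" using F(2) by blast
    then have gh: "g \<in> Homeo" using sub by blast
    then have bij: "g (finv g x) = x" "finv g (g x) = x" for x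
      by (simp_all add: Homeo_iff bij_is_surj surj_f_inv_f bij_is_inj)
    have "c (finv g x) = c (finv g x')" if s: "st (\<pi> x) = st (\<pi> x')" "c x = c x'" for x x'
    proof -
      have "\<pi> (finv g x) = \<pi> x" using fib[OF g, of "finv g x"] bij by simp
      then have "(g, c (finv g x), c x) \<in> st (\<pi> x)"
        unfolding st_def using inv bij by (auto intro!: exI[of _ "finv g x"])
      then have "(g, c (finv g x), c x) \<in> st (\<pi> x')" using s(1) by simp
      then obtain u where u: "\<pi> u = \<pi> x'" "c u = c (finv g x)" "c (g u) = c x" unfolding st_def by auto
      then have "g u = x'" using s(2) sep[of "g u" x'] fib[OF g, of u] by simp
      then have "u = finv g x'" using bij(2)[of u] by simp
      then show ?thesis using u by simp
    qed
    moreover have "finv g \<in> fibre_group \<pi>"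
      using g subgroup_fibre_group unfolding subgroup_homeo_iff by blast
    ultimately have "finv g \<in> S" unfolding S_def by blast
    then show ?case using homeo_group_inv[OF gh] by simp
  next
    case (eng v w)
    have vw: "v \<in> fibre_group \<pi>" "w \<in> fibre_group \<pi>" using eng.IH S1 by blast+
    then have "v \<circ> w \<in> fibre_group \<pi>"
      using subgroup_fibre_group unfolding subgroup_homeo_iff by simp
    then have "v \<circ> w \<in> S"
    proof (rule SI)
      fix x x' assume s: "st (\<pi> x) = st (\<pi> x')" "c x = c x'"
      have "c (w x) = c (w x')" by (rule S2[OF eng.IH(2) s])
      moreover have "st (\<pi> (w x)) = st (\<pi> (w x'))" using s(1) by (simp only: fib[OF vw(2)])
      ultimately have "c (v (w x)) = c (v (w x'))" by (intro S2[OF eng.IH(1)])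
      then show "c ((v \<circ> w) x) = c ((v \<circ> w) x')" by (simp only: comp_apply)
    qed
    moreover have "v \<otimes>\<^bsub>homeo_group\<^esub> w = v \<circ> w" by (simp add: homeo_group_def)
    ultimately show ?case by (simp only:)
  qed
  then have "generate homeo_group F \<subseteq> S" by (rule subsetI)
  \<comment> \<open>An element of \<open>S\<close> is recovered from its table of triples (state,
    old label, new label), because a label determines the point within its fibre. Only finitely many
    such tables exist.\<close>
  moreover have "finite S"
  proof (rule inj_on_finite)
    let ?gr = "\<lambda>w. range (\<lambda>x. (st (\<pi> x), c x, c (w x)))"
    let ?T = "Pow (Pow (F \<times> range c \<times> range c) \<times> range c \<times> range c)"
    show "finite ?T" using F(1) c(4) by simp
    have "st y \<in> Pow (F \<times> range c \<times> range c)" for y unfolding st_def by auto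
    then show "?gr ` S \<subseteq> ?T" by blast
    show "inj_on ?gr S"
    proof (intro inj_onI ext)
      fix v w x assume vw: "v \<in> S" "w \<in> S" "?gr v = ?gr w"
      have "(st (\<pi> x), c x, c (v x)) \<in> ?gr w" unfolding vw(3)[symmetric] by simp
      then obtain x' where x': "st (\<pi> x) = st (\<pi> x')" "c x = c x'" "c (v x) = c (w x')" by auto
      then have "c (w x) = c (v x)" using S2[OF vw(2) x'(1,2)] by simp
      moreover have "\<pi> (v x) = \<pi> (w x)" using fib[OF S1[OF vw(1)]] fib[OF S1[OF vw(2)]] by simp
      ultimately show "v x = w x" using sep by simp
    qed
  qed
  ultimately show ?thesis by (rule finite_subset)
qed

text \<open>The classes are the fibres of \<open>\<pi>\<close>, and equal push-forwards are equal
  class sums, so the greedy matching of \<open>f\<close> into \<open>g\<close> is exhaustive on both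
  sides. The bound 1 turns it into a map.\<close>

lemma push_eq_matching:
  assumes \<pi>: "piecewise \<pi>" and lc: "locally_constant f" "locally_constant g"
    and eq: "push \<pi> f = push \<pi> g" and f1: "\<forall>x. f x \<le> (1::nat)"
  shows "\<exists>\<rho>. piecewise \<rho> \<and> push \<rho> f = g \<and> (\<forall>x. f x \<noteq> 0 \<longrightarrow> \<pi> (\<rho> x) = \<pi> x)"
proof -
  obtain c where c[rule_format]: "locally_constant c" "\<forall>x. c x \<in> carrier G" "\<forall>x. \<pi> x = \<alpha> (c x) x" "finite (range c)"
    using \<pi> by (rule piecewiseE)
  define Q where "Q x y \<longleftrightarrow> \<pi> y = \<pi> x" for x y
  \<comment> \<open>The domain on which \<open>inv \<delta> \<otimes> \<gamma>\<close> takes the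
    point labelled \<open>\<gamma>\<close> to the point labelled \<open>\<delta>\<close> of the same
    fibre.\<close>
  define D where "D \<gamma> \<delta> = {x. c x = \<gamma> \<and> c (\<alpha> (inv \<delta> \<otimes> \<gamma>) x) = \<delta>}" for \<gamma> \<delta>
  have Q: "reflp Q" "symp Q" "transp Q" by (auto simp: Q_def reflp_def symp_def transp_def)
  have orb: "(\<Sum>y | Q x y. h y) = push \<pi> h (\<pi> x)" for h :: "'x \<Rightarrow> nat" and x
    by (simp add: push_def Q_def)
  have fin: "finite {y. Q x y}" for x using finite_fibre[OF \<pi>] by (simp add: Q_def)
  obtain L where L: "set L = (\<lambda>(\<gamma>, \<delta>). (D \<gamma> \<delta>, inv \<delta> \<otimes> \<gamma>)) ` (range c \<times> range c)"
    using finite_list[of "(\<lambda>(\<gamma>, \<delta>). (D \<gamma> \<delta>, inv \<delta> \<otimes> \<gamma>)) ` (range c \<times> range c)"] c(4) by auto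
  have cr: "\<gamma> \<in> carrier G" if "\<gamma> \<in> range c" for \<gamma> using that c(2) by auto
  have move: "clopen (D \<gamma> \<delta>) \<and> inv \<delta> \<otimes> \<gamma> \<in> carrier G \<and> (\<forall>x\<in>D \<gamma> \<delta>. Q x (\<alpha> (inv \<delta> \<otimes> \<gamma>) x))"
    if gd: "\<gamma> \<in> range c" "\<delta> \<in> range c" for \<gamma> \<delta>
  proof (intro conjI ballI)
    show *: "inv \<delta> \<otimes> \<gamma> \<in> carrier G" using gd cr by simp
    have "locally_constant (\<lambda>x. (c x = \<gamma>) \<and> (c (\<alpha> (inv \<delta> \<otimes> \<gamma>) x) = \<delta>))"
      by (intro locally_constant_comp2[where h = "(\<and>)"] locally_constant_comp[OF c(1)]
          locally_constant_comp[OF locally_constant_act[OF c(1) *]])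
    then show "clopen (D \<gamma> \<delta>)" unfolding D_def by (simp add: locally_constant_pred_iff)
    fix x assume "x \<in> D \<gamma> \<delta>"
    then have "\<pi> x = \<alpha> \<gamma> x" "\<pi> (\<alpha> (inv \<delta> \<otimes> \<gamma>) x) = \<alpha> \<delta> (\<alpha> (inv \<delta> \<otimes> \<gamma>) x)" using c(3) by (auto simp: D_def)
    then show "Q x (\<alpha> (inv \<delta> \<otimes> \<gamma>) x)" using gd cr by (simp add: Q_def act_mult act_act_inv)
  qed
  have "\<exists>g1 g2. eqv Q f g1 \<and> locally_constant g2 \<and> (\<forall>x. g x = g1 x + g2 x)"
  proof (rule orbit_sum_le_imp_eqv[OF Q fin, where L = L])
    show "\<forall>(D, \<gamma>)\<in>set L. clopen D \<and> \<gamma> \<in> carrier G \<and> (\<forall>x\<in>D. Q x (\<alpha> \<gamma> x))"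
      unfolding L using move by auto
    show "\<exists>(D, \<gamma>)\<in>set L. x \<in> D \<and> y = \<alpha> \<gamma> x" if xy: "Q x y" for x y
    proof -
      have "\<alpha> (c y) y = \<alpha> (c x) x" using xy c(3) by (simp add: Q_def)
      then have y: "y = \<alpha> (inv (c y) \<otimes> c x) x"
        using c(2) act_inv_act[of "c y" y] by (simp add: act_mult)
      then have "x \<in> D (c x) (c y)" by (simp add: D_def)
      then show ?thesis unfolding L
        by (intro bexI[of _ "(D (c x) (c y), inv (c y) \<otimes> c x)"]) (use y in auto)
    qed
  qed (use lc eq orb in auto)
  then obtain g1 g2 where g: "eqv Q f g1" "locally_constant g2" "\<forall>x. g x = g1 x + g2 x" by blast
  have "g2 x = 0" for x
  proof -
    have "(\<Sum>y | Q x y. f y) = (\<Sum>y | Q x y. g1 y)" by (rule eqv_orbit_sum[OF Q(2,3) fin g(1)])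
    moreover have "(\<Sum>y | Q x y. f y) = (\<Sum>y | Q x y. g y)" using eq orb by simp
    ultimately have "(\<Sum>y | Q x y. g2 y) = 0" using g(3) by (simp add: sum.distrib)
    then show ?thesis using fin[of x] by (simp add: Q_def)
  qed
  then have "g = g1" using g(3) by auto
  then show ?thesis using eqv_imp_piecewise[OF g(1) f1] by (simp add: Q_def)
qed

lemma push_indicator:
  assumes "piecewise \<rho>"
  shows "push \<rho> (indicator A) z = card {x\<in>A. \<rho> x = z}"
proof -
  have "push \<rho> (indicator A) z = (\<Sum>x | \<rho> x = z. if x \<in> A then 1 else 0)"
    unfolding push_def by (rule sum.cong) (simp_all add: indicator_def)
  also have "\<dots> = card ({x. \<rho> x = z} \<inter> A)"
    using finite_fibre[OF assms] by (simp add: sum.If_cases)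
  also have "{x. \<rho> x = z} \<inter> A = {x\<in>A. \<rho> x = z}" by auto
  finally show ?thesis .
qed

text \<open>The push-forward counts preimages in \<open>A\<close>; having at most one everywhere is
  injectivity, and having one exactly over \<open>B\<close> determines the image.\<close>

lemma push_indicator_bij:
  assumes "piecewise \<rho>" and eq: "push \<rho> (indicator A) = (indicator B :: 'x \<Rightarrow> nat)"
  shows "bij_betw \<rho> A B"
proof -
  have card: "card {x\<in>A. \<rho> x = z} = (if z \<in> B then 1 else 0)" for z
    using push_indicator[OF assms(1), of A z] eq by (cases "z \<in> B") simp_all
  have fin: "finite {x\<in>A. \<rho> x = z}" for z using finite_fibre[OF assms(1), of z] by simp
  have "inj_on \<rho> A"
  proof (rule inj_onI)
    fix x y assume "x \<in> A" "y \<in> A" "\<rho> x = \<rho> y"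
    moreover have "card {x'\<in>A. \<rho> x' = \<rho> x} \<le> Suc 0" using card[of "\<rho> x"] by simp
    ultimately show "x = y" using card_le_Suc0_iff_eq[OF fin, of "\<rho> x"] by simp
  qed
  moreover have "\<rho> x \<in> B" if "x \<in> A" for x
  proof -
    have "x \<in> {x'\<in>A. \<rho> x' = \<rho> x}" using that by simp
    then have "card {x'\<in>A. \<rho> x' = \<rho> x} \<noteq> 0" using fin[of "\<rho> x"] by auto
    then show ?thesis using card[of "\<rho> x"] by (simp split: if_splits)
  qed
  moreover have "z \<in> \<rho> ` A" if "z \<in> B" for z
  proof -
    have "card {x\<in>A. \<rho> x = z} \<noteq> 0" using card[of z] that by simp
    then show ?thesis by (auto simp: card_eq_0_iff)
  qed
  ultimately show ?thesis unfolding bij_betw_def by blast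
qed

lemma locally_constant_indicator: "clopen A \<Longrightarrow> locally_constant (indicator A :: 'x \<Rightarrow> nat)"
  using locally_constant_if[OF locally_constant_mem locally_constant_const[of 1] locally_constant_const[of 0]]
  by (simp add: indicator_def[abs_def] of_bool_def)

lemma equidec_indicator_image:
  assumes f: "piecewise f" "inj f" and A: "clopen A"
  shows "indicator A \<simeq> indicator (f ` A)"
proof -
  have "push f (indicator A) = (indicator (f ` A) :: 'x \<Rightarrow> nat)"
  proof
    fix z
    show "push f (indicator A) z = (indicator (f ` A) z :: nat)"
    proof (cases "z \<in> f ` A")
      case True
      then obtain x where "x \<in> A" "z = f x" by blast
      then have "{x\<in>A. f x = z} = {x}" using f(2) by (auto dest: injD)
      then show ?thesis using True by (simp add: push_indicator[OF f(1)])
    next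
      case False
      then have e: "{x\<in>A. f x = z} = {}" by auto
      have "push f (indicator A) z = (0::nat)" unfolding push_indicator[OF f(1)] e by simp
      then show ?thesis using False by simp
    qed
  qed
  then show ?thesis using equidec_push[OF f(1) locally_constant_indicator[OF A]] by simp
qed

lemma fibre_group_approx:
  assumes \<pi>: "piecewise \<pi>" and f: "f \<in> topological_full_group G \<alpha>" and P: "clopen_partition P"
    and eq: "\<And>A. A \<in> P \<Longrightarrow> push \<pi> (indicator A) = (push \<pi> (indicator (f ` A)) :: 'x \<Rightarrow> nat)"
  shows "\<exists>h\<in>fibre_group \<pi>. \<forall>A\<in>P. h ` A = f ` A"
proof -
  have fh: "f \<in> Homeo" "bij f" using f by (auto simp: topological_full_group_eq Homeo_iff)
  have PA: "clopen A" if "A \<in> P" for A using P that unfolding clopen_partition_def by auto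
  have "\<forall>A\<in>P. \<exists>\<rho>. piecewise \<rho> \<and> bij_betw \<rho> A (f ` A) \<and> (\<forall>x\<in>A. \<pi> (\<rho> x) = \<pi> x)"
  proof
    fix A assume A: "A \<in> P"
    have "\<forall>x. (indicator A x :: nat) \<le> 1" by (simp add: indicator_def)
    from push_eq_matching[OF \<pi> locally_constant_indicator[OF PA[OF A]]
        locally_constant_indicator[OF clopen_homeo_image[OF fh(1) PA[OF A]]] eq[OF A] this]
    obtain \<rho> where r: "piecewise \<rho>" "push \<rho> (indicator A) = (indicator (f ` A) :: 'x \<Rightarrow> nat)"
      "\<forall>x. (indicator A x :: nat) \<noteq> 0 \<longrightarrow> \<pi> (\<rho> x) = \<pi> x" by blast
    then show "\<exists>\<rho>. piecewise \<rho> \<and> bij_betw \<rho> A (f ` A) \<and> (\<forall>x\<in>A. \<pi> (\<rho> x) = \<pi> x)"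
      using push_indicator_bij[OF r(1,2)] by (auto simp: indicator_def)
  qed
  from bchoice[OF this] obtain \<rho> where
    r: "\<forall>A\<in>P. piecewise (\<rho> A) \<and> bij_betw (\<rho> A) A (f ` A) \<and> (\<forall>x\<in>A. \<pi> (\<rho> A x) = \<pi> x)" ..
  define h where "h x = \<rho> (THE A. A \<in> P \<and> x \<in> A) x" for x
  have uniq: "A = B" if "A \<in> P" "B \<in> P" "x \<in> A" "x \<in> B" for A B x
    using P that disjointD[of P A B] unfolding clopen_partition_def by auto
  have h: "h x = \<rho> A x" if "A \<in> P" "x \<in> A" for A x
  proof -
    have "(THE A. A \<in> P \<and> x \<in> A) = A"
    proof (rule the_equality)
      show "A \<in> P \<and> x \<in> A" using that by simp
      show "B = A" if "B \<in> P \<and> x \<in> B" for B using uniq[of B A x] that \<open>A \<in> P\<close> \<open>x \<in> A\<close> by simp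
    qed
    then show ?thesis by (simp add: h_def)
  qed
  have cover: "\<exists>A\<in>P. x \<in> A" for x
  proof -
    have "x \<in> \<Union>P" using P unfolding clopen_partition_def by simp
    then show ?thesis by simp
  qed
  have img: "h ` A = f ` A" if A: "A \<in> P" for A
  proof -
    have "h ` A = \<rho> A ` A" by (rule image_cong) (simp_all add: h[OF A])
    then show ?thesis using r A by (simp add: bij_betw_def)
  qed
  have "piecewise h" by (rule piecewise_partition[OF P, of \<rho>]) (use r h in auto)
  moreover have "inj h"
  proof (rule injI)
    fix x y assume xy: "h x = h y"
    obtain A B where A: "A \<in> P" "x \<in> A" and B: "B \<in> P" "y \<in> B" using cover by metis
    have "h x \<in> f ` A" "h y \<in> f ` B" using img A B by auto
    then obtain u v where uv: "u \<in> A" "h x = f u" "v \<in> B" "h y = f v" by auto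
    then have "u = v" using xy fh(2) by (metis bij_is_inj injD)
    then have "A = B" using uniq A B uv by metis
    then have "\<rho> A x = \<rho> A y" using xy h A B by metis
    moreover have "inj_on (\<rho> A) A" using r A by (simp add: bij_betw_def)
    ultimately show "x = y" using A B \<open>A = B\<close> by (simp add: inj_on_eq_iff)
  qed
  moreover have "surj h"
    unfolding surj_def
  proof
    fix y
    obtain A where "A \<in> P" "finv f y \<in> A" using cover by blast
    moreover have "f (finv f y) = y" using fh(2) by (simp add: bij_is_surj surj_f_inv_f)
    ultimately show "\<exists>x. y = h x" using img by (metis imageE imageI)
  qed
  ultimately have "h \<in> Homeo"
    using topological_full_groupI[of h] unfolding topological_full_group_eq by (simp add: bij_def)
  moreover have "\<pi> (h x) = \<pi> x" for x
  proof -
    obtain A where "A \<in> P" "x \<in> A" using cover by blast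
    then show ?thesis using r h by simp
  qed
  ultimately have "h \<in> fibre_group \<pi>" unfolding fibre_group_def by simp
  then show ?thesis using img by blast
qed

end

subsection \<open>The dense ample subgroup\<close>

context homeo_action
begin

text \<open>As each map identifies at least the points identified before, the fibre groups increase.
  A finite subset of the union thus lies in a single one of them, which reduces local finiteness and
  fullness to one map.\<close>

lemma ample_Union_fibre_groups:
  assumes cG: "countable (carrier G)" and cX: "countable {A :: 'x set. clopen A}"
    and \<tau>: "\<And>n. piecewise (\<tau> n)" "\<And>n x y. \<tau> n x = \<tau> n y \<Longrightarrow> \<tau> (Suc n) x = \<tau> (Suc n) y"
  shows "ample_group (\<Union>n. fibre_group (\<tau> n))" "(\<Union>n. fibre_group (\<tau> n)) \<subseteq> topological_full_group G \<alpha>"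
proof -
  let ?H = "\<Union>n. fibre_group (\<tau> n)"
  have step: "\<tau> m x = \<tau> m y" if "n \<le> m" "\<tau> n x = \<tau> n y" for n m x y
    using that by (induction rule: dec_induct) (auto intro: \<tau>(2))
  have mono: "fibre_group (\<tau> n) \<subseteq> fibre_group (\<tau> m)" if "n \<le> m" for n m
    unfolding fibre_group_def using step[OF that] by blast
  have fin: "\<exists>n. F \<subseteq> fibre_group (\<tau> n)" if "finite F" "F \<subseteq> ?H" for F
    using that
  proof (induction F)
    case (insert g F)
    then obtain n m where "F \<subseteq> fibre_group (\<tau> n)" "g \<in> fibre_group (\<tau> m)" by auto
    then have "insert g F \<subseteq> fibre_group (\<tau> (max n m))"
      using mono[of n "max n m"] mono[of m "max n m"] by auto
    then show ?case ..
  qed simp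
  have sub: "\<And>n. id \<in> fibre_group (\<tau> n)"
    "\<And>n f g. f \<in> fibre_group (\<tau> n) \<Longrightarrow> g \<in> fibre_group (\<tau> n) \<Longrightarrow> f \<circ> g \<in> fibre_group (\<tau> n)"
    "\<And>n f. f \<in> fibre_group (\<tau> n) \<Longrightarrow> finv f \<in> fibre_group (\<tau> n)"
    using subgroup_fibre_group unfolding subgroup_homeo_iff by simp_all
  have subgrp: "subgroup ?H homeo_group"
    unfolding subgroup_homeo_iff
  proof (intro conjI ballI)
    show "?H \<subseteq> Homeo" unfolding fibre_group_def by auto
    show "id \<in> ?H" using sub(1) by simp
    show "finv f \<in> ?H" if f: "f \<in> ?H" for f
    proof -
      obtain n where "f \<in> fibre_group (\<tau> n)" using f by blast
      from sub(3)[OF this] show ?thesis by blast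
    qed
    show "f \<circ> g \<in> ?H" if fg: "f \<in> ?H" "g \<in> ?H" for f g
    proof -
      obtain n where "{f, g} \<subseteq> fibre_group (\<tau> n)" using fin[of "{f, g}"] fg by auto
      then have "f \<circ> g \<in> fibre_group (\<tau> n)" using sub(2) by simp
      then show ?thesis by blast
    qed
  qed
  have pw: "piecewise g" if "g \<in> ?H" for g
    using that fibre_group_piecewise[OF \<tau>(1)] by auto
  then show "?H \<subseteq> topological_full_group G \<alpha>"
    unfolding topological_full_group_eq fibre_group_def by auto
  have "?H \<subseteq> {\<rho>. piecewise \<rho>}" using pw by (intro subsetI CollectI)
  then have count: "countable ?H" by (rule countable_subset[OF _ countable_piecewise[OF cG cX]])
  have lf: "finite (generate homeo_group F)" if F: "finite F" "F \<subseteq> ?H" for F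
  proof -
    obtain n where "F \<subseteq> fibre_group (\<tau> n)" using fin[OF F] ..
    then show ?thesis by (rule fibre_group_locally_finite[OF \<tau>(1) F(1)])
  qed
  have full: "h \<in> ?H" if h: "h \<in> Homeo" and P: "clopen_partition P" "\<forall>A\<in>P. \<exists>g\<in>?H. \<forall>x\<in>A. h x = g x" for h P
  proof -
    from bchoice[OF P(2)[unfolded Bex_def]]
    obtain g where g: "\<forall>A\<in>P. g A \<in> ?H \<and> (\<forall>x\<in>A. h x = g A x)" ..
    \<comment> \<open>Finitely many local models \<open>g A\<close> lie in one fibre group, whose
      defining condition is checked pointwise.\<close>
    have "finite (g ` P)" using P(1) unfolding clopen_partition_def by simp
    moreover have "g ` P \<subseteq> ?H" using g by blast
    ultimately obtain n where n: "g ` P \<subseteq> fibre_group (\<tau> n)" using fin by metis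
    have "\<tau> n (h x) = \<tau> n x" for x
    proof -
      have "x \<in> \<Union>P" using P(1) unfolding clopen_partition_def by simp
      then obtain A where A: "A \<in> P" "x \<in> A" ..
      then have "g A \<in> fibre_group (\<tau> n)" "h x = g A x" using n g by auto
      then show ?thesis unfolding fibre_group_def by simp
    qed
    then have "h \<in> fibre_group (\<tau> n)" using h unfolding fibre_group_def by simp
    then show ?thesis by blast
  qed
  have fixed: "clopen {x. g x = x}" if "g \<in> ?H" for g
    using that fibre_group_clopen_fixed[OF \<tau>(1)] by auto
  show "ample_group ?H"
    unfolding ample_group_def locally_finite_group_def
  proof (intro conjI allI ballI impI)
    show "countable ?H" "subgroup ?H homeo_group" by (rule count, rule subgrp)
    show "finite (generate homeo_group F)" if "finite F \<and> F \<subseteq> ?H" for F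
      using that by (intro lf) simp_all
    show "h \<in> ?H" if "h \<in> Homeo"
      "\<exists>P. clopen_partition P \<and> (\<forall>A\<in>P. \<exists>g\<in>?H. \<forall>x\<in>A. h x = g x)" for h
      using that(2) by (elim exE conjE) (rule full[OF that(1)])
    show "clopen {x. g x = x}" if "g \<in> ?H" for g by (rule fixed[OF that])
  qed
qed

lemma countable_equidec_pairs:
  assumes "countable {A :: 'x set. clopen A}"
  obtains a b :: "nat \<Rightarrow> 'x set" where "\<And>n. clopen (a n)" "\<And>n. clopen (b n)"
    "\<And>n. indicator (a n) \<simeq> indicator (b n)"
    "\<And>A B. clopen A \<Longrightarrow> clopen B \<Longrightarrow> indicator A \<simeq> indicator B \<Longrightarrow> \<exists>n. a n = A \<and> b n = B"
proof -
  let ?S = "{(A, B). clopen A \<and> clopen B \<and> indicator A \<simeq> indicator B} :: ('x set \<times> 'x set) set"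
  let ?e = "from_nat_into ?S"
  have "?S \<subseteq> {A. clopen A} \<times> {A. clopen A}" by auto
  moreover have "countable ({A :: 'x set. clopen A} \<times> {A :: 'x set. clopen A})"
    using assms by (intro countable_SIGMA)
  ultimately have cS: "countable ?S" by (rule countable_subset)
  have "clopen ({} :: 'x set)" by (simp add: clopen_def)
  \<comment> \<open>The empty pair makes the set nonempty, so that \<open>from_nat_into\<close>
    enumerates it, possibly with repetitions.\<close>
  then have "({}, {}) \<in> ?S" using equidec_refl[OF locally_constant_indicator] by simp
  then have ne: "?S \<noteq> {}" by blast
  have mem: "?e n \<in> ?S" for n by (rule from_nat_into[OF ne])
  have surj: "\<exists>n. ?e n = p" if "p \<in> ?S" for p using from_nat_into_surj[OF cS that] .
  show ?thesis
  proof (rule that[of "\<lambda>n. fst (?e n)" "\<lambda>n. snd (?e n)"])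
    show "clopen (fst (?e n))" "clopen (snd (?e n))" "indicator (fst (?e n)) \<simeq> indicator (snd (?e n))" for n
      using mem[of n] by (simp_all add: case_prod_beta)
    show "\<exists>n. fst (?e n) = A \<and> snd (?e n) = B"
      if "clopen A" "clopen B" "indicator A \<simeq> indicator B" for A B
    proof -
      have "(A, B) \<in> ?S" using that by simp
      from surj[OF this] obtain n where "?e n = (A, B)" ..
      then show ?thesis by (intro exI[of _ n]) simp
    qed
  qed
qed

text \<open>All equidecomposable pairs of clopen sets are enumerated, and a sequence of maps is
  chosen whose \<open>n\<close>-th step equalises the fibre counts of the \<open>n\<close>-th pair.
  The union of the fibre groups is ample, and dense because each element of the full group involves
  only finitely many pairs.\<close>

lemma exists_dense_ample:
  assumes cG: "countable (carrier G)" and cX: "countable {A :: 'x set. clopen A}"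
    and unp: "type_unperforated G \<alpha>" and canc: "type_cancellative G \<alpha>"
  shows "\<exists>H. dense_subgroup_of H (topological_full_group G \<alpha>) \<and> ample_group H"
proof -
  obtain a b :: "nat \<Rightarrow> 'x set" where ab: "\<And>n. clopen (a n)" "\<And>n. clopen (b n)"
    "\<And>n. indicator (a n) \<simeq> indicator (b n)"
    "\<And>A B. clopen A \<Longrightarrow> clopen B \<Longrightarrow> indicator A \<simeq> indicator B \<Longrightarrow> \<exists>n. a n = A \<and> b n = B"
    using countable_equidec_pairs[OF cX] by metis
  define d :: "nat \<Rightarrow> 'x \<Rightarrow> int" where "d n = (\<lambda>x. int (indicator (a n) x) - int (indicator (b n) x))" for n
  define R where "R n \<pi> \<pi>' \<longleftrightarrow> (\<exists>\<rho>. piecewise \<rho> \<and> \<pi>' = (\<lambda>x. \<rho> (\<pi> x)) \<and> push \<pi>' (d n) = (\<lambda>x. 0))"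
    for n :: nat and \<pi> \<pi>'
  have "\<exists>\<tau>. \<forall>n. piecewise (\<tau> n) \<and> R n (\<tau> n) (\<tau> (Suc n))"
  proof (rule dependent_nat_choice)
    show "\<exists>\<pi>. piecewise \<pi>" using piecewise_id by blast
    fix \<pi> and n :: nat assume \<pi>: "piecewise \<pi>"
    from equidec_push_zero[OF unp canc \<pi> ab(3)[of n]]
    obtain \<rho> where \<rho>: "piecewise \<rho>" "push (\<lambda>x. \<rho> (\<pi> x)) (d n) = (\<lambda>x. 0)" unfolding d_def by blast
    show "\<exists>\<pi>'. piecewise \<pi>' \<and> R n \<pi> \<pi>'"
      unfolding R_def
      by (intro exI[of _ "\<lambda>x. \<rho> (\<pi> x)"] conjI piecewise_comp[OF \<rho>(1) \<pi>] exI[of _ \<rho>] \<rho> refl)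
  qed
  then obtain \<tau> where P: "\<And>n. piecewise (\<tau> n)" "\<And>n. R n (\<tau> n) (\<tau> (Suc n))" by blast
  have P2: "\<tau> (Suc n) x = \<tau> (Suc n) y" if "\<tau> n x = \<tau> n y" for n x y
    using P(2)[of n] that unfolding R_def by auto
  \<comment> \<open>Later maps factor through \<open>\<tau> (Suc n)\<close>, and a push-forward of 0
    is 0, so a discrepancy once removed never returns.\<close>
  have kill: "push (\<tau> m) (d n) = (\<lambda>x. 0)" if "n < m" for n m
  proof -
    have "Suc n \<le> m" using that by simp
    then show ?thesis
    proof (induction rule: dec_induct)
      case base
      then show ?case using P(2)[of n] unfolding R_def by blast
    next
      case (step k)
      obtain \<rho> where r: "piecewise \<rho>" "\<tau> (Suc k) = (\<lambda>x. \<rho> (\<tau> k x))" using P(2)[of k] unfolding R_def by blast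
      then show ?case using push_comp[OF r(1) P(1)[of k], of "d n"] step.IH by (simp add: push_zero)
    qed
  qed
  let ?H = "\<Union>n. fibre_group (\<tau> n)"
  have ample: "ample_group ?H" "?H \<subseteq> topological_full_group G \<alpha>"
    using ample_Union_fibre_groups[of \<tau>, OF cG cX P(1) P2] by simp_all
  have "\<exists>h\<in>?H. \<forall>A\<in>\<A>. h ` A = f ` A"
    if f: "f \<in> topological_full_group G \<alpha>" and \<A>: "clopen_partition \<A>" for f \<A>
  proof -
    have fh: "f \<in> Homeo" "piecewise f" "inj f"
      using f by (auto simp: topological_full_group_eq Homeo_iff bij_is_inj)
    have cl: "clopen A" if "A \<in> \<A>" for A using \<A> that unfolding clopen_partition_def by simp
    have "\<forall>A\<in>\<A>. \<exists>n. a n = A \<and> b n = f ` A"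
    proof
      fix A assume A: "A \<in> \<A>"
      show "\<exists>n. a n = A \<and> b n = f ` A"
        by (rule ab(4)[OF cl[OF A] clopen_homeo_image[OF fh(1) cl[OF A]]
              equidec_indicator_image[OF fh(2,3) cl[OF A]]])
    qed
    from bchoice[OF this] obtain n where n: "\<forall>A\<in>\<A>. a (n A) = A \<and> b (n A) = f ` A" ..
    have fin: "finite (n ` \<A>)" using \<A> unfolding clopen_partition_def by simp
    \<comment> \<open>Pair \<open>n\<close> is settled only from stage \<open>Suc n\<close> on,
      hence the successor.\<close>
    define m where "m = Suc (Max (n ` \<A>))"
    have lt: "n A < m" if "A \<in> \<A>" for A
      using Max_ge[OF fin, of "n A"] that by (simp add: m_def)
    have "push (\<tau> m) (indicator A) = (push (\<tau> m) (indicator (f ` A)) :: 'x \<Rightarrow> nat)" if A: "A \<in> \<A>" for A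
    proof
      fix x
      have "d (n A) = (\<lambda>x. int (indicator A x) - int (indicator (f ` A) x))"
        unfolding d_def using n A by simp
      then have "push (\<tau> m) (\<lambda>x. int (indicator A x) - int (indicator (f ` A) x)) = (\<lambda>x. 0)"
        using kill[OF lt[OF A]] by simp
      then have "int (push (\<tau> m) (indicator A) x) - int (push (\<tau> m) (indicator (f ` A)) x) = 0"
        unfolding push_diff push_of_nat by (rule fun_cong)
      then show "push (\<tau> m) (indicator A) x = (push (\<tau> m) (indicator (f ` A)) x :: nat)" by linarith
    qed
    from fibre_group_approx[OF P(1) f \<A> this] show ?thesis by blast
  qed
  then have "dense_subgroup_of ?H (topological_full_group G \<alpha>)"
    using ample dense_subgroup_of_iff[of "topological_full_group G \<alpha>" ?H]
    unfolding ample_group_def locally_finite_group_def by (simp add: topological_full_group_eq)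
  with ample(1) show ?thesis by blast
qed

end

theorem theoremp:
  fixes G :: "('g, 'b) monoid_scheme"
    and \<alpha> :: "'g \<Rightarrow> 'x::topological_space \<Rightarrow> 'x"
  assumes "group G" and "countable (carrier G)"
    and "\<alpha> \<in> hom G homeo_group"
    and "compact (UNIV :: 'x set)"
    and "metrizable_space (euclidean :: 'x topology)"
    and "zero_dimensional_space TYPE('x)"
  shows "((\<exists>H. dense_subgroup_of H (topological_full_group G \<alpha>) \<and> locally_finite_group H)
            \<longleftrightarrow> (\<exists>H. dense_subgroup_of H (topological_full_group G \<alpha>) \<and> ample_group H))
       \<and> ((\<exists>H. dense_subgroup_of H (topological_full_group G \<alpha>) \<and> ample_group H)
            \<longleftrightarrow> (type_unperforated G \<alpha> \<and> type_cancellative G \<alpha>))"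
proof -
  interpret group G by (rule assms(1))
  interpret homeo_action G \<alpha> by unfold_locales (rule assms(3,4))+
  \<comment> \<open>The equivalences are closed up by the cycle (iii), (ii), (i), (iii).\<close>
  have 1: "\<exists>H. dense_subgroup_of H (topological_full_group G \<alpha>) \<and> ample_group H"
    if "type_unperforated G \<alpha> \<and> type_cancellative G \<alpha>"
    using exists_dense_ample[OF assms(2) countable_clopen[OF assms(4,5)]] that by simp
  have 2: "\<exists>H. dense_subgroup_of H (topological_full_group G \<alpha>) \<and> locally_finite_group H"
    if "\<exists>H. dense_subgroup_of H (topological_full_group G \<alpha>) \<and> ample_group H"
    using that unfolding ample_group_def by (elim exE conjE) (intro exI conjI)
  have 3: "type_unperforated G \<alpha> \<and> type_cancellative G \<alpha>"
    if "\<exists>H. dense_subgroup_of H (topological_full_group G \<alpha>) \<and> locally_finite_group H"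
    using that dense_locally_finite_imp_unperforated dense_locally_finite_imp_cancellative
    by (elim exE conjE) (intro conjI)
  show ?thesis
    using 1 2 3 by (intro conjI[OF iffI iffI]) simp_all
qed

end
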